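(* Let $d=1$ and $1<p<q<5$. Assume further that $M'(0)\neq 0$. Then: if $p<7/3$, $$\lim_{R\to\infty}\langle L_0\psi_R,\psi_R\rangle=\langle L_0\phi_0,\phi_0\rangle+\frac{\|\phi_0\|_{L^2}^4}{M'(0)};$$ if $p\ge 7/3$, $$\lim_{R\to\infty}\langle L_0\psi_R,\psi_R\rangle=\langle L_0\phi_0,\phi_0\rangle .$$
   Context: For $\omega\ge 0$, $\phi_\omega$ denotes the unique positive, even, decreasing (and decaying to $0$ at infinity) solution on $\mathbb{R}$ of $-\phi''+\omega\phi+|\phi|^{p-1}\phi-|\phi|^{q-1}\phi=0$; for $p<5$ one has $\phi_0\in H^1(\mathbb{R})$. For $\omega>0$, $M(\omega):=\frac12\|\phi_\omega\|_{L^2}^2$ and $\eta_\omega:=\partial_\omega\phi_\omega$. $M'(0):=\lim_{\omega\downarrow0}M'(\omega)$, a limit known to exist in $[-\infty,\infty)$. $\eta_0(x):=\lim_{\omega\downarrow0}\eta_\omega(x)$ for $x\in\mathbb{R}$; this pointwise limit exists and is a smooth even function on $\mathbb{R}$. $L_0=-\partial_x^2+p\phi_0^{p-1}-q\phi_0^{q-1}$, with $\langle L_0v,v\rangle=\int_{\mathbb{R}}\bigl(|v'|^2+p\phi_0^{p-1}v^2-q\phi_0^{q-1}v^2\bigr)dx$ for real-valued $v\in H^1(\mathbb{R})$. Let $\chi\in C_c^\infty(\mathbb{R})$ be an even function with $0\le\chi\le1$, $\chi(x)=1$ for $|x|\le1$ and $\chi(x)=0$ for $|x|\ge2$, and set $\chi_R(x):=\chi(x/R)$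 for $R>0$. Define (for those $R$ with $(\phi_0,\chi_R\eta_0)_{L^2}\ne0$, in particular for all large $R$) $$\psi_R:=\phi_0+\beta_R\chi_R\eta_0,\qquad \beta_R:=-\frac{\|\phi_0\|_{L^2}^2}{(\phi_0,\chi_R\eta_0)_{L^2}}.$$ *)

theory Defs
  imports "HOL-Analysis.Analysis"
begin

text \<open>Positive, even, decreasing, decaying classical solutions of
  \<open>- f'' + \<omega> f + |f|^(p-1) f - |f|^(q-1) f = 0\<close> on the real line.  For
  \<open>1 < p < q < 5\<close> and \<open>\<omega> \<ge> 0\<close> there is exactly one.\<close>

definition standing_wave :: "real \<Rightarrow> real \<Rightarrow> real \<Rightarrow> (real \<Rightarrow> real) \<Rightarrow> bool" where
  "standing_wave p q \<omega> f \<longleftrightarrow>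
     f differentiable_on UNIV \<and> deriv f differentiable_on UNIV \<and>
     (\<forall>x. - deriv (deriv f) x + \<omega> * f x
          + \<bar>f x\<bar> powr (p - 1) * f x - \<bar>f x\<bar> powr (q - 1) * f x = 0) \<and>
     (\<forall>x. f x > 0) \<and>
     (\<forall>x. f (- x) = f x) \<and>
     antimono_on {0..} f \<and>
     (f \<longlongrightarrow> 0) at_infinity"

definition L2_inner :: "(real \<Rightarrow> real) \<Rightarrow> (real \<Rightarrow> real) \<Rightarrow> real" where
  "L2_inner f g = (LINT x|lborel. f x * g x)"

definition L2_norm :: "(real \<Rightarrow> real) \<Rightarrow> real" where
  "L2_norm f = sqrt (L2_inner f f)"

text \<open>In the following, \<open>\<phi> \<omega>\<close> is the standing wave of frequency \<open>\<omega> \<ge> 0\<close>.\<close>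

definition mass :: "(real \<Rightarrow> real \<Rightarrow> real) \<Rightarrow> real \<Rightarrow> real" where
  "mass \<phi> \<omega> = 1 / 2 * (L2_norm (\<phi> \<omega>))\<^sup>2"

text \<open>\<open>M'(0)\<close> is the limit of \<open>M'(\<omega>)\<close> as \<open>\<omega>\<close> decreases to \<open>0\<close>, not a derivative at \<open>0\<close>.
  It is extended real because the value \<open>-\<infinity>\<close> occurs.\<close>

definition mass_deriv0 :: "(real \<Rightarrow> real \<Rightarrow> real) \<Rightarrow> ereal" where
  "mass_deriv0 \<phi> = Lim (at_right 0) (\<lambda>\<omega>. ereal (deriv (mass \<phi>) \<omega>))"

definition eta :: "(real \<Rightarrow> real \<Rightarrow> real) \<Rightarrow> real \<Rightarrow> real \<Rightarrow> real" where
  "eta \<phi> \<omega> x = deriv (\<lambda>w. \<phi> w x) \<omega>"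

definition eta0 :: "(real \<Rightarrow> real \<Rightarrow> real) \<Rightarrow> real \<Rightarrow> real" where
  "eta0 \<phi> x = Lim (at_right 0) (\<lambda>\<omega>. eta \<phi> \<omega> x)"

text \<open>The quadratic form of \<open>L\<^sub>0 = - d\<^sup>2/dx\<^sup>2 + p f^(p-1) - q f^(q-1)\<close>, where \<open>f\<close> is the standing
  wave at frequency \<open>0\<close>.  It is written with the classical derivative, which is the weak
  derivative for differentiable \<open>v\<close> in \<open>H\<^sup>1\<close>; it is only applied to such \<open>v\<close>.\<close>

definition L0_form :: "real \<Rightarrow> real \<Rightarrow> (real \<Rightarrow> real) \<Rightarrow> (real \<Rightarrow> real) \<Rightarrow> real" where
  "L0_form p q f v =
     (LINT x|lborel. (deriv v x)\<^sup>2 + p * f x powr (p - 1) * (v x)\<^sup>2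
                                 - q * f x powr (q - 1) * (v x)\<^sup>2)"

text \<open>The last condition contains the compactness of the support.\<close>

definition cutoff :: "(real \<Rightarrow> real) \<Rightarrow> bool" where
  "cutoff \<theta> \<longleftrightarrow>
     (\<forall>n. (deriv ^^ n) \<theta> differentiable_on UNIV) \<and>
     (\<forall>x. \<theta> (- x) = \<theta> x) \<and>
     (\<forall>x. 0 \<le> \<theta> x \<and> \<theta> x \<le> 1) \<and>
     (\<forall>x. \<bar>x\<bar> \<le> 1 \<longrightarrow> \<theta> x = 1) \<and>
     (\<forall>x. \<bar>x\<bar> \<ge> 2 \<longrightarrow> \<theta> x = 0)"

text \<open>\<open>\<beta>\<^sub>R\<close> is meaningful only when the denominator is nonzero, which holds for all large \<open>R\<close>.\<close>

definition beta :: "(real \<Rightarrow> real \<Rightarrow> real) \<Rightarrow> (real \<Rightarrow> real) \<Rightarrow> real \<Rightarrow> real" where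
  "beta \<phi> \<theta> R = - ((L2_norm (\<phi> 0))\<^sup>2 / L2_inner (\<phi> 0) (\<lambda>x. \<theta> (x / R) * eta0 \<phi> x))"

definition psi :: "(real \<Rightarrow> real \<Rightarrow> real) \<Rightarrow> (real \<Rightarrow> real) \<Rightarrow> real \<Rightarrow> real \<Rightarrow> real" where
  "psi \<phi> \<theta> R x = \<phi> 0 x + beta \<phi> \<theta> R * (\<theta> (x / R) * eta0 \<phi> x)"

end

theory Submission
  imports Defs
begin

text \<open>
  Write \<open>g v = 2/(q+1) v^(q-1) - 2/(p+1) v^(p-1)\<close>. The energy identity is
  \<open>\<phi>'\<^sup>2 = \<phi>\<^sup>2 (\<omega> - g \<phi>)\<close>, so \<open>\<phi> \<omega> 0\<close> inverts \<open>g\<close> and Gronwall's inequality makes \<open>\<phi> \<omega> x\<close>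
  differentiable in \<open>\<omega>\<close>, continuously down to \<open>\<omega> = 0\<close>, the derivative \<open>\<eta>\<close> solving
  \<open>\<eta>'' = (\<omega> + p \<phi>^(p-1) - q \<phi>^(q-1)) \<eta> + \<phi>\<close>. Since \<open>\<phi>'\<close> solves the homogeneous equation,
  \<open>(\<eta> / \<phi>')' = 1 / (2 (\<omega> - g \<phi>))\<close>. With \<open>s = 2/(p-1)\<close> this gives \<open>\<phi>\<^sub>0 ~ |x|^(-s)\<close> and
  \<open>\<eta>\<^sub>0 ~ -|x|^(2-s)\<close>, with upper bounds for \<open>\<phi> \<eta>\<close> uniform in small \<open>\<omega>\<close>.

  With \<open>\<chi>\<close> the rescaled cutoff, integration by parts yields \<open>\<langle>L\<^sub>0 \<phi>\<^sub>0, \<chi> \<eta>\<^sub>0\<rangle> = - (\<phi>\<^sub>0, \<chi> \<phi>\<^sub>0) + o(1)\<close> and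
  \<open>\<langle>L\<^sub>0 (\<chi> \<eta>\<^sub>0), \<chi> \<eta>\<^sub>0\<rangle> = - (\<phi>\<^sub>0, \<chi>\<^sup>2 \<eta>\<^sub>0) + O(R^(3-2s))\<close>. For \<open>p < 7/3\<close>, that is \<open>s > 3/2\<close>, everything
  converges and \<open>(\<phi>\<^sub>0, \<eta>\<^sub>0) = M'(0)\<close>. Otherwise \<open>(\<phi>\<^sub>0, \<chi> \<eta>\<^sub>0)\<close> tends to \<open>-\<infinity>\<close> at least as fast as
  \<open>R^(3-2s)\<close>, so that \<open>\<beta>\<^sub>R\<close> and \<open>\<beta>\<^sub>R\<^sup>2 \<langle>L\<^sub>0 (\<chi> \<eta>\<^sub>0), \<chi> \<eta>\<^sub>0\<rangle>\<close> vanish in the limit.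
\<close>

section \<open>A single standing wave\<close>

text \<open>The exponents produce the thresholds. At \<open>\<omega> = 0\<close>,
  \<open>- g \<phi>\<close> is of size \<open>|x|^(-2)\<close>, so \<open>\<eta> / \<phi>'\<close>
  grows like \<open>|x|^3\<close>, while \<open>\<phi>'\<close> decays like
  \<open>|x|^(-s-1)\<close>. Thus \<open>\<phi>^2\<close> is integrable when \<open>2 s > 1\<close>,
  that is \<open>p < 5\<close>, and \<open>\<phi> \<eta>\<close> when \<open>2 s - 2 > 1\<close>,
  that is \<open>p < 7/3\<close>. The obstacle is that \<open>M'(0)\<close> is a limit of
  derivatives at \<open>\<omega> > 0\<close>, where the waves decay exponentially, whereas at
  \<open>\<omega> = 0\<close> they decay only polynomially. Dominated convergence needs one majorant
  for both regimes. It comes from comparing \<open>\<omega> - g \<phi>\<close> with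
  \<open>\<omega> + m \<phi>^(p-1)\<close>, which decreases along the half-line, and from bounding
  \<open>\<eta>\<close> through \<open>\<phi>\<close> itself before the decay of
  \<open>\<phi>\<close> is inserted. No implicit function theorem is invoked for the dependence on
  \<open>\<omega>\<close>: \<open>\<eta>\<close> is built as a solution of the linearised equation
  and then recognised as the derivative, with a remainder uniform over pairs of frequencies in
  \<open>[0, 1]\<close>. This uniformity carries the derivative down to the endpoint
  \<open>\<omega> = 0\<close>.\<close>

locale double_power =
  fixes p q :: real
  assumes p_gt_1: "1 < p" and p_lt_q: "p < q"
begin

section \<open>The potential \<open>g\<close> and its invertibility where it is nonnegative\<close>

definition g :: "real \<Rightarrow> real" where
  "g v = 2 / (q + 1) * v powr (q - 1) - 2 / (p + 1) * v powr (p - 1)"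

definition g' :: "real \<Rightarrow> real" where
  "g' v = 2 / (q + 1) * ((q - 1) * v powr (q - 2)) - 2 / (p + 1) * ((p - 1) * v powr (p - 2))"

definition nl :: "real \<Rightarrow> real" where
  "nl v = v powr p - v powr q"

definition nl' :: "real \<Rightarrow> real" where
  "nl' v = p * v powr (p - 1) - q * v powr (q - 1)"

lemma g_has_derivative: "v > 0 \<Longrightarrow> (g has_real_derivative g' v) (at v)"
proof -
  assume v: "v > 0"
  have "(g has_real_derivative 2 / (q + 1) * ((q - 1) * v powr (q - 1 - 1)) - 2 / (p + 1) * ((p - 1) * v powr (p - 1 - 1))) (at v)"
    unfolding g_def by (intro DERIV_diff DERIV_cmult has_real_derivative_powr v)
  moreover have "q - 1 - 1 = q - 2" "p - 1 - 1 = p - 2" by simp_all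
  ultimately show ?thesis unfolding g'_def by (simp only:)
qed

lemma nl_has_derivative: "v > 0 \<Longrightarrow> (nl has_real_derivative nl' v) (at v)"
  unfolding nl_def nl'_def
  by (auto intro!: derivative_eq_intros simp: field_simps)

lemma g_times_square: "v > 0 \<Longrightarrow> v\<^sup>2 * g v = 2 / (q + 1) * v powr (q + 1) - 2 / (p + 1) * v powr (p + 1)"
proof -
  assume v: "v > 0"
  have *: "v\<^sup>2 * v powr (r - 1) = v powr (r + 1)" for r
  proof -
    have "v\<^sup>2 * v powr (r - 1) = v powr 2 * v powr (r - 1)" using v by (simp add: powr_numeral)
    also have "\<dots> = v powr (r + 1)" by (simp add: powr_add [symmetric] add.commute)
    finally show ?thesis .
  qed
  have "v\<^sup>2 * g v = 2 / (q + 1) * (v\<^sup>2 * v powr (q - 1)) - 2 / (p + 1) * (v\<^sup>2 * v powr (p - 1))"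
    unfolding g_def by (simp add: algebra_simps)
  then show ?thesis unfolding * .
qed

lemma nl_factor: "v > 0 \<Longrightarrow> nl v = v * (v powr (p - 1) - v powr (q - 1))"
  unfolding nl_def by (simp add: right_diff_distrib powr_diff)

text \<open>Multiplication by \<open>v\<close> turns \<open>g'\<close> into
  \<open>(p - 1) * g v\<close> plus \<open>q - p\<close> times the positive \<open>q\<close>-term of
  \<open>g\<close>.\<close>

lemma g'_pos:
  assumes "v > 0" "g v \<ge> 0"
  shows "g' v > 0"
proof -
  have *: "v * v powr (r - 2) = v powr (r - 1)" for r
    using assms(1) by (simp add: powr_diff powr_numeral power2_eq_square field_simps)
  define A B where "A = 2 / (q + 1) * v powr (q - 1)" and "B = 2 / (p + 1) * v powr (p - 1)"
  have "v * g' v = (q - 1) * (2 / (q + 1) * (v * v powr (q - 2))) - (p - 1) * (2 / (p + 1) * (v * v powr (p - 2)))"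
    unfolding g'_def by (simp only: algebra_simps)
  also have "\<dots> = (q - 1) * A - (p - 1) * B"
    unfolding * A_def B_def ..
  also have "\<dots> = (p - 1) * (A - B) + (q - p) * A" by (simp add: algebra_simps)
  also have "A - B = g v" unfolding g_def A_def B_def ..
  also have "(p - 1) * g v + (q - p) * A > 0"
    using assms p_gt_1 p_lt_q unfolding A_def by (intro add_nonneg_pos mult_nonneg_nonneg mult_pos_pos) auto
  finally show ?thesis using assms(1) by (simp add: zero_less_mult_iff)
qed

text \<open>Factoring out \<open>v powr (p - 1)\<close> leaves a condition that is monotone in
  \<open>v\<close>. Hence the region where \<open>g\<close> is nonnegative is upward closed, and
  \<open>g\<close> increases strictly on all of it.\<close>

lemma g_nonneg_iff:
  assumes "v > 0"
  shows "g v \<ge> 0 \<longleftrightarrow> v powr (q - p) \<ge> (q + 1) / (p + 1)"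
proof -
  have "v powr (q - 1) = v powr (p - 1) * v powr (q - p)"
    by (simp add: powr_add [symmetric])
  then have "g v = v powr (p - 1) * (2 / (q + 1)) * (v powr (q - p) - (q + 1) / (p + 1))"
    unfolding g_def using p_gt_1 p_lt_q by (simp add: field_simps)
  moreover have "v powr (p - 1) * (2 / (q + 1)) > 0"
    using assms p_gt_1 p_lt_q by simp
  ultimately show ?thesis by (smt (verit) mult_nonneg_nonneg mult_pos_neg)
qed

lemma g_nonneg_mono:
  assumes "v > 0" "g v \<ge> 0" "v \<le> w"
  shows "g w \<ge> 0"
proof -
  have "v powr (q - p) \<le> w powr (q - p)"
    using assms p_lt_q by (intro powr_mono2) auto
  then show ?thesis using assms g_nonneg_iff[of v] g_nonneg_iff[of w] by auto
qed

lemma g_strict_mono: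
  assumes "v > 0" "g v \<ge> 0" "v < w"
  shows "g v < g w"
proof (rule DERIV_pos_imp_increasing[OF assms(3)])
  fix x assume x: "v \<le> x" "x \<le> w"
  then show "\<exists>y. (g has_real_derivative y) (at x) \<and> 0 < y"
    using g_has_derivative[of x] g'_pos[of x] g_nonneg_mono[of v x] assms by auto
qed

lemma g_inj:
  assumes "v > 0" "w > 0" "g v = g w" "g v \<ge> 0"
  shows "v = w"
  using g_strict_mono[of v w] g_strict_mono[of w v] assms by (cases v w rule: linorder_cases) auto

end

locale standing = double_power +
  fixes w :: real and f :: "real \<Rightarrow> real"
  assumes w_nonneg: "w \<ge> 0" and sw: "standing_wave p q w f"
begin

lemma pos: "f x > 0" and even: "f (- x) = f x" and decay: "(f \<longlongrightarrow> 0) at_infinity"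
  and decr: "0 \<le> x \<Longrightarrow> x \<le> y \<Longrightarrow> f y \<le> f x"
  using sw unfolding standing_wave_def monotone_on_def by auto

lemma deriv1: "(f has_real_derivative deriv f x) (at x)"
  using sw unfolding standing_wave_def
  by (simp add: DERIV_deriv_iff_real_differentiable differentiable_on_def)

lemma deriv2: "(deriv f has_real_derivative (w * f x + nl (f x))) (at x)"
proof -
  have "deriv f differentiable at x" and eq: "- deriv (deriv f) x + w * f x
          + \<bar>f x\<bar> powr (p - 1) * f x - \<bar>f x\<bar> powr (q - 1) * f x = 0"
    using sw unfolding standing_wave_def by (auto simp: differentiable_on_def)
  then have "(deriv f has_real_derivative deriv (deriv f) x) (at x)"
    by (simp add: DERIV_deriv_iff_real_differentiable)
  moreover have "deriv (deriv f) x = w * f x + nl (f x)"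
    using eq nl_factor[OF pos, of x] pos[of x] by (simp add: algebra_simps)
  ultimately show ?thesis by simp
qed

lemma deriv_odd: "deriv f (- x) = - deriv f x"
proof -
  have "((\<lambda>x. f (- x)) has_real_derivative (- deriv f (- x))) (at x)"
    using DERIV_mirror[of f "deriv f (-x)" x] deriv1[of "-x"] by simp
  then have "(f has_real_derivative (- deriv f (- x))) (at x)"
    unfolding even .
  then show ?thesis using DERIV_unique[OF deriv1] by fastforce
qed

lemma deriv_zero: "deriv f 0 = 0"
  using deriv_odd[of 0] by simp

lemma deriv_nonpos: "x \<ge> 0 \<Longrightarrow> deriv f x \<le> 0"
proof -
  assume x: "x \<ge> 0"
  show ?thesis
  proof (cases "x = 0")
    case True then show ?thesis by (simp add: deriv_zero)
  next
    case False
    show ?thesis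
    proof (rule ccontr)
      assume "\<not> ?thesis"
      then obtain d where d: "d > 0" "\<And>h. 0 < h \<Longrightarrow> h < d \<Longrightarrow> f x < f (x + h)"
        using DERIV_pos_inc_right[OF deriv1, of x] by auto
      have "f x < f (x + d/2)" by (rule d(2)) (use d(1) in auto)
      then show False using decr[of x "x + d/2"] x d(1) by simp
    qed
  qed
qed

lemma cont: "isCont f x"
  using deriv1 DERIV_isCont by blast

lemma decay_top: "(f \<longlongrightarrow> 0) at_top"
  using decay by (rule tendsto_mono[rotated]) (simp add: at_top_le_at_infinity)

text \<open>The energy vanishes at infinity: otherwise \<open>f'\<close> would tend to a nonzero limit, against \<open>f \<rightarrow> 0\<close>.\<close>

lemma energy: "(deriv f x)\<^sup>2 = (f x)\<^sup>2 * (w - g (f x))"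
proof -
  define G where "G v = w * v\<^sup>2 + 2 / (p + 1) * v powr (p + 1) - 2 / (q + 1) * v powr (q + 1)" for v
  define E where "E x = (deriv f x)\<^sup>2 - G (f x)" for x
  have G': "((\<lambda>x. G (f x)) has_real_derivative 2 * (w * f x + nl (f x)) * deriv f x) (at x)" for x
  proof -
    let ?v = "f x"
    have "(G has_real_derivative w * (2 * ?v) + 2 / (p + 1) * ((p + 1) * ?v powr (p + 1 - 1)) 
        - 2 / (q + 1) * ((q + 1) * ?v powr (q + 1 - 1))) (at ?v)"
      unfolding G_def
      by (intro DERIV_diff DERIV_add DERIV_cmult has_real_derivative_powr pos) (auto intro!: derivative_eq_intros)
    also have "w * (2 * ?v) + 2 / (p + 1) * ((p + 1) * ?v powr (p + 1 - 1)) 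
        - 2 / (q + 1) * ((q + 1) * ?v powr (q + 1 - 1)) = 2 * (w * ?v + nl ?v)"
    proof -
      have "2 / (r + 1) * ((r + 1) * X) = 2 * X" if "r > 1" for r X :: real using that by simp
      then show ?thesis using p_gt_1 p_lt_q by (simp add: nl_def)
    qed
    finally show ?thesis using DERIV_chain2[OF _ deriv1] by blast
  qed
  have "(E has_real_derivative 0) (at x)" for x
    unfolding E_def by (auto intro!: derivative_eq_intros deriv2 G')
  then have const: "E x = E y" for x y
    using DERIV_isconst_all[of E] by blast
  have "((\<lambda>x. w * (f x)\<^sup>2 + 2 / (p + 1) * f x powr (p + 1) - 2 / (q + 1) * f x powr (q + 1)) \<longlongrightarrow> 
      w * 0\<^sup>2 + 2 / (p + 1) * 0 - 2 / (q + 1) * 0) at_top"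
    using p_gt_1 p_lt_q
    by (intro tendsto_intros decay_top tendsto_zero_powrI[where b="p+1"] tendsto_zero_powrI[where b="q+1"])
       (auto simp: eventually_at_top_linorder less_imp_le[OF pos])
  then have G0: "((\<lambda>x. G (f x)) \<longlongrightarrow> 0) at_top"
    unfolding G_def by simp
  have "((\<lambda>x. E 0 + G (f x)) \<longlongrightarrow> E 0 + 0) at_top"
    by (intro tendsto_intros G0)
  moreover have "E 0 + G (f x) = (deriv f x)\<^sup>2" for x
    using const[of 0 x] by (simp add: E_def)
  ultimately have lim: "((\<lambda>x. (deriv f x)\<^sup>2) \<longlongrightarrow> E 0) at_top" by simp
  then have E0: "E 0 \<ge> 0"
    by (rule tendsto_lowerbound) auto
  have "E 0 = 0"
  proof (rule ccontr)
    assume "E 0 \<noteq> 0"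
    then have E0: "E 0 > 0" using E0 by simp
    define c where "c = sqrt (E 0 / 2)"
    have c: "c > 0" unfolding c_def using E0 by simp
    have "eventually (\<lambda>x. (deriv f x)\<^sup>2 > E 0 / 2) at_top"
      using lim E0 by (intro order_tendstoD(1)[OF lim]) auto
    then obtain X where X: "\<And>x. x \<ge> X \<Longrightarrow> (deriv f x)\<^sup>2 > E 0 / 2"
      unfolding eventually_at_top_linorder by blast
    define Y where "Y = max X 0"
    have d: "deriv f x \<le> - c" if "x \<ge> Y" for x
    proof -
      have "c \<le> sqrt ((deriv f x)\<^sup>2)" unfolding c_def
        using X[of x] that unfolding Y_def by (intro real_sqrt_le_mono) auto
      then show ?thesis using deriv_nonpos[of x] that unfolding Y_def by auto
    qed
    \<comment> \<open>Over this length a slope of at most \<open>- c\<close> lowers \<open>f\<close>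
      by at least \<open>f Y + 1\<close>, which makes it negative.\<close>
    define Z where "Z = Y + (f Y + 1) / c"
    have YZ: "Y < Z" unfolding Z_def using c pos[of Y] by simp
    obtain z where z: "z > Y" "z < Z" "f Z - f Y = (Z - Y) * deriv f z"
      using MVT2[OF YZ, of f "deriv f"] deriv1 by blast
    have "(Z - Y) * deriv f z \<le> (Z - Y) * (- c)"
      using d[of z] z YZ by (intro mult_left_mono) auto
    also have "\<dots> = - (f Y + 1)" unfolding Z_def using c by simp
    finally show False using z(3) pos[of Z] by simp
  qed
  then have "(deriv f x)\<^sup>2 = G (f x)" using const[of x 0] unfolding E_def by simp
  also have "\<dots> = (f x)\<^sup>2 * (w - g (f x))"
    using g_times_square[OF pos, of x] unfolding G_def by (simp add: algebra_simps)
  finally show ?thesis .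
qed

lemma g_max: "g (f 0) = w"
  using energy[of 0] pos[of 0] by (simp add: deriv_zero)

lemma le_max: "f x \<le> f 0"
  using decr[of 0 "\<bar>x\<bar>"] even[of x] by (cases "x \<ge> 0") auto

text \<open>This is \<open>d/dv (v^2 (w - g v)) = 2 (w v + nl v)\<close>, evaluated at
  \<open>v = f x\<close>. At the peak, where \<open>g (f x) = w\<close>, it expresses
  \<open>f''\<close> through \<open>g'\<close> alone.\<close>

lemma deriv2_eq_g: "2 * (w * f x + nl (f x)) = 2 * f x * (w - g (f x)) - (f x)\<^sup>2 * g' (f x)"
proof -
  have *: "v\<^sup>2 * v powr (r - 2) = v * v powr (r - 1)" if "v > 0" for v r :: real
    using that by (simp add: powr_diff powr_numeral power2_eq_square field_simps)
  let ?v = "f x"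
  have c: "2 / (r + 1) * (r - 1) = 2 - 2 * (2 / (r + 1))" if "r > 1" for r :: real
    using that by (simp add: field_simps)
  have "?v\<^sup>2 * g' ?v = 2 / (q + 1) * (q - 1) * (?v\<^sup>2 * ?v powr (q - 2)) - 2 / (p + 1) * (p - 1) * (?v\<^sup>2 * ?v powr (p - 2))"
    unfolding g'_def by (simp only: algebra_simps)
  also have "\<dots> = (2 - 2 * (2 / (q + 1))) * (?v * ?v powr (q - 1)) - (2 - 2 * (2 / (p + 1))) * (?v * ?v powr (p - 1))"
    using *[OF pos] c p_gt_1 p_lt_q by simp
  finally show ?thesis
    unfolding g_def nl_factor[OF pos] by (simp add: algebra_simps)
qed

text \<open>A zero of \<open>f'\<close> at some \<open>x > 0\<close> gives
  \<open>g (f x) = w = g (f 0)\<close>, hence \<open>f x = f 0\<close> by injectivity. Monotonicity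
  then makes \<open>f\<close> constant on \<open>[0, x]\<close>, so \<open>f'' = 0\<close> inside,
  which contradicts \<open>g' > 0\<close> at the peak value.\<close>

lemma deriv_neg:
  assumes "x > 0"
  shows "deriv f x < 0"
proof (rule ccontr)
  assume "\<not> ?thesis"
  then have d0: "deriv f x = 0" using deriv_nonpos[of x] assms by simp
  then have "g (f x) = w" using energy[of x] pos[of x] by simp
  then have eq: "f x = f 0"
    using g_inj[OF pos pos, of x 0] g_max w_nonneg by simp
  have const: "f y = f 0" if "0 \<le> y" "y \<le> x" for y
    using decr[of 0 y] decr[of y x] that eq by auto
  have c0: "deriv f y = 0" if "0 < y" "y < x" for y
  proof -
    have "((\<lambda>_. f 0) has_real_derivative deriv f y) (at y)"
      by (rule has_field_derivative_transform_within_open[OF deriv1, where S = "{0<..<x}"])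
         (use that in \<open>auto intro: const\<close>)
    then show ?thesis using DERIV_unique[OF _ DERIV_const] by blast
  qed
  have "((\<lambda>_. 0) has_real_derivative (w * f (x/2) + nl (f (x/2)))) (at (x/2))"
    by (rule has_field_derivative_transform_within_open[OF deriv2, where S = "{0<..<x}"])
       (use assms c0 in auto)
  then have "w * f (x/2) + nl (f (x/2)) = 0"
    using DERIV_unique[OF _ DERIV_const] by blast
  then have "(f 0)\<^sup>2 * g' (f 0) = 0"
    using deriv2_eq_g[of "x/2"] const[of "x/2"] assms g_max by simp
  then show False using g'_pos[of "f 0"] pos[of 0] g_max w_nonneg by auto
qed

lemma g_less: "x \<noteq> 0 \<Longrightarrow> g (f x) < w"
  using energy[of x] deriv_neg[of x] deriv_neg[of "-x"] deriv_odd[of x] pos[of x]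
  by (smt (verit) mult_nonneg_nonpos zero_less_power2 zero_le_power2)

lemma deriv_eq: "x \<ge> 0 \<Longrightarrow> deriv f x = - (f x * sqrt (w - g (f x)))"
proof -
  assume "x \<ge> 0"
  then have "- deriv f x = sqrt ((deriv f x)\<^sup>2)" using deriv_nonpos by simp
  also have "\<dots> = f x * sqrt (w - g (f x))" 
    unfolding energy using pos[of x] by (simp add: real_sqrt_mult)
  finally show ?thesis by simp
qed

end

section \<open>Second order linear equations\<close>

text \<open>The function \<open>M / K * exp (K * x)\<close> has derivative at least
  \<open>\<bar>f\<bar>\<close> on the right half-line, so it dominates both \<open>F\<close> and
  \<open>- F\<close> from \<open>0\<close> onwards; reflection treats the left half-line. Each
  antidifferentiation thus gains a factor \<open>1 / K\<close> in the exponential weight.\<close>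

lemma antiderivative_exp_bound:
  fixes f F :: "real \<Rightarrow> real"
  assumes F: "\<And>x. (F has_real_derivative f x) (at x)" and F0: "F 0 = 0"
    and K: "K > 0" and f: "\<And>x. \<bar>f x\<bar> \<le> M * exp (K * \<bar>x\<bar>)"
  shows "\<bar>F x\<bar> \<le> M / K * exp (K * \<bar>x\<bar>)"
proof -
  have M: "M \<ge> 0" using f[of 0] by simp
  have pos: "\<bar>F x\<bar> \<le> M / K * exp (K * x)"
    if F: "\<And>x. (F has_real_derivative f x) (at x)" and F0: "F 0 = 0"
    and f: "\<And>x. \<bar>f x\<bar> \<le> M * exp (K * \<bar>x\<bar>)" and x: "x \<ge> 0" for F f :: "real \<Rightarrow> real" and x
  proof -
    have "F x - M / K * exp (K * x) \<le> F 0 - M / K * exp (K * 0)"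
    proof (rule DERIV_nonpos_imp_nonincreasing[OF x], intro exI conjI)
      fix t :: real assume t: "0 \<le> t"
      show "((\<lambda>t. F t - M / K * exp (K * t)) has_real_derivative f t - M * exp (K * t)) (at t)"
        using K by (auto intro!: derivative_eq_intros F)
      show "f t - M * exp (K * t) \<le> 0" using f[of t] t by auto
    qed
    moreover have "- F x - M / K * exp (K * x) \<le> - F 0 - M / K * exp (K * 0)"
    proof (rule DERIV_nonpos_imp_nonincreasing[OF x], intro exI conjI)
      fix t :: real assume t: "0 \<le> t"
      show "((\<lambda>t. - F t - M / K * exp (K * t)) has_real_derivative - f t - M * exp (K * t)) (at t)"
        using K by (auto intro!: derivative_eq_intros F)
      show "- f t - M * exp (K * t) \<le> 0" using f[of t] t by auto
    qed
    moreover have "M / K \<ge> 0" using M K by simp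
    ultimately show ?thesis using F0 by auto
  qed
  show ?thesis
  proof (cases "x \<ge> 0")
    case True
    then show ?thesis using pos[OF F F0 f True] by simp
  next
    case False
    have "((\<lambda>x. F (- x)) has_real_derivative - f (- x)) (at x)" for x
      using DERIV_mirror[of F "f (-x)" x] F[of "-x"] by simp
    from pos[OF this, of "-x"] show ?thesis using F0 f[of "- _"] False by simp
  qed
qed

text \<open>Choice makes antidifferentiation an operation on functions, so that the Picard iterates
  can be defined by primitive recursion.\<close>

definition antideriv :: "(real \<Rightarrow> real) \<Rightarrow> real \<Rightarrow> real" where
  "antideriv f = (SOME F. F 0 = 0 \<and> (\<forall>x. (F has_real_derivative f x) (at x)))"

lemma antideriv:
  assumes "\<And>x. isCont f x"
  shows "antideriv f 0 = 0" "(antideriv f has_real_derivative f x) (at x)"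
proof -
  obtain F where F: "\<And>x. (F has_vector_derivative f x) (at x)"
    using einterval_antiderivative[of "-\<infinity>" "\<infinity>" f] assms by auto
  let ?F = "\<lambda>x. F x - F 0"
  have "?F 0 = 0 \<and> (\<forall>x. (?F has_real_derivative f x) (at x))"
    using F by (auto intro!: derivative_eq_intros simp: has_real_derivative_iff_has_vector_derivative)
  then have "\<exists>F. F 0 = 0 \<and> (\<forall>x. (F has_real_derivative f x) (at x))"
    by (rule exI[where x = ?F])
  from someI_ex[OF this, folded antideriv_def] show "antideriv f 0 = 0" "(antideriv f has_real_derivative f x) (at x)" by auto
qed

text \<open>Picard iteration; the weight \<open>exp (K * \<bar>x\<bar>)\<close> with \<open>K\<^sup>2 = 2 L\<close> makes each step gain a factor \<open>1/2\<close>.\<close>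

lemma linear_ode_exists:
  fixes c d :: "real \<Rightarrow> real"
  assumes c: "\<And>x. isCont c x" "\<And>x. \<bar>c x\<bar> \<le> L" and d: "\<And>x. isCont d x" "\<And>x. \<bar>d x\<bar> \<le> D"
  shows "\<exists>y y'. y 0 = B \<and> y' 0 = 0 \<and> (\<forall>x. (y has_real_derivative y' x) (at x)) \<and>
    (\<forall>x. (y' has_real_derivative c x * y x + d x) (at x))"
proof -
  \<comment> \<open>The maximum with \<open>1\<close> keeps \<open>K\<close> positive when
    \<open>L\<close> is \<open>0\<close>.\<close>
  define K where "K = sqrt (2 * max L 1)"
  have K: "K > 0" "K * K = 2 * max L 1" unfolding K_def by auto
  \<comment> \<open>The \<open>y n\<close> are the increments of the Picard iteration, not its
    partial sums: only \<open>y 0\<close> carries the initial value \<open>B\<close> and the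
    inhomogeneity \<open>d\<close>, and the solution is the sum of all of them.\<close>
  define y where "y n = rec_nat (\<lambda>x. B + antideriv (antideriv d) x) (\<lambda>_ u. antideriv (antideriv (\<lambda>x. c x * u x))) n" for n
  define y' where "y' n = (case n of 0 \<Rightarrow> antideriv d | Suc n \<Rightarrow> antideriv (\<lambda>x. c x * y n x))" for n
  define y'' where "y'' n = (case n of 0 \<Rightarrow> d | Suc n \<Rightarrow> (\<lambda>x. c x * y n x))" for n
  have y0: "y 0 = (\<lambda>x. B + antideriv (y' 0) x)" and ySuc: "y (Suc n) = antideriv (y' (Suc n))" for n
    by (simp_all add: y_def y'_def)
  have y'_eq: "y' n = antideriv (y'' n)" for n by (simp add: y'_def y''_def split: nat.split)
  have all: "(\<forall>x. (y n has_real_derivative y' n x) (at x)) \<and> (\<forall>x. (y' n has_real_derivative y'' n x) (at x))" for n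
  proof (induction n)
    case 0
    have d2: "(y' 0 has_real_derivative y'' 0 x) (at x)" for x
      unfolding y'_eq by (rule antideriv) (simp add: y''_def d)
    then have "(y 0 has_real_derivative y' 0 x) (at x)" for x
      unfolding y0 by (auto intro!: derivative_eq_intros antideriv DERIV_isCont)
    with d2 show ?case by blast
  next
    case (Suc n)
    then have "isCont (y n) x" for x using DERIV_isCont by blast
    then have d2: "(y' (Suc n) has_real_derivative y'' (Suc n) x) (at x)" for x
      unfolding y'_eq by (intro antideriv) (simp add: y''_def c)
    then have "(y (Suc n) has_real_derivative y' (Suc n) x) (at x)" for x
      unfolding ySuc by (intro antideriv DERIV_isCont)
    with d2 show ?case by blast
  qed
  then have dy: "(y n has_real_derivative y' n x) (at x)" and dy': "(y' n has_real_derivative y'' n x) (at x)" for n x by auto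
  have y'0: "y' n 0 = 0" for n
  proof -
    have "isCont (y'' n) x" for x
      using DERIV_isCont[OF dy] d(1) c(1) by (cases n) (auto simp: y''_def)
    then show ?thesis unfolding y'_eq by (intro antideriv)
  qed
  have ySuc0: "y (Suc n) 0 = 0" for n
    unfolding ySuc by (intro antideriv DERIV_isCont) (use all in blast)
  have y00: "y 0 0 = B"
    unfolding y0 using antideriv(1)[of "y' 0", OF DERIV_isCont[OF dy']] by simp
  \<comment> \<open>The second summand is what two antidifferentiations make of the bound
    \<open>D\<close> on \<open>d\<close>.\<close>
  define M where "M = \<bar>B\<bar> + D / (K * K)"
  have D: "D \<ge> 0" using d(2)[of 0] by simp
  have M: "M \<ge> 0" unfolding M_def using D by simp
  have expge1: "1 \<le> exp (K * \<bar>x\<bar>)" for x :: real using K by simp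
  have b0: "\<bar>y'' 0 x\<bar> \<le> D * exp (K * \<bar>x\<bar>)" for x
    using mult_left_mono[OF expge1 D, of x] d(2)[of x] by (simp add: y''_def)
  have yb: "\<bar>y n x\<bar> \<le> M * (1/2)^n * exp (K * \<bar>x\<bar>)" for n x
  proof (induction n arbitrary: x)
    case 0
    have 1: "\<bar>y' 0 x\<bar> \<le> D / K * exp (K * \<bar>x\<bar>)" for x
      by (rule antiderivative_exp_bound[OF dy' y'0 K(1) b0])
    have "\<bar>y 0 x - B\<bar> \<le> D / K / K * exp (K * \<bar>x\<bar>)"
      by (rule antiderivative_exp_bound[OF _ _ K(1) 1]) (auto intro!: derivative_eq_intros dy simp: y00)
    moreover have "\<bar>B\<bar> \<le> \<bar>B\<bar> * exp (K * \<bar>x\<bar>)" using mult_left_mono[OF expge1, of "\<bar>B\<bar>" x] by simp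
    ultimately show ?case unfolding M_def by (simp add: algebra_simps)
  next
    case (Suc n)
    have 2: "\<bar>y'' (Suc n) x\<bar> \<le> max L 1 * (M * (1/2)^n) * exp (K * \<bar>x\<bar>)" for x
    proof -
      have "\<bar>y'' (Suc n) x\<bar> = \<bar>c x\<bar> * \<bar>y n x\<bar>" by (simp add: y''_def abs_mult)
      also have "\<dots> \<le> max L 1 * (M * (1/2)^n * exp (K * \<bar>x\<bar>))"
        using Suc[of x] c(2)[of x] by (intro mult_mono) auto
      finally show ?thesis by simp
    qed
    have 1: "\<bar>y' (Suc n) x\<bar> \<le> max L 1 * (M * (1/2)^n) / K * exp (K * \<bar>x\<bar>)" for x
      by (rule antiderivative_exp_bound[OF dy' y'0 K(1) 2])
    have "\<bar>y (Suc n) x\<bar> \<le> max L 1 * (M * (1/2)^n) / K / K * exp (K * \<bar>x\<bar>)"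
      by (rule antiderivative_exp_bound[OF dy ySuc0 K(1) 1])
    also have "max L 1 * (M * (1/2)^n) / K / K = M * (1/2)^Suc n"
      unfolding divide_divide_eq_left K(2) by simp
    finally show ?case .
  qed
  \<comment> \<open>First and second derivatives inherit the geometric rate, so the series may be
    differentiated twice term by term on every ball.\<close>
  have b'': "\<bar>y'' n x\<bar> \<le> (D + 2 * max L 1 * M) * (1/2)^n * exp (K * \<bar>x\<bar>)" for n x
  proof (cases n)
    case 0
    have "D * exp (K * \<bar>x\<bar>) \<le> (D + 2 * max L 1 * M) * exp (K * \<bar>x\<bar>)" 
      using M by (intro mult_right_mono) auto
    from order_trans[OF b0 this] show ?thesis by (simp add: 0)
  next
    case (Suc m)
    have "\<bar>y'' n x\<bar> = \<bar>c x\<bar> * \<bar>y m x\<bar>" by (simp add: y''_def abs_mult Suc)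
    also have "\<dots> \<le> max L 1 * (M * (1/2)^m * exp (K * \<bar>x\<bar>))"
      using yb[of m x] c(2)[of x] by (intro mult_mono) auto
    also have "\<dots> = (0 + 2 * max L 1 * M) * (1/2)^n * exp (K * \<bar>x\<bar>)" by (simp add: Suc)
    also have "\<dots> \<le> (D + 2 * max L 1 * M) * (1/2)^n * exp (K * \<bar>x\<bar>)"
      using D by (intro mult_right_mono) auto
    finally show ?thesis .
  qed
  have b': "\<bar>y' n x\<bar> \<le> (D + 2 * max L 1 * M) * (1/2)^n / K * exp (K * \<bar>x\<bar>)" for n x
    by (rule antiderivative_exp_bound[OF dy' y'0 K(1) b''])
  have unif: "uniformly_convergent_on (ball 0 X) (\<lambda>n x. \<Sum>i<n. u i x)" 
    if u: "\<And>n x. \<bar>u n x\<bar> \<le> C * (1/2)^n * exp (K * \<bar>x\<bar>)" for u :: "nat \<Rightarrow> real \<Rightarrow> real" and C X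
  proof (rule Weierstrass_m_test'_ev)
    have "C \<ge> 0" using u[of 0 0] by simp
    then have "\<bar>u n x\<bar> \<le> C * (1/2)^n * exp (K * X)" if "x \<in> ball 0 X" for n x
      using that K(1) by (intro order_trans[OF u] mult_left_mono) auto
    then show "\<forall>\<^sub>F n in sequentially. \<forall>x\<in>ball 0 X. norm (u n x) \<le> C * (1/2)^n * exp (K * X)" by simp
    show "summable (\<lambda>n. C * (1 / 2) ^ n * exp (K * X))"
      by (intro summable_mult summable_mult2 summable_geometric) auto
  qed
  define z where "z x = (\<Sum>n. y n x)" for x
  define z' where "z' x = (\<Sum>n. y' n x)" for x
  have summ: "summable (\<lambda>n. u n x)" if "\<And>n x. \<bar>u n x\<bar> \<le> C * (1/2)^n * exp (K * \<bar>x\<bar>)" for u :: "nat \<Rightarrow> real \<Rightarrow> real" and C x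
    by (rule summable_comparison_test'[where g = "\<lambda>n. C * (1/2)^n * exp (K * \<bar>x\<bar>)" and N = 0])
       (auto intro!: summable_mult summable_mult2 summable_geometric that)
  have bb': "\<bar>y' n x\<bar> \<le> ((D + 2 * max L 1 * M) / K) * (1/2)^n * exp (K * \<bar>x\<bar>)" for n x
    using b'[of n x] by simp
  have z: "(z has_real_derivative z' x) (at x)" for x
    unfolding z_def z'_def
    by (rule has_field_derivative_series'(2)[of "ball 0 (\<bar>x\<bar> + 1)" _ _ 0])
       (use dy unif[OF bb'] summ[OF yb] in \<open>auto intro: has_field_derivative_at_within\<close>)
  have "(z' has_real_derivative (\<Sum>n. y'' n x)) (at x)" for x
    unfolding z'_def
    by (rule has_field_derivative_series'(2)[of "ball 0 (\<bar>x\<bar> + 1)" _ _ 0])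
       (use dy' unif[OF b''] summ[OF bb'] in \<open>auto intro: has_field_derivative_at_within\<close>)
  moreover have "(\<Sum>n. y'' n x) = c x * z x + d x" for x
    using suminf_split_head[OF summ[OF b''], of x] suminf_mult[OF summ[OF yb], of "c x" x] by (simp add: y''_def z_def)
  ultimately have "(z' has_real_derivative c x * z x + d x) (at x)" for x by metis
  moreover have "z 0 = B"
    using suminf_split_head[OF summ[OF yb], of 0] by (simp add: ySuc0 y00 z_def)
  moreover have "z' 0 = 0" unfolding z'_def by (simp add: y'0)
  ultimately show ?thesis using z by blast
qed

text \<open>The energy \<open>z\<^sup>2 + z'\<^sup>2 + A\<^sup>2\<close> grows at most exponentially.\<close>

lemma second_order_gronwall:
  fixes z z' z'' :: "real \<Rightarrow> real"
  assumes z: "\<And>x. (z has_real_derivative z' x) (at x)" and z': "\<And>x. (z' has_real_derivative z'' x) (at x)"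
    and b: "\<And>x. 0 \<le> x \<Longrightarrow> x \<le> X \<Longrightarrow> \<bar>z'' x\<bar> \<le> A + L * \<bar>z x\<bar>" and "A \<ge> 0" "L \<ge> 0" "z' 0 = 0"
    and x: "0 \<le> x" "x \<le> X"
  shows "\<bar>z x\<bar> \<le> exp ((2 + L) * X) * (\<bar>z 0\<bar> + A)"
proof -
  define E where "E x = (z x)\<^sup>2 + (z' x)\<^sup>2 + A\<^sup>2" for x
  \<comment> \<open>In \<open>E'\<close> the terms \<open>2 z z'\<close> and \<open>2 z' z''\<close>
    each contribute one \<open>z'^2\<close>, which accounts for the \<open>2\<close>; the part of
    \<open>z''\<close> bounded by \<open>L * \<bar>z\<bar>\<close> accounts for
    \<open>L\<close>.\<close>
  define k where "k = 2 + L"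
  have "exp (- k * x) * E x \<le> exp (- k * 0) * E 0"
  proof (rule DERIV_nonpos_imp_nonincreasing[OF x(1)], intro exI conjI)
    fix t assume t: "0 \<le> t" "t \<le> x"
    show "((\<lambda>x. exp (- k * x) * E x) has_real_derivative
        exp (- k * t) * (2 * z t * z' t + 2 * z' t * z'' t - k * E t)) (at t)"
      unfolding E_def by (auto intro!: derivative_eq_intros z z' simp: algebra_simps)
    have "2 * z' t * z'' t \<le> 2 * \<bar>z' t\<bar> * \<bar>z'' t\<bar>" by (metis abs_ge_self abs_mult abs_numeral)
    also have "\<dots> \<le> 2 * \<bar>z' t\<bar> * (A + L * \<bar>z t\<bar>)" using b[of t] t x by (intro mult_left_mono) auto
    also have "\<dots> = 2 * \<bar>z' t\<bar> * A + L * (2 * \<bar>z' t\<bar> * \<bar>z t\<bar>)" by (simp add: algebra_simps)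
    also have "\<dots> \<le> ((z' t)\<^sup>2 + A\<^sup>2) + L * ((z' t)\<^sup>2 + (z t)\<^sup>2)"
      using \<open>L \<ge> 0\<close> sum_squares_bound[of "\<bar>z' t\<bar>" A] sum_squares_bound[of "\<bar>z' t\<bar>" "\<bar>z t\<bar>"]
      by (intro add_mono mult_left_mono) auto
    finally have 1: "2 * z' t * z'' t \<le> ((z' t)\<^sup>2 + A\<^sup>2) + L * ((z' t)\<^sup>2 + (z t)\<^sup>2)" .
    have 2: "2 * z t * z' t \<le> (z t)\<^sup>2 + (z' t)\<^sup>2" by (rule sum_squares_bound)
    have "L * A\<^sup>2 \<ge> 0" using \<open>L \<ge> 0\<close> by simp
    then have "2 * z t * z' t + 2 * z' t * z'' t - k * E t \<le> 0"
      using 1 2 unfolding k_def E_def by (simp add: algebra_simps) (smt (verit) zero_le_power2)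
    then show "exp (- k * t) * (2 * z t * z' t + 2 * z' t * z'' t - k * E t) \<le> 0"
      by (simp add: mult_nonneg_nonpos)
  qed
  then have "E x \<le> exp (k * x) * E 0"
    by (simp add: exp_minus field_simps)
  also have "\<dots> \<le> exp (k * X) * (\<bar>z 0\<bar> + A)\<^sup>2"
  proof (rule mult_mono)
    show "exp (k * x) \<le> exp (k * X)" using x \<open>L \<ge> 0\<close> unfolding k_def by (simp add: mult_left_mono)
    have "\<bar>z 0\<bar> * A \<ge> 0" using \<open>A \<ge> 0\<close> by simp
    then show "E 0 \<le> (\<bar>z 0\<bar> + A)\<^sup>2" unfolding E_def using \<open>z' 0 = 0\<close> by (simp add: power2_sum mult.commute)
  qed (auto simp: E_def)
  \<comment> \<open>The exponential is at least \<open>1\<close>; squaring it turns the right-hand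
    side into a perfect square, so that the root can be taken.\<close>
  also have "\<dots> \<le> (exp (k * X))\<^sup>2 * (\<bar>z 0\<bar> + A)\<^sup>2"
    using x \<open>L \<ge> 0\<close> unfolding k_def by (intro mult_right_mono self_le_power) auto
  finally have "(z x)\<^sup>2 \<le> (exp (k * X) * (\<bar>z 0\<bar> + A))\<^sup>2" unfolding E_def power_mult_distrib
    by (smt (verit) zero_le_power2)
  then show ?thesis unfolding k_def using \<open>A \<ge> 0\<close> by (simp add: abs_le_square_iff [symmetric] abs_mult)
qed

section \<open>Dependence on the frequency\<close>

locale family = double_power +
  fixes \<phi> :: "real \<Rightarrow> real \<Rightarrow> real"
  assumes standing_waves: "\<omega> \<ge> 0 \<Longrightarrow> standing_wave p q \<omega> (\<phi> \<omega>)"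
begin

lemma standing: "\<omega> \<ge> 0 \<Longrightarrow> standing p q \<omega> (\<phi> \<omega>)"
  by (intro standing.intro standing_axioms.intro double_power_axioms standing_waves)

lemmas pos = standing.pos[OF standing]
  and even = standing.even[OF standing]
  and deriv1 = standing.deriv1[OF standing]
  and deriv2 = standing.deriv2[OF standing]
  and g_max = standing.g_max[OF standing]
  and deriv_zero = standing.deriv_zero[OF standing]

section \<open>The peak height as a function of the frequency\<close>

lemma max_mono: "0 \<le> \<omega> \<Longrightarrow> \<omega> \<le> \<omega>' \<Longrightarrow> \<phi> \<omega> 0 \<le> \<phi> \<omega>' 0"
  using g_strict_mono[of "\<phi> \<omega>' 0" "\<phi> \<omega> 0"] pos[of \<omega>' 0] g_max[of \<omega>] g_max[of \<omega>'] by force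

lemma le_max: "\<omega> \<in> {0..1} \<Longrightarrow> \<phi> \<omega> x \<le> \<phi> 1 0"
  using max_mono[of \<omega> 1] standing.le_max[OF standing, of \<omega> x] by auto

lemma max_in: "\<omega> \<in> {0..1} \<Longrightarrow> \<phi> \<omega> 0 \<in> {\<phi> 0 0..\<phi> 1 0}"
  using max_mono[of \<omega> 1] max_mono[of 0 \<omega>] by auto

lemma g_pos_range: "v \<in> {\<phi> 0 0..\<phi> 1 0} \<Longrightarrow> v > 0 \<and> g' v > 0"
proof -
  assume v: "v \<in> {\<phi> 0 0..\<phi> 1 0}"
  then have "v > 0" using pos[of 0 0] by auto
  moreover have "g v \<ge> 0" using g_nonneg_mono[OF pos, of 0 0 v] g_max[of 0] v by simp
  ultimately show ?thesis using g'_pos[of v] by simp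
qed

lemma continuous_g': "continuous_on {\<phi> 0 0..\<phi> 1 0} g'"
proof (rule continuous_on_subset)
  show "continuous_on {0<..} g'"
    unfolding g'_def by (intro continuous_intros) auto
  show "{\<phi> 0 0..\<phi> 1 0} \<subseteq> {0<..}" using g_pos_range by (meson greaterThan_iff subsetI)
qed

lemma g'_lower: "\<exists>c>0. \<forall>v\<in>{\<phi> 0 0..\<phi> 1 0}. c \<le> g' v"
proof -
  have "\<exists>x\<in>{\<phi> 0 0..\<phi> 1 0}. \<forall>y\<in>{\<phi> 0 0..\<phi> 1 0}. g' x \<le> g' y"
    by (rule continuous_attains_inf) (simp_all add: continuous_g' max_mono)
  then show ?thesis using g_pos_range by blast
qed

text \<open>The mean value theorem for \<open>g\<close>, stated so that the order of the two peaks
  stays open and equality is allowed. The intermediate point lies in the compact range where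
  \<open>g'\<close> is bounded away from \<open>0\<close>.\<close>

lemma max_difference:
  assumes "\<omega> \<in> {0..1}" "\<omega>' \<in> {0..1}"
  shows "\<exists>\<xi>. \<bar>\<xi> - \<phi> \<omega> 0\<bar> \<le> \<bar>\<phi> \<omega>' 0 - \<phi> \<omega> 0\<bar> \<and> \<xi> \<in> {\<phi> 0 0..\<phi> 1 0} \<and> \<omega>' - \<omega> = g' \<xi> * (\<phi> \<omega>' 0 - \<phi> \<omega> 0)"
proof -
  have *: "\<exists>\<xi>. u \<le> \<xi> \<and> \<xi> \<le> v \<and> g v - g u = g' \<xi> * (v - u)"
    if "u \<le> v" "u > 0" "g u \<ge> 0" for u v
  proof (cases "u = v")
    case False
    then have "u < v" using that by simp
    have "\<exists>z>u. z < v \<and> g v - g u = (v - u) * g' z"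
      by (rule MVT2[OF \<open>u < v\<close>]) (rule g_has_derivative, use that in linarith)
    then obtain z where "z > u" "z < v" "g v - g u = (v - u) * g' z" by blast
    then show ?thesis by (intro exI[of _ z]) auto
  qed auto
  show ?thesis
  proof (cases "\<phi> \<omega> 0 \<le> \<phi> \<omega>' 0")
    case True
    obtain \<xi> where \<xi>: "\<phi> \<omega> 0 \<le> \<xi>" "\<xi> \<le> \<phi> \<omega>' 0" "g (\<phi> \<omega>' 0) - g (\<phi> \<omega> 0) = g' \<xi> * (\<phi> \<omega>' 0 - \<phi> \<omega> 0)"
      using *[OF True pos] assms g_max[of \<omega>] by auto
    then have "\<omega>' - \<omega> = g' \<xi> * (\<phi> \<omega>' 0 - \<phi> \<omega> 0)" using assms g_max by simp
    then show ?thesis using \<xi>(1,2) max_in[OF assms(1)] max_in[OF assms(2)] by (intro exI[of _ \<xi>] conjI) auto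
  next
    case False
    then have le: "\<phi> \<omega>' 0 \<le> \<phi> \<omega> 0" by simp
    obtain \<xi> where \<xi>: "\<phi> \<omega>' 0 \<le> \<xi>" "\<xi> \<le> \<phi> \<omega> 0" "g (\<phi> \<omega> 0) - g (\<phi> \<omega>' 0) = g' \<xi> * (\<phi> \<omega> 0 - \<phi> \<omega>' 0)"
      using *[OF le pos] assms g_max[of \<omega>'] by auto
    then have "\<omega> - \<omega>' = g' \<xi> * (\<phi> \<omega> 0 - \<phi> \<omega>' 0)" using assms g_max by simp
    then have "\<omega>' - \<omega> = g' \<xi> * (\<phi> \<omega>' 0 - \<phi> \<omega> 0)" by (simp add: algebra_simps)
    then show ?thesis using \<xi>(1,2) max_in[OF assms(1)] max_in[OF assms(2)] by (intro exI[of _ \<xi>] conjI) auto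
  qed
qed

lemma max_lipschitz:
  "\<exists>C\<ge>0. \<forall>\<omega>\<in>{0..1}. \<forall>\<omega>'\<in>{0..1}. \<bar>\<phi> \<omega>' 0 - \<phi> \<omega> 0\<bar> \<le> C * \<bar>\<omega>' - \<omega>\<bar>"
proof -
  obtain c where c: "c > 0" "\<And>v. v \<in> {\<phi> 0 0..\<phi> 1 0} \<Longrightarrow> c \<le> g' v" using g'_lower by blast
  have "\<bar>\<phi> \<omega>' 0 - \<phi> \<omega> 0\<bar> \<le> 1 / c * \<bar>\<omega>' - \<omega>\<bar>" if "\<omega> \<in> {0..1}" "\<omega>' \<in> {0..1}" for \<omega> \<omega>'
  proof -
    note w = that
    obtain \<xi> where \<xi>: "\<xi> \<in> {\<phi> 0 0..\<phi> 1 0}" "\<omega>' - \<omega> = g' \<xi> * (\<phi> \<omega>' 0 - \<phi> \<omega> 0)"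
      using max_difference[OF w] by blast
    have "c * \<bar>\<phi> \<omega>' 0 - \<phi> \<omega> 0\<bar> \<le> g' \<xi> * \<bar>\<phi> \<omega>' 0 - \<phi> \<omega> 0\<bar>"
      using c(2)[OF \<xi>(1)] by (intro mult_right_mono) auto
    also have "\<dots> = \<bar>\<omega>' - \<omega>\<bar>" unfolding \<xi>(2) using g_pos_range[OF \<xi>(1)] by (simp add: abs_mult)
    finally show ?thesis using c(1) by (simp add: field_simps)
  qed
  then show ?thesis using c(1) by (intro exI[of _ "1/c"]) auto
qed

text \<open>Uniform differentiability of the inverse of \<open>g\<close>: the intermediate point is
  within a multiple of \<open>\<bar>\<omega>' - \<omega>\<bar>\<close> of
  \<open>\<phi> \<omega> 0\<close>, and \<open>1 / g'\<close> is uniformly continuous on the range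
  of the peaks. Hence \<open>\<delta>\<close> does not depend on the frequencies.\<close>

lemma max_remainder:
  assumes "\<epsilon> > 0"
  shows "\<exists>\<delta>>0. \<forall>\<omega>\<in>{0..1}. \<forall>\<omega>'\<in>{0..1}. \<bar>\<omega>' - \<omega>\<bar> < \<delta> \<longrightarrow>
    \<bar>\<phi> \<omega>' 0 - \<phi> \<omega> 0 - (\<omega>' - \<omega>) * (1 / g' (\<phi> \<omega> 0))\<bar> \<le> \<epsilon> * \<bar>\<omega>' - \<omega>\<bar>"
proof -
  obtain C where C: "C \<ge> 0" "\<And>\<omega> \<omega>'. \<omega> \<in> {0..1} \<Longrightarrow> \<omega>' \<in> {0..1} \<Longrightarrow> \<bar>\<phi> \<omega>' 0 - \<phi> \<omega> 0\<bar> \<le> C * \<bar>\<omega>' - \<omega>\<bar>"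
    using max_lipschitz by blast
  have "continuous_on {\<phi> 0 0..\<phi> 1 0} (\<lambda>v. 1 / g' v)"
    by (intro continuous_intros continuous_g' ballI) (metis g_pos_range less_irrefl)
  then have "uniformly_continuous_on {\<phi> 0 0..\<phi> 1 0} (\<lambda>v. 1 / g' v)"
    by (rule compact_uniformly_continuous) simp
  then obtain d where d: "d > 0" "\<And>u v. u \<in> {\<phi> 0 0..\<phi> 1 0} \<Longrightarrow> v \<in> {\<phi> 0 0..\<phi> 1 0} \<Longrightarrow> \<bar>u - v\<bar> < d \<Longrightarrow> \<bar>1 / g' u - 1 / g' v\<bar> < \<epsilon>"
    using assms unfolding uniformly_continuous_on_def dist_real_def by blast
  show ?thesis
  \<comment> \<open>\<open>C + 1\<close> instead of \<open>C\<close>, because \<open>C\<close> may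
    be \<open>0\<close>.\<close>
  proof (intro exI[of _ "d / (C + 1)"] conjI ballI impI)
    show "0 < d / (C + 1)" using d C by simp
    fix \<omega> \<omega>' :: real assume w: "\<omega> \<in> {0..1}" "\<omega>' \<in> {0..1}" and lt: "\<bar>\<omega>' - \<omega>\<bar> < d / (C + 1)"
    obtain \<xi> where \<xi>: "\<bar>\<xi> - \<phi> \<omega> 0\<bar> \<le> \<bar>\<phi> \<omega>' 0 - \<phi> \<omega> 0\<bar>" "\<xi> \<in> {\<phi> 0 0..\<phi> 1 0}" "\<omega>' - \<omega> = g' \<xi> * (\<phi> \<omega>' 0 - \<phi> \<omega> 0)"
      using max_difference[OF w] by blast
    have "\<bar>\<xi> - \<phi> \<omega> 0\<bar> \<le> (C + 1) * \<bar>\<omega>' - \<omega>\<bar>"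
      using \<xi>(1) C(2)[OF w] by (simp add: algebra_simps)
    also have "\<dots> < d" using lt C(1) by (simp add: field_simps)
    finally have near: "\<bar>1 / g' \<xi> - 1 / g' (\<phi> \<omega> 0)\<bar> \<le> \<epsilon>"
      using d(2)[OF \<xi>(2) max_in[OF w(1)]] by simp
    have eq: "\<phi> \<omega>' 0 - \<phi> \<omega> 0 = (\<omega>' - \<omega>) * (1 / g' \<xi>)"
      using \<xi>(3) g_pos_range[OF \<xi>(2)] by simp
    have "\<bar>\<phi> \<omega>' 0 - \<phi> \<omega> 0 - (\<omega>' - \<omega>) * (1 / g' (\<phi> \<omega> 0))\<bar> = \<bar>\<omega>' - \<omega>\<bar> * \<bar>1 / g' \<xi> - 1 / g' (\<phi> \<omega> 0)\<bar>"
      unfolding eq by (simp only: right_diff_distrib [symmetric] abs_mult)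
    also have "\<dots> \<le> \<bar>\<omega>' - \<omega>\<bar> * \<epsilon>" using near by (intro mult_left_mono) auto
    finally show "\<bar>\<phi> \<omega>' 0 - \<phi> \<omega> 0 - (\<omega>' - \<omega>) * (1 / g' (\<phi> \<omega> 0))\<bar> \<le> \<epsilon> * \<bar>\<omega>' - \<omega>\<bar>"
      by (simp only: mult.commute)
  qed
qed

text \<open>The interval is closed at \<open>0\<close>, the value approached by the waves at
  infinity. As \<open>p > 1\<close>, continuity persists there, and compactness yields a bound and a
  modulus of continuity uniform in \<open>x\<close> and \<open>\<omega>\<close>.\<close>

lemma continuous_nl': "continuous_on {0..\<phi> 1 0} nl'"
  unfolding nl'_def using p_gt_1 p_lt_q by (intro continuous_intros continuous_on_powr') auto

lemma nl'_bound: "\<exists>L\<ge>0. \<forall>v\<in>{0..\<phi> 1 0}. \<bar>nl' v\<bar> \<le> L"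
proof -
  have "bounded (nl' ` {0..\<phi> 1 0})"
    by (intro compact_imp_bounded compact_continuous_image continuous_nl') simp
  then obtain L where "\<And>v. v \<in> {0..\<phi> 1 0} \<Longrightarrow> \<bar>nl' v\<bar> \<le> L" unfolding bounded_iff by (auto simp del: atLeastAtMost_iff)
  then show ?thesis by (intro exI[of _ "max L 0"]) fastforce
qed

lemma nl_difference:
  assumes "u > 0" "v > 0" "u \<le> \<phi> 1 0" "v \<le> \<phi> 1 0"
  shows "\<exists>\<xi>. \<bar>\<xi> - u\<bar> \<le> \<bar>v - u\<bar> \<and> \<xi> \<in> {0..\<phi> 1 0} \<and> nl v - nl u = nl' \<xi> * (v - u)"
proof -
  have *: "\<exists>\<xi>. u \<le> \<xi> \<and> \<xi> \<le> v \<and> nl v - nl u = nl' \<xi> * (v - u)"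
    if "u \<le> v" "u > 0" for u v
  proof (cases "u = v")
    case False
    then have "u < v" using that by simp
    have "\<exists>z>u. z < v \<and> nl v - nl u = (v - u) * nl' z"
      by (rule MVT2[OF \<open>u < v\<close>]) (rule nl_has_derivative, use that in linarith)
    then obtain z where "z > u" "z < v" "nl v - nl u = (v - u) * nl' z" by blast
    then show ?thesis by (intro exI[of _ z]) auto
  qed auto
  show ?thesis
  proof (cases "u \<le> v")
    case True
    then obtain \<xi> where \<xi>: "u \<le> \<xi>" "\<xi> \<le> v" "nl v - nl u = nl' \<xi> * (v - u)"
      using *[of u v] assms by auto
    then show ?thesis using assms by (intro exI[of _ \<xi>] conjI) auto
  next
    case False
    then obtain \<xi> where \<xi>: "v \<le> \<xi>" "\<xi> \<le> u" "nl u - nl v = nl' \<xi> * (u - v)"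
      using *[of v u] assms by auto
    then have "nl v - nl u = nl' \<xi> * (v - u)" by (simp add: algebra_simps)
    then show ?thesis using \<xi>(1,2) assms by (intro exI[of _ \<xi>] conjI) auto
  qed
qed

lemma in_range: "\<omega> \<in> {0..1} \<Longrightarrow> \<phi> \<omega> x \<in> {0..\<phi> 1 0}"
  using le_max[of \<omega> x] pos[of \<omega> x] by auto

lemma isCont_nl': "\<omega> \<ge> 0 \<Longrightarrow> isCont (\<lambda>x. nl' (\<phi> \<omega> x)) x"
  unfolding nl'_def using pos[of \<omega> x]
  by (intro continuous_intros standing.cont[OF standing]) auto

text \<open>The response \<open>\<partial>\<phi>/\<partial>\<omega>\<close>, obtained by solving the linearised equation
  \<open>H'' = (\<omega> + nl' \<phi>) H + \<phi>\<close>; the initial value is the \<open>\<omega>\<close>-derivative of \<open>\<phi> \<omega> 0 = g\<^sup>-\<^sup>1 \<omega>\<close>.\<close>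

definition resp :: "real \<Rightarrow> real \<Rightarrow> real" where
  "resp \<omega> = (SOME y. y 0 = 1 / g' (\<phi> \<omega> 0) \<and> deriv y 0 = 0 \<and> (\<forall>x. (y has_real_derivative deriv y x) (at x)) \<and>
    (\<forall>x. (deriv y has_real_derivative (\<omega> + nl' (\<phi> \<omega> x)) * y x + \<phi> \<omega> x) (at x)))"

lemma resp:
  assumes w: "\<omega> \<in> {0..1}"
  shows resp_0: "resp \<omega> 0 = 1 / g' (\<phi> \<omega> 0)" and deriv_resp_0: "deriv (resp \<omega>) 0 = 0"
    and resp1: "(resp \<omega> has_real_derivative deriv (resp \<omega>) x) (at x)"
    and resp2: "(deriv (resp \<omega>) has_real_derivative (\<omega> + nl' (\<phi> \<omega> x)) * resp \<omega> x + \<phi> \<omega> x) (at x)"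
proof -
  obtain L where L: "L \<ge> 0" "\<And>v. v \<in> {0..\<phi> 1 0} \<Longrightarrow> \<bar>nl' v\<bar> \<le> L" using nl'_bound by blast
  have 1: "isCont (\<lambda>x. \<omega> + nl' (\<phi> \<omega> x)) x" for x using w by (intro continuous_intros isCont_nl') auto
  have 2: "\<bar>\<omega> + nl' (\<phi> \<omega> x)\<bar> \<le> 1 + L" for x using L(2)[OF in_range[OF w, of x]] w by auto
  have 3: "isCont (\<phi> \<omega>) x" for x using standing.cont[OF standing] w by auto
  have 4: "\<bar>\<phi> \<omega> x\<bar> \<le> \<phi> 1 0" for x using in_range[OF w, of x] by auto
  obtain y y' where y: "y 0 = 1 / g' (\<phi> \<omega> 0)" "y' 0 = 0" "\<And>x. (y has_real_derivative y' x) (at x)"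
    "\<And>x. (y' has_real_derivative (\<omega> + nl' (\<phi> \<omega> x)) * y x + \<phi> \<omega> x) (at x)"
    using linear_ode_exists[OF 1 2 3 4] by blast
  have "deriv y = y'" using DERIV_imp_deriv[OF y(3)] by auto
  with y have "\<exists>y. y 0 = 1 / g' (\<phi> \<omega> 0) \<and> deriv y 0 = 0 \<and> (\<forall>x. (y has_real_derivative deriv y x) (at x)) \<and>
    (\<forall>x. (deriv y has_real_derivative (\<omega> + nl' (\<phi> \<omega> x)) * y x + \<phi> \<omega> x) (at x))"
    by (intro exI[of _ y]) simp
  from someI_ex[OF this, folded resp_def]
  show "resp \<omega> 0 = 1 / g' (\<phi> \<omega> 0)" "deriv (resp \<omega>) 0 = 0"
    "(resp \<omega> has_real_derivative deriv (resp \<omega>) x) (at x)"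
    "(deriv (resp \<omega>) has_real_derivative (\<omega> + nl' (\<phi> \<omega> x)) * resp \<omega> x + \<phi> \<omega> x) (at x)"
    by auto
qed

text \<open>As \<open>\<phi> \<omega>\<close> is even, the difference between the response and its
  reflection solves the homogeneous linear equation with zero initial data, and Gronwall with
  \<open>A = 0\<close> forces it to vanish.\<close>

lemma resp_even:
  assumes w: "\<omega> \<in> {0..1}"
  shows "resp \<omega> (- x) = resp \<omega> x"
proof -
  obtain L where L: "L \<ge> 0" "\<And>v. v \<in> {0..\<phi> 1 0} \<Longrightarrow> \<bar>nl' v\<bar> \<le> L" using nl'_bound by blast
  define z where "z x = resp \<omega> x - resp \<omega> (- x)" for x
  define z' where "z' x = deriv (resp \<omega>) x + deriv (resp \<omega>) (- x)" for x
  have m: "((\<lambda>x. f (- x)) has_real_derivative - d (- x)) (at x)" if "\<And>x. (f has_real_derivative d x) (at x)" for f d :: "real \<Rightarrow> real" and x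
    using DERIV_mirror[of f "d (-x)" x] that[of "-x"] by simp
  have z: "(z has_real_derivative z' x) (at x)" for x
    unfolding z_def z'_def by (rule derivative_eq_intros m resp1[OF w] refl | simp)+
  have z': "(z' has_real_derivative (\<omega> + nl' (\<phi> \<omega> x)) * z x) (at x)" for x
    unfolding z'_def z_def
    by (rule derivative_eq_intros m resp2[OF w] refl)+ (use even[of \<omega>] w in \<open>auto simp: algebra_simps\<close>)
  have "\<bar>(\<omega> + nl' (\<phi> \<omega> x)) * z x\<bar> \<le> 0 + (1 + L) * \<bar>z x\<bar>" for x
    using L(2)[OF in_range[OF w, of x]] w by (auto simp: abs_mult intro!: mult_right_mono)
  then have "\<bar>z x\<bar> \<le> exp ((2 + (1 + L)) * x) * (\<bar>z 0\<bar> + 0)" if "x \<ge> 0" for x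
    using L(1) that deriv_resp_0[OF w]
    by (intro second_order_gronwall[OF z z', of x 0 "1 + L" x]) (auto simp: z'_def)
  then have "z x = 0" if "x \<ge> 0" for x using that by (auto simp: z_def)
  from this[of x] this[of "- x"] show ?thesis unfolding z_def by (cases "x \<ge> 0") auto
qed

text \<open>All data of the linearised equation are bounded independently of
  \<open>\<omega>\<close>: the coefficient by \<open>1 + L\<close>, the forcing by
  \<open>\<phi> 1 0\<close> and the initial value by \<open>1 / c\<close>.\<close>

lemma resp_bounded: "\<exists>C\<ge>0. \<forall>\<omega>\<in>{0..1}. \<forall>x. \<bar>x\<bar> \<le> X \<longrightarrow> \<bar>resp \<omega> x\<bar> \<le> C"
proof -
  obtain L where L: "L \<ge> 0" "\<And>v. v \<in> {0..\<phi> 1 0} \<Longrightarrow> \<bar>nl' v\<bar> \<le> L" using nl'_bound by blast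
  obtain c where c: "c > 0" "\<And>v. v \<in> {\<phi> 0 0..\<phi> 1 0} \<Longrightarrow> c \<le> g' v" using g'_lower by blast
  define C where "C = exp ((2 + (1 + L)) * X) * (1 / c + \<phi> 1 0)"
  have b: "\<bar>resp \<omega> x\<bar> \<le> C" if w: "\<omega> \<in> {0..1}" and x: "0 \<le> x" "x \<le> X" for \<omega> x
  proof -
    have "\<bar>(\<omega> + nl' (\<phi> \<omega> x)) * resp \<omega> x + \<phi> \<omega> x\<bar> \<le> \<phi> 1 0 + (1 + L) * \<bar>resp \<omega> x\<bar>" for x
    proof -
      have "\<bar>(\<omega> + nl' (\<phi> \<omega> x)) * resp \<omega> x\<bar> \<le> (1 + L) * \<bar>resp \<omega> x\<bar>"
        using L(2)[OF in_range[OF w, of x]] w by (auto simp: abs_mult intro!: mult_right_mono)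
      then show ?thesis using in_range[OF w, of x] by auto
    qed
    then have "\<bar>resp \<omega> x\<bar> \<le> exp ((2 + (1 + L)) * X) * (\<bar>resp \<omega> 0\<bar> + \<phi> 1 0)"
      using L(1) x deriv_resp_0[OF w] pos[of 1 0]
      by (intro second_order_gronwall[OF resp1[OF w] resp2[OF w], of X "\<phi> 1 0" "1 + L" x]) auto
    also have "\<dots> \<le> C"
    proof -
      have "c \<le> g' (\<phi> \<omega> 0)" using c(2)[OF max_in[OF w]] .
      then have "\<bar>resp \<omega> 0\<bar> \<le> 1 / c" unfolding resp_0[OF w] using c(1) by (simp add: frac_le)
      then show ?thesis unfolding C_def by (intro mult_left_mono) auto
    qed
    finally show ?thesis .
  qed
  have "\<bar>resp \<omega> x\<bar> \<le> max C 0" if w: "\<omega> \<in> {0..1}" and x: "\<bar>x\<bar> \<le> X" for \<omega> x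
    using b[OF w, of "\<bar>x\<bar>"] x resp_even[OF w, of x] by (cases "x \<ge> 0") auto
  then show ?thesis by (intro exI[of _ "max C 0"]) auto
qed

section \<open>Differentiability in the frequency, uniformly on compact intervals\<close>

lemma lipschitz_in_omega:
  "\<exists>C\<ge>0. \<forall>\<omega>\<in>{0..1}. \<forall>\<omega>'\<in>{0..1}. \<forall>x. 0 \<le> x \<and> x \<le> X \<longrightarrow> \<bar>\<phi> \<omega>' x - \<phi> \<omega> x\<bar> \<le> C * \<bar>\<omega>' - \<omega>\<bar>"
proof -
  obtain L where L: "L \<ge> 0" "\<And>v. v \<in> {0..\<phi> 1 0} \<Longrightarrow> \<bar>nl' v\<bar> \<le> L" using nl'_bound by blast
  obtain C where C: "C \<ge> 0" "\<And>\<omega> \<omega>'. \<omega> \<in> {0..1} \<Longrightarrow> \<omega>' \<in> {0..1} \<Longrightarrow> \<bar>\<phi> \<omega>' 0 - \<phi> \<omega> 0\<bar> \<le> C * \<bar>\<omega>' - \<omega>\<bar>"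
    using max_lipschitz by blast
  have "\<bar>\<phi> \<omega>' x - \<phi> \<omega> x\<bar> \<le> exp ((2 + (1 + L)) * X) * (C + \<phi> 1 0) * \<bar>\<omega>' - \<omega>\<bar>"
    if w: "\<omega> \<in> {0..1}" and w': "\<omega>' \<in> {0..1}" and x: "0 \<le> x" "x \<le> X" for \<omega> \<omega>' x
  proof -
    define z where "z x = \<phi> \<omega>' x - \<phi> \<omega> x" for x
    define z' where "z' x = deriv (\<phi> \<omega>') x - deriv (\<phi> \<omega>) x" for x
    define z'' where "z'' x = \<omega>' * \<phi> \<omega>' x + nl (\<phi> \<omega>' x) - (\<omega> * \<phi> \<omega> x + nl (\<phi> \<omega> x))" for x
    have z: "(z has_real_derivative z' x) (at x)" and z': "(z' has_real_derivative z'' x) (at x)" for x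
      unfolding z_def z'_def z''_def using w w' by (auto intro!: derivative_intros deriv1 deriv2)
    have "\<bar>z'' x\<bar> \<le> \<phi> 1 0 * \<bar>\<omega>' - \<omega>\<bar> + (1 + L) * \<bar>z x\<bar>" for x
    proof -
      obtain \<xi> where \<xi>: "\<xi> \<in> {0..\<phi> 1 0}" "nl (\<phi> \<omega>' x) - nl (\<phi> \<omega> x) = nl' \<xi> * (\<phi> \<omega>' x - \<phi> \<omega> x)"
        using nl_difference[of "\<phi> \<omega> x" "\<phi> \<omega>' x"] pos le_max w w' by auto
      \<comment> \<open>The mean value form of \<open>nl\<close> makes the difference of two waves
        solve a linear equation with bounded coefficient and a forcing proportional to
        \<open>\<omega>' - \<omega>\<close>.\<close>
      have "z'' x = (\<omega>' - \<omega>) * \<phi> \<omega>' x + (\<omega> + nl' \<xi>) * z x"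
        unfolding z''_def z_def using \<xi>(2) by (simp add: algebra_simps)
      also have "\<bar>\<dots>\<bar> \<le> \<bar>\<omega>' - \<omega>\<bar> * \<bar>\<phi> \<omega>' x\<bar> + \<bar>\<omega> + nl' \<xi>\<bar> * \<bar>z x\<bar>"
        unfolding abs_mult [symmetric] by (rule abs_triangle_ineq)
      also have "\<dots> \<le> \<bar>\<omega>' - \<omega>\<bar> * \<phi> 1 0 + (1 + L) * \<bar>z x\<bar>"
        using in_range[OF w', of x] L(2)[OF \<xi>(1)] w by (intro add_mono mult_left_mono mult_right_mono) auto
      finally show ?thesis by (simp add: mult.commute)
    qed
    then have "\<bar>z x\<bar> \<le> exp ((2 + (1 + L)) * X) * (\<bar>z 0\<bar> + \<phi> 1 0 * \<bar>\<omega>' - \<omega>\<bar>)"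
      using L(1) x deriv_zero[of \<omega>] deriv_zero[of \<omega>'] w w' pos[of 1 0]
      by (intro second_order_gronwall[OF z z', of X _ "1 + L" x]) (auto simp: z'_def)
    also have "\<dots> \<le> exp ((2 + (1 + L)) * X) * ((C + \<phi> 1 0) * \<bar>\<omega>' - \<omega>\<bar>)"
      using C(2)[OF w w'] unfolding z_def by (intro mult_left_mono) (auto simp: algebra_simps)
    finally show ?thesis unfolding z_def by simp
  qed
  then show ?thesis
    using C(1) pos[of 1 0] by (intro exI[of _ "exp ((2 + (1 + L)) * X) * (C + \<phi> 1 0)"]) auto
qed

text \<open>The remainder solves the linearised equation at \<open>\<omega>\<close> with a forcing
  made of two products: \<open>\<omega>' - \<omega>\<close> and
  \<open>nl' \<xi> - nl' (\<phi> \<omega> x)\<close>, each times the difference of the waves. That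
  difference is Lipschitz in \<open>\<omega>\<close> and the other factors are small, so Gronwall
  applies. One \<open>\<delta>\<close> serves all pairs of frequencies, which allows their roles to
  be exchanged later.\<close>

lemma remainder_in_omega:
  assumes "\<epsilon> > 0"
  shows "\<exists>\<delta>>0. \<forall>\<omega>\<in>{0..1}. \<forall>\<omega>'\<in>{0..1}. \<bar>\<omega>' - \<omega>\<bar> < \<delta> \<longrightarrow> (\<forall>x. 0 \<le> x \<and> x \<le> X \<longrightarrow>
    \<bar>\<phi> \<omega>' x - \<phi> \<omega> x - (\<omega>' - \<omega>) * resp \<omega> x\<bar> \<le> \<epsilon> * \<bar>\<omega>' - \<omega>\<bar>)"
proof -
  obtain L where L: "L \<ge> 0" "\<And>v. v \<in> {0..\<phi> 1 0} \<Longrightarrow> \<bar>nl' v\<bar> \<le> L" using nl'_bound by blast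
  obtain C where C: "C \<ge> 0" "\<And>\<omega> \<omega>' x. \<omega> \<in> {0..1} \<Longrightarrow> \<omega>' \<in> {0..1} \<Longrightarrow> 0 \<le> x \<Longrightarrow> x \<le> X \<Longrightarrow> \<bar>\<phi> \<omega>' x - \<phi> \<omega> x\<bar> \<le> C * \<bar>\<omega>' - \<omega>\<bar>"
    using lipschitz_in_omega[of X] by blast
  define G where "G = exp ((2 + (1 + L)) * X)"
  \<comment> \<open>The peak remainder costs \<open>e\<close> and each of the two forcing products
    costs \<open>C * e\<close>; the Gronwall factor \<open>G\<close> brings the total to exactly
    \<open>\<epsilon>\<close>.\<close>
  define e where "e = \<epsilon> / (G * (2 * C + 1))"
  have G: "G > 0" unfolding G_def by simp
  have e: "e > 0" unfolding e_def using G C(1) assms by simp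
  have Ge: "G * (e + 2 * C * e) = \<epsilon>"
  proof -
    have "G * (e + 2 * C * e) = e * (G * (2 * C + 1))" by (simp add: algebra_simps)
    then show ?thesis unfolding e_def using G C(1) by simp
  qed
  obtain d1 where d1: "d1 > 0" "\<And>\<omega> \<omega>'. \<omega> \<in> {0..1} \<Longrightarrow> \<omega>' \<in> {0..1} \<Longrightarrow> \<bar>\<omega>' - \<omega>\<bar> < d1 \<Longrightarrow> 
    \<bar>\<phi> \<omega>' 0 - \<phi> \<omega> 0 - (\<omega>' - \<omega>) * (1 / g' (\<phi> \<omega> 0))\<bar> \<le> e * \<bar>\<omega>' - \<omega>\<bar>"
    using max_remainder[OF e] by blast
  have "uniformly_continuous_on {0..\<phi> 1 0} nl'"
    by (rule compact_uniformly_continuous[OF continuous_nl']) simp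
  then obtain d2 where d2: "d2 > 0" "\<And>u v. u \<in> {0..\<phi> 1 0} \<Longrightarrow> v \<in> {0..\<phi> 1 0} \<Longrightarrow> \<bar>u - v\<bar> < d2 \<Longrightarrow> \<bar>nl' u - nl' v\<bar> < e"
    using e unfolding uniformly_continuous_on_def dist_real_def by blast
  define \<delta> where "\<delta> = min (min d1 e) (d2 / (C + 1))"
  have \<delta>: "\<delta> > 0" unfolding \<delta>_def using d1 d2 e C(1) by simp
  have "\<bar>\<phi> \<omega>' x - \<phi> \<omega> x - (\<omega>' - \<omega>) * resp \<omega> x\<bar> \<le> \<epsilon> * \<bar>\<omega>' - \<omega>\<bar>"
    if w: "\<omega> \<in> {0..1}" and w': "\<omega>' \<in> {0..1}" and lt: "\<bar>\<omega>' - \<omega>\<bar> < \<delta>" and x: "0 \<le> x" "x \<le> X" for \<omega> \<omega>' x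
  proof -
    define z where "z x = \<phi> \<omega>' x - \<phi> \<omega> x - (\<omega>' - \<omega>) * resp \<omega> x" for x
    define z' where "z' x = deriv (\<phi> \<omega>') x - deriv (\<phi> \<omega>) x - (\<omega>' - \<omega>) * deriv (resp \<omega>) x" for x
    define z'' where "z'' x = \<omega>' * \<phi> \<omega>' x + nl (\<phi> \<omega>' x) - (\<omega> * \<phi> \<omega> x + nl (\<phi> \<omega> x))
        - (\<omega>' - \<omega>) * ((\<omega> + nl' (\<phi> \<omega> x)) * resp \<omega> x + \<phi> \<omega> x)" for x
    have z: "(z has_real_derivative z' x) (at x)" and z': "(z' has_real_derivative z'' x) (at x)" for x
      unfolding z_def z'_def z''_def using w w' by (auto intro!: DERIV_diff DERIV_cmult deriv1 deriv2 resp1 resp2)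
    have "\<bar>z'' x\<bar> \<le> 2 * C * e * \<bar>\<omega>' - \<omega>\<bar> + (1 + L) * \<bar>z x\<bar>" if x: "0 \<le> x" "x \<le> X" for x
    proof -
      let ?u = "\<phi> \<omega> x" and ?v = "\<phi> \<omega>' x"
      obtain \<xi> where \<xi>: "\<bar>\<xi> - ?u\<bar> \<le> \<bar>?v - ?u\<bar>" "\<xi> \<in> {0..\<phi> 1 0}" "nl ?v - nl ?u = nl' \<xi> * (?v - ?u)"
        using nl_difference[of "\<phi> \<omega> x" "\<phi> \<omega>' x"] pos le_max w w' by auto
      have lip: "\<bar>?v - ?u\<bar> \<le> C * \<bar>\<omega>' - \<omega>\<bar>" using C(2)[OF w w' x] .
      have "\<bar>\<xi> - ?u\<bar> \<le> (C + 1) * \<bar>\<omega>' - \<omega>\<bar>" using \<xi>(1) lip by (simp add: algebra_simps)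
      also have "\<dots> < d2" using lt C(1) unfolding \<delta>_def by (simp add: field_simps)
      finally have near: "\<bar>nl' \<xi> - nl' ?u\<bar> \<le> e" using d2(2)[OF \<xi>(2) in_range[OF w, of x]] by simp
      have "z'' x = ((\<omega>' - \<omega>) * (?v - ?u) + (nl' \<xi> - nl' ?u) * (?v - ?u)) + (\<omega> + nl' ?u) * z x"
        unfolding z''_def z_def using \<xi>(3) by (simp add: algebra_simps)
      also have "\<bar>\<dots>\<bar> \<le> (\<bar>\<omega>' - \<omega>\<bar> * \<bar>?v - ?u\<bar> + \<bar>nl' \<xi> - nl' ?u\<bar> * \<bar>?v - ?u\<bar>) + \<bar>\<omega> + nl' ?u\<bar> * \<bar>z x\<bar>"
        unfolding abs_mult [symmetric] by (intro order_trans[OF abs_triangle_ineq] add_mono) auto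
      also have "\<dots> \<le> (e * (C * \<bar>\<omega>' - \<omega>\<bar>) + e * (C * \<bar>\<omega>' - \<omega>\<bar>)) + (1 + L) * \<bar>z x\<bar>"
        using lip near lt e L(2)[OF in_range[OF w, of x]] w unfolding \<delta>_def by (intro add_mono mult_mono) auto
      finally show ?thesis by (simp add: algebra_simps)
    qed
    then have "\<bar>z x\<bar> \<le> G * (\<bar>z 0\<bar> + 2 * C * e * \<bar>\<omega>' - \<omega>\<bar>)"
      unfolding G_def using L(1) C(1) e x deriv_zero[of \<omega>] deriv_zero[of \<omega>'] deriv_resp_0[OF w] w w'
      by (intro second_order_gronwall[OF z z', of X _ "1 + L" x]) (auto simp: z'_def)
    also have "\<dots> \<le> G * (e * \<bar>\<omega>' - \<omega>\<bar> + 2 * C * e * \<bar>\<omega>' - \<omega>\<bar>)"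
      using d1(2)[OF w w'] lt G resp_0[OF w] unfolding z_def \<delta>_def by (intro mult_left_mono add_right_mono) auto
    also have "\<dots> = \<epsilon> * \<bar>\<omega>' - \<omega>\<bar>" unfolding Ge [symmetric] by (simp add: algebra_simps)
    finally show ?thesis unfolding z_def .
  qed
  with \<delta> show ?thesis by blast
qed

text \<open>Evenness of the wave and of its response carries the estimate to negative
  \<open>x\<close>.\<close>

lemma remainder_in_omega_at:
  assumes "\<epsilon> > 0"
  obtains \<delta> where "\<delta> > 0" "\<And>\<omega> \<omega>'. \<omega> \<in> {0..1} \<Longrightarrow> \<omega>' \<in> {0..1} \<Longrightarrow> \<bar>\<omega>' - \<omega>\<bar> < \<delta> \<Longrightarrow>
    \<bar>\<phi> \<omega>' x - \<phi> \<omega> x - (\<omega>' - \<omega>) * resp \<omega> x\<bar> \<le> \<epsilon> * \<bar>\<omega>' - \<omega>\<bar>"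
proof -
  obtain \<delta> where \<delta>: "\<delta> > 0" "\<And>\<omega> \<omega>'. \<omega> \<in> {0..1} \<Longrightarrow> \<omega>' \<in> {0..1} \<Longrightarrow> \<bar>\<omega>' - \<omega>\<bar> < \<delta> \<Longrightarrow>
    \<bar>\<phi> \<omega>' \<bar>x\<bar> - \<phi> \<omega> \<bar>x\<bar> - (\<omega>' - \<omega>) * resp \<omega> \<bar>x\<bar>\<bar> \<le> \<epsilon> * \<bar>\<omega>' - \<omega>\<bar>"
    using remainder_in_omega[OF assms, of "\<bar>x\<bar>"] by (meson abs_ge_zero order_refl)
  have "\<phi> \<omega> \<bar>x\<bar> = \<phi> \<omega> x" "resp \<omega> \<bar>x\<bar> = resp \<omega> x" if "\<omega> \<in> {0..1}" for \<omega>
    using even[of \<omega> x] resp_even[OF that, of x] that by (auto simp: abs_if)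
  then show thesis using \<delta> by (intro that[of \<delta>]) metis+
qed

lemma resp_difference_quotient:
  assumes "\<epsilon> > 0"
  obtains \<delta> where "\<delta> > 0" "\<And>\<omega> \<omega>'. \<omega> \<in> {0..1} \<Longrightarrow> \<omega>' \<in> {0..1} \<Longrightarrow> \<omega>' \<noteq> \<omega> \<Longrightarrow> \<bar>\<omega>' - \<omega>\<bar> < \<delta> \<Longrightarrow>
    \<bar>(\<phi> \<omega>' x - \<phi> \<omega> x) / (\<omega>' - \<omega>) - resp \<omega> x\<bar> \<le> \<epsilon>"
proof -
  obtain \<delta> where \<delta>: "\<delta> > 0" "\<And>\<omega> \<omega>'. \<omega> \<in> {0..1} \<Longrightarrow> \<omega>' \<in> {0..1} \<Longrightarrow> \<bar>\<omega>' - \<omega>\<bar> < \<delta> \<Longrightarrow>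
    \<bar>\<phi> \<omega>' x - \<phi> \<omega> x - (\<omega>' - \<omega>) * resp \<omega> x\<bar> \<le> \<epsilon> * \<bar>\<omega>' - \<omega>\<bar>"
    using remainder_in_omega_at[OF assms] by metis
  show thesis
  proof (rule that[OF \<delta>(1)])
    fix \<omega> \<omega>' :: real
    assume w: "\<omega> \<in> {0..1}" "\<omega>' \<in> {0..1}" "\<omega>' \<noteq> \<omega>" "\<bar>\<omega>' - \<omega>\<bar> < \<delta>"
    have "(\<phi> \<omega>' x - \<phi> \<omega> x) / (\<omega>' - \<omega>) - resp \<omega> x = (\<phi> \<omega>' x - \<phi> \<omega> x - (\<omega>' - \<omega>) * resp \<omega> x) / (\<omega>' - \<omega>)"
      using w(3) by (simp add: field_simps)
    then show "\<bar>(\<phi> \<omega>' x - \<phi> \<omega> x) / (\<omega>' - \<omega>) - resp \<omega> x\<bar> \<le> \<epsilon>"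
      using \<delta>(2)[OF w(1,2,4)] w(3) by (simp add: abs_divide divide_le_eq)
  qed
qed

lemma phi_has_derivative:
  assumes "0 < \<omega>" "\<omega> < 1"
  shows "((\<lambda>w. \<phi> w x) has_real_derivative resp \<omega> x) (at \<omega>)"
  unfolding DERIV_def
proof (rule LIM_I)
  fix r :: real assume r: "r > 0"
  then have "r / 2 > 0" by simp
  then obtain \<delta> where \<delta>: "\<delta> > 0" "\<And>\<omega> \<omega>'. \<omega> \<in> {0..1} \<Longrightarrow> \<omega>' \<in> {0..1} \<Longrightarrow> \<omega>' \<noteq> \<omega> \<Longrightarrow> \<bar>\<omega>' - \<omega>\<bar> < \<delta> \<Longrightarrow>
    \<bar>(\<phi> \<omega>' x - \<phi> \<omega> x) / (\<omega>' - \<omega>) - resp \<omega> x\<bar> \<le> r / 2"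
    using resp_difference_quotient by metis
  show "\<exists>s>0. \<forall>h. h \<noteq> 0 \<and> norm (h - 0) < s \<longrightarrow> norm ((\<phi> (\<omega> + h) x - \<phi> \<omega> x) / h - resp \<omega> x) < r"
  proof (intro exI[of _ "min \<delta> (min \<omega> (1 - \<omega>))"] conjI allI impI)
    show "0 < min \<delta> (min \<omega> (1 - \<omega>))" using \<delta>(1) assms by simp
    fix h :: real assume h: "h \<noteq> 0 \<and> norm (h - 0) < min \<delta> (min \<omega> (1 - \<omega>))"
    then have "\<bar>(\<phi> (\<omega> + h) x - \<phi> \<omega> x) / (\<omega> + h - \<omega>) - resp \<omega> x\<bar> \<le> r / 2"
      using assms by (intro \<delta>(2)) (auto simp: abs_if split: if_splits)
    then show "norm ((\<phi> (\<omega> + h) x - \<phi> \<omega> x) / h - resp \<omega> x) < r" using r by simp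
  qed
qed

lemma eventually_small: "\<delta> > 0 \<Longrightarrow> eventually (\<lambda>\<omega>::real. 0 < \<omega> \<and> \<omega> < \<delta>) (at_right 0)"
  unfolding eventually_at_right_field by auto

text \<open>The remainder estimate is symmetric in the two frequencies, so it also compares their responses.\<close>

lemma resp_tendsto: "((\<lambda>\<omega>. resp \<omega> x) \<longlongrightarrow> resp 0 x) (at_right 0)"
proof (rule tendstoI)
  fix e :: real assume e: "e > 0"
  then have "e / 3 > 0" by simp
  then obtain \<delta> where \<delta>: "\<delta> > 0" "\<And>\<omega> \<omega>'. \<omega> \<in> {0..1} \<Longrightarrow> \<omega>' \<in> {0..1} \<Longrightarrow> \<omega>' \<noteq> \<omega> \<Longrightarrow> \<bar>\<omega>' - \<omega>\<bar> < \<delta> \<Longrightarrow>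
    \<bar>(\<phi> \<omega>' x - \<phi> \<omega> x) / (\<omega>' - \<omega>) - resp \<omega> x\<bar> \<le> e / 3"
    using resp_difference_quotient by metis
  have "dist (resp \<omega> x) (resp 0 x) < e" if w: "0 < \<omega>" "\<omega> < min \<delta> 1" for \<omega>
  proof -
    have "\<bar>(\<phi> \<omega> x - \<phi> 0 x) / (\<omega> - 0) - resp 0 x\<bar> \<le> e / 3"
      using w by (intro \<delta>(2)) auto
    moreover have "\<bar>(\<phi> 0 x - \<phi> \<omega> x) / (0 - \<omega>) - resp \<omega> x\<bar> \<le> e / 3"
      using w by (intro \<delta>(2)) auto
    moreover have "(\<phi> 0 x - \<phi> \<omega> x) / (0 - \<omega>) = (\<phi> \<omega> x - \<phi> 0 x) / (\<omega> - 0)"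
      using w by (simp add: field_simps)
    ultimately show ?thesis using e unfolding dist_real_def by (simp only:)
  qed
  then show "eventually (\<lambda>\<omega>. dist (resp \<omega> x) (resp 0 x) < e) (at_right 0)"
    using eventually_small[of "min \<delta> 1"] \<delta>(1) by (auto elim!: eventually_mono)
qed

lemma phi_tendsto: "((\<lambda>\<omega>. \<phi> \<omega> x) \<longlongrightarrow> \<phi> 0 x) (at_right 0)"
proof -
  obtain \<delta> where \<delta>: "\<delta> > 0" "\<And>\<omega> \<omega>'. \<omega> \<in> {0..1} \<Longrightarrow> \<omega>' \<in> {0..1} \<Longrightarrow> \<bar>\<omega>' - \<omega>\<bar> < \<delta> \<Longrightarrow>
    \<bar>\<phi> \<omega>' x - \<phi> \<omega> x - (\<omega>' - \<omega>) * resp \<omega> x\<bar> \<le> 1 * \<bar>\<omega>' - \<omega>\<bar>"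
    using remainder_in_omega_at[of 1] by (metis zero_less_one)
  have "((\<lambda>\<omega>. (1 + \<bar>resp 0 x\<bar>) * \<omega>) \<longlongrightarrow> (1 + \<bar>resp 0 x\<bar>) * 0) (at_right 0)"
    by (intro tendsto_intros)
  then have lim: "((\<lambda>\<omega>. (1 + \<bar>resp 0 x\<bar>) * \<omega>) \<longlongrightarrow> 0) (at_right 0)" by simp
  have "norm (\<phi> \<omega> x - \<phi> 0 x) \<le> (1 + \<bar>resp 0 x\<bar>) * \<omega>" if "0 < \<omega>" "\<omega> < min \<delta> 1" for \<omega>
  proof -
    have "\<bar>\<phi> \<omega> x - \<phi> 0 x - (\<omega> - 0) * resp 0 x\<bar> \<le> 1 * \<bar>\<omega> - 0\<bar>"
      using that by (intro \<delta>(2)) auto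
    moreover have "\<bar>\<omega> * resp 0 x\<bar> = \<omega> * \<bar>resp 0 x\<bar>" using that by (simp add: abs_mult)
    ultimately show ?thesis using that by (simp add: algebra_simps)
  qed
  then have "((\<lambda>\<omega>. \<phi> \<omega> x - \<phi> 0 x) \<longlongrightarrow> 0) (at_right 0)"
    using eventually_small[of "min \<delta> 1"] \<delta>(1)
    by (intro Lim_null_comparison[OF _ lim]) (auto elim!: eventually_mono)
  then show ?thesis by (simp add: LIM_zero_iff)
qed

lemma eta_eq: "0 < \<omega> \<Longrightarrow> \<omega> < 1 \<Longrightarrow> eta \<phi> \<omega> x = resp \<omega> x"
  unfolding eta_def by (intro DERIV_imp_deriv phi_has_derivative)

lemma eta0_eq: "eta0 \<phi> x = resp 0 x"
proof -
  have "((\<lambda>\<omega>. eta \<phi> \<omega> x) \<longlongrightarrow> resp 0 x) (at_right 0)"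
    by (rule Lim_transform_eventually[OF resp_tendsto])
       (use eventually_small[of 1] eta_eq in \<open>auto elim!: eventually_mono\<close>)
  then show ?thesis unfolding eta0_def by (intro tendsto_Lim) auto
qed

end

section \<open>Decay of the standing waves and of their response\<close>

text \<open>Passing through the exponent \<open>- \<bar>r\<bar>\<close> covers growing and decaying
  weights at once.\<close>

lemma powr_local_bound:
  fixes x X r :: real
  assumes "\<bar>x\<bar> \<le> X"
  shows "1 \<le> (1 + X) powr \<bar>r\<bar> * (1 + \<bar>x\<bar>) powr r"
proof -
  have "1 = (1 + \<bar>x\<bar>) powr (\<bar>r\<bar> - \<bar>r\<bar>)" by simp
  also have "\<dots> = (1 + \<bar>x\<bar>) powr \<bar>r\<bar> * (1 + \<bar>x\<bar>) powr (- \<bar>r\<bar>)" by (simp add: powr_add [symmetric])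
  also have "\<dots> \<le> (1 + X) powr \<bar>r\<bar> * (1 + \<bar>x\<bar>) powr r"
    using assms by (intro mult_mono powr_mono2 powr_mono) auto
  finally show ?thesis .
qed

text \<open>Glues a constant bound near the origin and a power bound at infinity into a single
  global power bound, the form in which integrability and size on annuli are read off.\<close>

lemma powr_bound_extend:
  fixes u :: real
  assumes in_bound: "\<bar>x\<bar> \<le> X \<Longrightarrow> u \<le> B" and out_bound: "\<bar>x\<bar> \<ge> X \<Longrightarrow> u \<le> C * (1 + \<bar>x\<bar>) powr r" and "B \<ge> 0"
  shows "u \<le> max C (B * (1 + X) powr \<bar>r\<bar>) * (1 + \<bar>x\<bar>) powr r"
proof (cases "\<bar>x\<bar> \<le> X")
  case True
  have "u \<le> B * ((1 + X) powr \<bar>r\<bar> * (1 + \<bar>x\<bar>) powr r)"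
    using in_bound[OF True] mult_left_mono[OF powr_local_bound[OF True, of r] \<open>B \<ge> 0\<close>] by simp
  also have "\<dots> \<le> max C (B * (1 + X) powr \<bar>r\<bar>) * (1 + \<bar>x\<bar>) powr r"
    unfolding mult.assoc [symmetric] by (intro mult_right_mono) auto
  finally show ?thesis .
next
  case False
  then have "u \<le> C * (1 + \<bar>x\<bar>) powr r" using out_bound by simp
  also have "\<dots> \<le> max C (B * (1 + X) powr \<bar>r\<bar>) * (1 + \<bar>x\<bar>) powr r"
    by (intro mult_right_mono) auto
  finally show ?thesis .
qed

context double_power
begin

text \<open>\<open>\<phi> 0\<close> decays like \<open>\<bar>x\<bar>\<close> to the power \<open>- s\<close>, and \<open>\<kappa> = 1 / s\<close>.\<close>

definition s :: real where "s = 2 / (p - 1)"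
definition \<kappa> :: real where "\<kappa> = (p - 1) / 2"

lemma s_kappa: "s * \<kappa> = 1" and s_pos: "s > 0" and kappa_pos: "\<kappa> > 0"
  using p_gt_1 by (auto simp: s_def \<kappa>_def)

lemma neg_g_upper: "v > 0 \<Longrightarrow> - g v \<le> v powr (p - 1)"
proof -
  assume "v > 0"
  have "2 / (p + 1) * v powr (p - 1) \<le> 1 * v powr (p - 1)"
    using p_gt_1 by (intro mult_right_mono) auto
  moreover have "0 \<le> 2 / (q + 1) * v powr (q - 1)" using p_gt_1 p_lt_q by simp
  ultimately show ?thesis unfolding g_def by linarith
qed

text \<open>For small \<open>v\<close> the \<open>q\<close>-term of \<open>g\<close> is at most half
  of the \<open>p\<close>-term; \<open>c\<close> is the value of \<open>v powr (q - p)\<close> at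
  which it is exactly half.\<close>

lemma neg_g_lower: "\<exists>v1>0. \<forall>v. 0 < v \<and> v \<le> v1 \<longrightarrow> 1 / (p + 1) * v powr (p - 1) \<le> - g v"
proof -
  define c where "c = (q + 1) / (2 * (p + 1))"
  have c: "c > 0" unfolding c_def using p_gt_1 p_lt_q by simp
  have "1 / (p + 1) * v powr (p - 1) \<le> - g v" if v: "0 < v" "v \<le> c powr (1 / (q - p))" for v
  proof -
    have "v powr (q - p) \<le> (c powr (1 / (q - p))) powr (q - p)" using v p_lt_q by (intro powr_mono2) auto
    also have "\<dots> = c" using c p_lt_q by (simp add: powr_powr)
    finally have "2 / (q + 1) * v powr (q - p) \<le> 2 / (q + 1) * c"
      using p_gt_1 p_lt_q by (intro mult_left_mono) auto
    also have "2 / (q + 1) * c = 1 / (p + 1)"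
      unfolding c_def using p_gt_1 p_lt_q by (simp add: divide_simps) (simp add: algebra_simps)
    finally have le: "2 / (q + 1) * v powr (q - p) \<le> 1 / (p + 1)" .
    have "v powr (q - 1) = v powr (q - p) * v powr (p - 1)" by (simp add: powr_add [symmetric])
    then have "- g v = (2 * (1 / (p + 1)) - 2 / (q + 1) * v powr (q - p)) * v powr (p - 1)"
      unfolding g_def by (simp add: left_diff_distrib)
    also have "\<dots> \<ge> 1 / (p + 1) * v powr (p - 1)"
      using le by (intro mult_right_mono) auto
    finally show ?thesis .
  qed
  then show ?thesis using c by (intro exI[of _ "c powr (1 / (q - p))"]) auto
qed

end

context family
begin

lemma phi_abs: "\<omega> \<ge> 0 \<Longrightarrow> \<phi> \<omega> \<bar>x\<bar> = \<phi> \<omega> x"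
  using even[of \<omega> x] by (auto simp: abs_if)

lemma resp_abs: "\<omega> \<in> {0..1} \<Longrightarrow> resp \<omega> \<bar>x\<bar> = resp \<omega> x"
  using resp_even[of \<omega> x] by (auto simp: abs_if)

text \<open>The energy identity, differentiated in \<open>\<omega>\<close>.\<close>

lemma resp_first_order:
  assumes w: "\<omega> \<in> {0..1}"
  shows "2 * deriv (\<phi> \<omega>) x * deriv (resp \<omega>) x = (\<phi> \<omega> x)\<^sup>2 + 2 * (\<omega> * \<phi> \<omega> x + nl (\<phi> \<omega> x)) * resp \<omega> x"
proof -
  have w0: "\<omega> \<ge> 0" using w by simp
  define W where "W x = 2 * deriv (\<phi> \<omega>) x * deriv (resp \<omega>) x - (\<phi> \<omega> x)\<^sup>2 - 2 * (\<omega> * \<phi> \<omega> x + nl (\<phi> \<omega> x)) * resp \<omega> x" for x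
  have nl': "((\<lambda>x. nl (\<phi> \<omega> x)) has_real_derivative nl' (\<phi> \<omega> x) * deriv (\<phi> \<omega>) x) (at x)" for x
    using DERIV_chain2[OF nl_has_derivative[OF pos[OF w0]] deriv1[OF w0]] .
  have "(W has_real_derivative 0) (at x)" for x
    unfolding W_def
    by (rule derivative_eq_intros resp1[OF w] resp2[OF w] deriv1[OF w0] deriv2[OF w0] nl' refl)+ (simp add: algebra_simps power2_eq_square)
  then have "W x = W 0" using DERIV_isconst_all[of W] by blast
  also have "\<dots> = - (\<phi> \<omega> 0)\<^sup>2 - 2 * (\<omega> * \<phi> \<omega> 0 + nl (\<phi> \<omega> 0)) * (1 / g' (\<phi> \<omega> 0))"
    unfolding W_def deriv_zero[OF w0] resp_0[OF w] by simp
  \<comment> \<open>At the peak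
    \<open>2 * (\<omega> * \<phi> \<omega> 0 + nl (\<phi> \<omega> 0))\<close> equals
    \<open>- (\<phi> \<omega> 0)\<^sup>2 * g' (\<phi> \<omega> 0)\<close>, so the initial value
    \<open>1 / g'\<close> of the response is precisely the one that makes the constant
    vanish.\<close>
  also have "\<dots> = 0"
    unfolding standing.deriv2_eq_g[OF standing[OF w0]] g_max[OF w0] using g_pos_range[OF max_in[OF w]] by simp
  finally show ?thesis unfolding W_def by simp
qed

text \<open>Reduction of order, as \<open>\<phi>'\<close> solves the homogeneous equation.\<close>

lemma resp_quotient_derivative:
  assumes w: "\<omega> \<in> {0..1}" and x: "x > 0"
  shows "((\<lambda>x. resp \<omega> x / deriv (\<phi> \<omega>) x) has_real_derivative 1 / (2 * (\<omega> - g (\<phi> \<omega> x)))) (at x)"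
proof -
  have w0: "\<omega> \<ge> 0" using w by simp
  have neg: "deriv (\<phi> \<omega>) x < 0" using standing.deriv_neg[OF standing[OF w0] x] .
  have D: "\<omega> - g (\<phi> \<omega> x) > 0" using standing.g_less[OF standing[OF w0], of x] x by simp
  have "((\<lambda>x. resp \<omega> x / deriv (\<phi> \<omega>) x) has_real_derivative
      (deriv (resp \<omega>) x * deriv (\<phi> \<omega>) x - resp \<omega> x * (\<omega> * \<phi> \<omega> x + nl (\<phi> \<omega> x))) / (deriv (\<phi> \<omega>) x * deriv (\<phi> \<omega>) x)) (at x)"
    using neg by (intro DERIV_divide resp1[OF w] deriv2[OF w0]) auto
  moreover have "deriv (resp \<omega>) x * deriv (\<phi> \<omega>) x - resp \<omega> x * (\<omega> * \<phi> \<omega> x + nl (\<phi> \<omega> x)) = (\<phi> \<omega> x)\<^sup>2 / 2"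
    using resp_first_order[OF w, of x] by (simp add: algebra_simps)
  moreover have "deriv (\<phi> \<omega>) x * deriv (\<phi> \<omega>) x = (\<phi> \<omega> x)\<^sup>2 * (\<omega> - g (\<phi> \<omega> x))"
    using standing.energy[OF standing[OF w0], of x] by (simp add: power2_eq_square)
  moreover have "(\<phi> \<omega> x)\<^sup>2 / 2 / ((\<phi> \<omega> x)\<^sup>2 * (\<omega> - g (\<phi> \<omega> x))) = 1 / (2 * (\<omega> - g (\<phi> \<omega> x)))"
    using pos[OF w0, of x] by simp
  ultimately show ?thesis by simp
qed

section \<open>Bounds uniform in small frequencies\<close>

lemma uniform_small:
  assumes "v1 > 0"
  obtains X0 \<omega>0 k where "X0 > 0" "0 < \<omega>0" "\<omega>0 < 1" "k > 0"
    "\<And>\<omega> x. \<omega> \<in> {0..\<omega>0} \<Longrightarrow> x \<ge> X0 \<Longrightarrow> \<phi> \<omega> x \<le> v1" "\<And>\<omega>. \<omega> \<in> {0..\<omega>0} \<Longrightarrow> k \<le> \<phi> \<omega> X0"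
proof -
  have "eventually (\<lambda>x. \<phi> 0 x < v1 / 2 \<and> x > 0) at_top"
    using order_tendstoD(2)[OF standing.decay_top[OF standing[of 0]], of "v1/2"] assms eventually_gt_at_top[of 0]
    by (auto simp: eventually_conj_iff)
  then obtain X0 where X0: "\<phi> 0 X0 < v1 / 2" "X0 > 0" using eventually_happens by force
  obtain C where C: "C \<ge> 0" "\<And>\<omega> \<omega>' x. \<omega> \<in> {0..1} \<Longrightarrow> \<omega>' \<in> {0..1} \<Longrightarrow> 0 \<le> x \<Longrightarrow> x \<le> X0 \<Longrightarrow> \<bar>\<phi> \<omega>' x - \<phi> \<omega> x\<bar> \<le> C * \<bar>\<omega>' - \<omega>\<bar>"
    using lipschitz_in_omega[of X0] by blast
  \<comment> \<open>A perturbation by \<open>r\<close> keeps the value at \<open>X0\<close> below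
    \<open>v1\<close>, by the first entry, and above \<open>\<phi> 0 X0 / 2\<close>, by the second.
    Monotonicity extends the upper bound to all \<open>x \<ge> X0\<close>.\<close>
  define r where "r = min (v1 / 2) (\<phi> 0 X0 / 2)"
  have r: "r > 0" unfolding r_def using assms pos[of 0 X0] by simp
  define \<omega>0 where "\<omega>0 = min (1/2) (r / (C + 1))"
  have \<omega>0: "0 < \<omega>0" "\<omega>0 < 1" unfolding \<omega>0_def using r C(1) by auto
  have near: "\<bar>\<phi> \<omega> X0 - \<phi> 0 X0\<bar> \<le> r" if w: "\<omega> \<in> {0..\<omega>0}" for \<omega>
  proof -
    have "\<bar>\<phi> \<omega> X0 - \<phi> 0 X0\<bar> \<le> C * \<bar>\<omega> - 0\<bar>" using w \<omega>0 X0 by (intro C(2)) auto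
    also have "\<dots> \<le> (C + 1) * (r / (C + 1))" using w C(1) unfolding \<omega>0_def by (intro mult_mono) auto
    also have "\<dots> = r" using C(1) by simp
    finally show ?thesis .
  qed
  show thesis
  proof (rule that[of X0 \<omega>0 "\<phi> 0 X0 / 2"])
    fix \<omega> x assume w: "\<omega> \<in> {0..\<omega>0}" and x: "x \<ge> X0"
    have "\<phi> \<omega> x \<le> \<phi> \<omega> X0" using standing.decr[OF standing, of \<omega> X0 x] w x X0 by simp
    then show "\<phi> \<omega> x \<le> v1" using near[OF w] X0 unfolding r_def by linarith
  next
    fix \<omega> assume w: "\<omega> \<in> {0..\<omega>0}"
    show "\<phi> 0 X0 / 2 \<le> \<phi> \<omega> X0" using near[OF w] unfolding r_def by linarith
  qed (use X0 \<omega>0 pos[of 0 X0] in auto)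
qed

text \<open>The power \<open>- \<kappa>\<close> straightens the decay: since
  \<open>\<phi>' = - \<phi> * sqrt (\<omega> - g \<phi>)\<close> and
  \<open>sqrt (- g \<phi>)\<close> is comparable to \<open>\<phi> powr \<kappa>\<close> for small
  \<open>\<phi>\<close>, the derivative at \<open>\<omega> = 0\<close> stays between positive
  constants far out. For \<open>\<omega> > 0\<close> the lower bound persists.\<close>

lemma phi_powr_derivative:
  assumes w: "\<omega> \<ge> 0" and x: "x \<ge> 0"
  shows "((\<lambda>x. \<phi> \<omega> x powr (- \<kappa>)) has_real_derivative \<kappa> * (\<phi> \<omega> x powr (- \<kappa>) * sqrt (\<omega> - g (\<phi> \<omega> x)))) (at x)"
proof -
  have "((\<lambda>x. \<phi> \<omega> x powr (- \<kappa>)) has_real_derivative (- \<kappa> * \<phi> \<omega> x powr (- \<kappa> - 1)) * deriv (\<phi> \<omega>) x) (at x)"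
    by (rule DERIV_chain2[OF has_real_derivative_powr[OF pos[OF w]] deriv1[OF w]])
  also have "(- \<kappa> * \<phi> \<omega> x powr (- \<kappa> - 1)) * deriv (\<phi> \<omega>) x = \<kappa> * ((\<phi> \<omega> x powr (- \<kappa> - 1) * \<phi> \<omega> x) * sqrt (\<omega> - g (\<phi> \<omega> x)))"
    unfolding standing.deriv_eq[OF standing[OF w] x] by simp
  also have "\<phi> \<omega> x powr (- \<kappa> - 1) * \<phi> \<omega> x = \<phi> \<omega> x powr (- \<kappa>)"
    using pos[OF w, of x] by (simp add: powr_diff)
  finally show ?thesis .
qed

lemma sqrt_powr: "v > 0 \<Longrightarrow> sqrt (v powr (p - 1)) = v powr \<kappa>"
  by (simp add: \<kappa>_def powr_half_sqrt [symmetric] powr_powr)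

text \<open>\<open>\<phi>\<^sup>-\<^sup>\<kappa>\<close> grows linearly in \<open>x\<close>, at a rate bounded from below uniformly in small \<open>\<omega>\<close>.\<close>

lemma uniform_decay:
  obtains X0 \<omega>0 k C m where "X0 > 0" "0 < \<omega>0" "\<omega>0 < 1" "k > 0" "C > 0" "0 < m" "m < 1"
    "\<And>\<omega>. \<omega> \<in> {0..\<omega>0} \<Longrightarrow> k \<le> \<phi> \<omega> X0"
    "\<And>\<omega> x. \<omega> \<in> {0..\<omega>0} \<Longrightarrow> x \<ge> X0 \<Longrightarrow> m * \<phi> \<omega> x powr (p - 1) \<le> - g (\<phi> \<omega> x)"
    "\<And>\<omega> x. \<omega> \<in> {0..\<omega>0} \<Longrightarrow> \<phi> \<omega> x \<le> C * (1 + \<bar>x\<bar>) powr (- s)"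
proof -
  define m where "m = 1 / (p + 1)"
  have m: "0 < m" "m < 1" unfolding m_def using p_gt_1 by auto
  obtain v1 where v1: "v1 > 0" "\<And>v. 0 < v \<Longrightarrow> v \<le> v1 \<Longrightarrow> m * v powr (p - 1) \<le> - g v"
    using neg_g_lower unfolding m_def by blast
  obtain X0 \<omega>0 k where X: "X0 > 0" "0 < \<omega>0" "\<omega>0 < 1" "k > 0"
    "\<And>\<omega> x. \<omega> \<in> {0..\<omega>0} \<Longrightarrow> x \<ge> X0 \<Longrightarrow> \<phi> \<omega> x \<le> v1" "\<And>\<omega>. \<omega> \<in> {0..\<omega>0} \<Longrightarrow> k \<le> \<phi> \<omega> X0"
    using uniform_small[OF v1(1)] by blast
  have low: "m * \<phi> \<omega> x powr (p - 1) \<le> - g (\<phi> \<omega> x)" if "\<omega> \<in> {0..\<omega>0}" "x \<ge> X0" for \<omega> x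
    using v1(2)[OF pos X(5)[OF that]] that by simp
  define A where "A = \<phi> 1 0"
  have A: "A > 0" unfolding A_def using pos[of 1 0] by simp
  define r where "r = \<kappa> * sqrt m"
  have r: "r > 0" unfolding r_def using kappa_pos m by simp
  \<comment> \<open>With this \<open>c\<close> the line \<open>c * (1 + x)\<close> starts below
    \<open>\<phi> powr (- \<kappa>)\<close> at \<open>X0\<close> and has slope at most
    \<open>r\<close>, so it stays below.\<close>
  define c where "c = min r (A powr (- \<kappa>) / (1 + X0))"
  have c: "c > 0" unfolding c_def using r A X by simp
  have rate: "\<phi> \<omega> x \<le> c powr (- s) * (1 + \<bar>x\<bar>) powr (- s)" if w: "\<omega> \<in> {0..\<omega>0}" and x: "\<bar>x\<bar> \<ge> X0" for \<omega> x
  proof -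
    have w0: "\<omega> \<ge> 0" "\<omega> \<in> {0..1}" using w X by auto
    let ?y = "\<lambda>x. \<phi> \<omega> x powr (- \<kappa>)"
    have "?y X0 - r * X0 \<le> ?y \<bar>x\<bar> - r * \<bar>x\<bar>"
    proof (rule DERIV_nonneg_imp_nondecreasing[OF x], intro exI conjI)
      fix t assume t: "X0 \<le> t"
      show "((\<lambda>x. ?y x - r * x) has_real_derivative \<kappa> * (\<phi> \<omega> t powr (- \<kappa>) * sqrt (\<omega> - g (\<phi> \<omega> t))) - r) (at t)"
        using phi_powr_derivative[OF w0(1), of t] t X
        by (intro DERIV_diff DERIV_cmult_Id) auto
      have "sqrt (m * \<phi> \<omega> t powr (p - 1)) \<le> sqrt (\<omega> - g (\<phi> \<omega> t))"
        using low[OF w t] w0 by (intro real_sqrt_le_mono) auto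
      then have "\<phi> \<omega> t powr (- \<kappa>) * (sqrt m * \<phi> \<omega> t powr \<kappa>) \<le> \<phi> \<omega> t powr (- \<kappa>) * sqrt (\<omega> - g (\<phi> \<omega> t))"
        using sqrt_powr[OF pos[OF w0(1), of t]] by (intro mult_left_mono) (auto simp: real_sqrt_mult)
      moreover have "\<phi> \<omega> t powr (- \<kappa>) * (sqrt m * \<phi> \<omega> t powr \<kappa>) = sqrt m"
        using pos[OF w0(1), of t] by (simp add: powr_minus field_simps)
      ultimately show "0 \<le> \<kappa> * (\<phi> \<omega> t powr (- \<kappa>) * sqrt (\<omega> - g (\<phi> \<omega> t))) - r"
        unfolding r_def using kappa_pos by simp
    qed
    moreover have "A powr (- \<kappa>) \<le> ?y X0"
      using le_max[OF w0(2), of X0] pos[OF w0(1), of X0] kappa_pos unfolding A_def by (intro powr_mono2') auto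
    ultimately have "A powr (- \<kappa>) + r * (\<bar>x\<bar> - X0) \<le> ?y \<bar>x\<bar>" by (simp add: algebra_simps)
    moreover have "c * (1 + X0) \<le> A powr (- \<kappa>)" 
      using X(1) by (subst pos_le_divide_eq [symmetric]) (auto simp: c_def)
    moreover have "c * (\<bar>x\<bar> - X0) \<le> r * (\<bar>x\<bar> - X0)" using x by (intro mult_right_mono) (auto simp: c_def)
    ultimately have "c * (1 + \<bar>x\<bar>) \<le> ?y \<bar>x\<bar>" by (simp add: algebra_simps)
    then have "(?y \<bar>x\<bar>) powr (- s) \<le> (c * (1 + \<bar>x\<bar>)) powr (- s)"
      using c s_pos by (intro powr_mono2') auto
    also have "(?y \<bar>x\<bar>) powr (- s) = \<phi> \<omega> x"
      unfolding phi_abs[OF w0(1)] using pos[OF w0(1), of x] s_kappa by (simp add: powr_powr mult.commute)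
    also have "(c * (1 + \<bar>x\<bar>)) powr (- s) = c powr (- s) * (1 + \<bar>x\<bar>) powr (- s)"
      using c by (simp add: powr_mult)
    finally show ?thesis .
  qed
  define C where "C = max (c powr (- s)) (A * (1 + X0) powr \<bar>- s\<bar>)"
  have "C > 0" unfolding C_def using c by (simp add: less_max_iff_disj)
  moreover have "\<phi> \<omega> x \<le> C * (1 + \<bar>x\<bar>) powr (- s)" if w: "\<omega> \<in> {0..\<omega>0}" for \<omega> x
    unfolding C_def using rate[OF w] le_max[of \<omega> x] w X A
    by (intro powr_bound_extend) (auto simp: A_def)
  ultimately show thesis using that[of X0 \<omega>0 k C m] X m low by blast
qed

text \<open>The quotient \<open>h = resp / \<phi>'\<close> has derivative \<open>1 / (2 D)\<close>
  with \<open>D = \<omega> - g \<phi>\<close>, and \<open>\<phi>' = - \<phi> * sqrt D\<close>.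
  Integrating from \<open>X0\<close> gives one term from \<open>h X0\<close> and one growing at most
  like \<open>x / D\<close>; multiplied by \<open>\<phi>'\<close> they yield the two summands.
  Stating the bound through \<open>\<phi>\<close> keeps it valid for exponential and polynomial
  decay alike.\<close>

lemma uniform_resp_bound:
  obtains X0 \<omega>0 C1 C2 where "X0 > 0" "0 < \<omega>0" "\<omega>0 < 1" "C1 \<ge> 0" "C2 \<ge> 0"
    "\<And>\<omega> x. \<omega> \<in> {0..\<omega>0} \<Longrightarrow> \<bar>x\<bar> \<ge> X0 \<Longrightarrow> \<bar>resp \<omega> x\<bar> \<le> C1 * \<phi> \<omega> x + C2 * (1 + \<bar>x\<bar>) * \<phi> \<omega> x powr (1 - \<kappa>)"
proof -
  obtain X0 \<omega>0 k C' m where X: "X0 > 0" "0 < \<omega>0" "\<omega>0 < 1" "k > 0" and m: "0 < m" "m < 1" and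
    k: "\<And>\<omega>. \<omega> \<in> {0..\<omega>0} \<Longrightarrow> k \<le> \<phi> \<omega> X0" and
    low: "\<And>\<omega> x. \<omega> \<in> {0..\<omega>0} \<Longrightarrow> x \<ge> X0 \<Longrightarrow> m * \<phi> \<omega> x powr (p - 1) \<le> - g (\<phi> \<omega> x)"
    using uniform_decay by metis
  obtain C where C: "C \<ge> 0" "\<And>\<omega> x. \<omega> \<in> {0..1} \<Longrightarrow> \<bar>x\<bar> \<le> X0 \<Longrightarrow> \<bar>resp \<omega> x\<bar> \<le> C"
    using resp_bounded by blast
  have bound: "\<bar>resp \<omega> x\<bar> \<le> C / (sqrt m * k) * \<phi> \<omega> x + 1 / (2 * m) * (1 + x) * \<phi> \<omega> x powr (1 - \<kappa>)"
    if w: "\<omega> \<in> {0..\<omega>0}" and x: "x \<ge> X0" for \<omega> x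
  proof -
    have w0: "\<omega> \<ge> 0" "\<omega> \<in> {0..1}" using w X by auto
    define D where "D x = \<omega> - g (\<phi> \<omega> x)" for x
    \<comment> \<open>\<open>E\<close> is comparable to \<open>D\<close>, as
      \<open>E \<le> D \<le> E / m\<close> beyond \<open>X0\<close>, and unlike \<open>D\<close> it
      is visibly decreasing. Hence the largest value of \<open>1 / E\<close> on an interval is at
      its right end.\<close>
    define E where "E x = \<omega> + m * \<phi> \<omega> x powr (p - 1)" for x
    define h where "h x = resp \<omega> x / deriv (\<phi> \<omega>) x" for x
    have Epos: "E t > 0" for t unfolding E_def using w0 m pos[OF w0(1), of t] by (intro add_nonneg_pos) auto
    have ED: "E t \<le> D t" if "t \<ge> X0" for t unfolding E_def D_def using low[OF w that] by simp
    have DE: "D t \<le> E t / m" for t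
    proof -
      have "\<omega> * m \<le> \<omega> * 1" using w0 m by (intro mult_left_mono) auto
      then have "m * D t \<le> E t"
        using mult_left_mono[OF neg_g_upper[OF pos[OF w0(1), of t]], of m] m unfolding D_def E_def by (simp add: algebra_simps)
      then show ?thesis using m by (simp add: field_simps)
    qed
    have Emono: "E x \<le> E t" if "X0 \<le> t" "t \<le> x" for t
      unfolding E_def using standing.decr[OF standing[OF w0(1)], of t x] that X m p_gt_1 less_imp_le[OF pos[OF w0(1)]]
      by (intro add_left_mono mult_left_mono powr_mono2) auto
    have d: "\<bar>deriv (\<phi> \<omega>) t\<bar> = \<phi> \<omega> t * sqrt (D t)" if "t \<ge> X0" for t
      using standing.deriv_eq[OF standing[OF w0(1)], of t] that X ED[OF that] Epos[of t] pos[OF w0(1), of t] unfolding D_def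
      by (simp add: abs_mult)
    have "\<bar>h x - h X0\<bar> \<le> (x - X0) / (2 * E x)"
    proof (cases "x = X0")
      case False
      then have lt: "X0 < x" using x by simp
      have "\<exists>z>X0. z < x \<and> h x - h X0 = (x - X0) * (1 / (2 * D z))"
        by (rule MVT2[OF lt]) (use resp_quotient_derivative[OF w0(2)] X in \<open>auto simp: h_def [abs_def] D_def\<close>)
      then obtain z where z: "z > X0" "z < x" "h x - h X0 = (x - X0) * (1 / (2 * D z))" by blast
      have "E x \<le> D z" using Emono[of z] ED[of z] z by simp
      then have "1 / (2 * D z) \<le> 1 / (2 * E x)" using Epos[of x] by (intro divide_left_mono) auto
      moreover have "0 \<le> 1 / (2 * D z)" using ED[of z] Epos[of z] z by simp
      ultimately have "(x - X0) * (1 / (2 * D z)) \<le> (x - X0) * (1 / (2 * E x))" "0 \<le> (x - X0) * (1 / (2 * D z))"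
        using lt by (intro mult_left_mono mult_nonneg_nonneg; simp)+
      then show ?thesis unfolding z(3) by simp
    qed simp
    then have h: "\<bar>h x\<bar> \<le> \<bar>h X0\<bar> + (x - X0) / (2 * E x)" by simp
    have nz: "deriv (\<phi> \<omega>) t \<noteq> 0" if "t \<ge> X0" for t
      using standing.deriv_neg[OF standing[OF w0(1)], of t] that X by simp
    have sq: "sqrt (D x) \<le> sqrt (E x) / sqrt m"
      using DE[of x] by (simp add: real_sqrt_divide [symmetric])
    have "\<bar>resp \<omega> x\<bar> = \<bar>deriv (\<phi> \<omega>) x\<bar> * \<bar>h x\<bar>" unfolding h_def using nz[OF x] by (simp add: abs_mult)
    also have "\<dots> \<le> (\<phi> \<omega> x * (sqrt (E x) / sqrt m)) * (\<bar>h X0\<bar> + (x - X0) / (2 * E x))"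
      unfolding d[OF x] using h sq pos[OF w0(1), of x] Epos[of x] ED[OF x] m by (intro mult_mono) (auto intro!: mult_left_mono)
    also have "\<dots> = \<phi> \<omega> x * (sqrt (E x) / sqrt m) * \<bar>h X0\<bar> + \<phi> \<omega> x * (sqrt (E x) / sqrt m) * ((x - X0) / (2 * E x))"
      by (rule distrib_left)
    \<comment> \<open>The denominator of \<open>h X0\<close> contains \<open>sqrt (D X0)\<close>,
      which is at least \<open>sqrt (E x)\<close>; so the roots cancel and the constant does not
      depend on \<open>\<omega>\<close>.\<close>
    also have "\<phi> \<omega> x * (sqrt (E x) / sqrt m) * \<bar>h X0\<bar> \<le> C / (sqrt m * k) * \<phi> \<omega> x"
    proof -
      have "\<bar>h X0\<bar> = \<bar>resp \<omega> X0\<bar> / (\<phi> \<omega> X0 * sqrt (D X0))" unfolding h_def d[OF order_refl, symmetric] by simp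
      also have "\<dots> \<le> C / (k * sqrt (E x))"
      proof (rule frac_le)
        show "\<bar>resp \<omega> X0\<bar> \<le> C" using C(2)[OF w0(2), of X0] X by simp
        have "sqrt (E x) \<le> sqrt (D X0)" using Emono[of X0] ED[of X0] x by simp
        then show "k * sqrt (E x) \<le> \<phi> \<omega> X0 * sqrt (D X0)" using k[OF w] X Epos[of x] by (intro mult_mono) auto
      qed (use C(1) X Epos[of x] in auto)
      finally have "\<phi> \<omega> x * (sqrt (E x) / sqrt m) * \<bar>h X0\<bar> \<le> \<phi> \<omega> x * (sqrt (E x) / sqrt m) * (C / (k * sqrt (E x)))"
        using pos[OF w0(1), of x] Epos[of x] m by (intro mult_left_mono) auto
      also have "\<dots> = C / (sqrt m * k) * \<phi> \<omega> x" using Epos[of x] by (simp add: field_simps)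
      finally show ?thesis .
    qed
    \<comment> \<open>One factor \<open>sqrt (E x)\<close> cancels; the other, in the denominator,
      is bounded below by its share \<open>sqrt m * \<phi> powr \<kappa>\<close>.\<close>
    also have "\<phi> \<omega> x * (sqrt (E x) / sqrt m) * ((x - X0) / (2 * E x)) \<le> 1 / (2 * m) * (1 + x) * \<phi> \<omega> x powr (1 - \<kappa>)"
    proof -
      have "sqrt m * \<phi> \<omega> x powr \<kappa> \<le> sqrt (E x)"
        unfolding sqrt_powr[OF pos[OF w0(1)], symmetric] real_sqrt_mult [symmetric] E_def using w0 by simp
      then have "m * \<phi> \<omega> x powr \<kappa> \<le> sqrt m * sqrt (E x)"
        using mult_left_mono[of "sqrt m * \<phi> \<omega> x powr \<kappa>" "sqrt (E x)" "sqrt m"] m by (simp flip: mult.assoc)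
      then have le: "1 / (sqrt m * sqrt (E x)) \<le> 1 / (m * \<phi> \<omega> x powr \<kappa>)"
        using m pos[OF w0(1), of x] Epos[of x] by (intro divide_left_mono) auto
      have "\<phi> \<omega> x * (sqrt (E x) / sqrt m) * ((x - X0) / (2 * (sqrt (E x) * sqrt (E x)))) = \<phi> \<omega> x * (x - X0) / 2 * (1 / (sqrt m * sqrt (E x)))"
        using Epos[of x] by (simp add: divide_simps)
      then have "\<phi> \<omega> x * (sqrt (E x) / sqrt m) * ((x - X0) / (2 * E x)) = \<phi> \<omega> x * (x - X0) / 2 * (1 / (sqrt m * sqrt (E x)))"
        using Epos[of x] by simp
      also have "\<dots> \<le> \<phi> \<omega> x * (1 + x) / 2 * (1 / (m * \<phi> \<omega> x powr \<kappa>))"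
        using le x X pos[OF w0(1), of x] Epos[of x] m by (intro mult_mono divide_right_mono mult_left_mono) auto
      also have "\<dots> = 1 / (2 * m) * (1 + x) * \<phi> \<omega> x powr (1 - \<kappa>)"
        using pos[OF w0(1), of x] m by (simp add: powr_diff field_simps)
      finally show ?thesis .
    qed
    finally show ?thesis by simp
  qed
  show thesis
  proof (rule that[of X0 \<omega>0 "C / (sqrt m * k)" "1 / (2 * m)"])
    fix \<omega> x assume w: "\<omega> \<in> {0..\<omega>0}" and x: "\<bar>x\<bar> \<ge> X0"
    show "\<bar>resp \<omega> x\<bar> \<le> C / (sqrt m * k) * \<phi> \<omega> x + 1 / (2 * m) * (1 + \<bar>x\<bar>) * \<phi> \<omega> x powr (1 - \<kappa>)"
      using bound[OF w x] w X by (simp add: phi_abs resp_abs)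
  qed (use X C m in auto)
qed

text \<open>The product is bounded by \<open>\<phi>^2\<close> and
  \<open>(1 + \<bar>x\<bar>) * \<phi> powr (2 - \<kappa>)\<close>. Since \<open>p < 5\<close> makes
  \<open>2 - \<kappa>\<close> positive, the uniform upper bound on \<open>\<phi>\<close> suffices; a
  uniform polynomial lower bound would fail for \<open>\<omega> > 0\<close>. The exponent follows
  from \<open>s * \<kappa> = 1\<close>.\<close>

lemma uniform_product_bound:
  assumes "p < 5"
  obtains \<omega>0 C where "0 < \<omega>0" "\<omega>0 < 1" "C \<ge> 0"
    "\<And>\<omega> x. \<omega> \<in> {0..\<omega>0} \<Longrightarrow> \<phi> \<omega> x \<le> C * (1 + \<bar>x\<bar>) powr (- s)"
    "\<And>\<omega> x. \<omega> \<in> {0..\<omega>0} \<Longrightarrow> \<bar>\<phi> \<omega> x * resp \<omega> x\<bar> \<le> C * (1 + \<bar>x\<bar>) powr (2 - 2 * s)"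
proof -
  obtain \<omega>1 C where 1: "0 < \<omega>1" "\<omega>1 < 1" "C > 0" "\<And>\<omega> x. \<omega> \<in> {0..\<omega>1} \<Longrightarrow> \<phi> \<omega> x \<le> C * (1 + \<bar>x\<bar>) powr (- s)"
    using uniform_decay by metis
  obtain X0 \<omega>2 C1 C2 where 2: "X0 > 0" "0 < \<omega>2" "\<omega>2 < 1" "C1 \<ge> 0" "C2 \<ge> 0"
    "\<And>\<omega> x. \<omega> \<in> {0..\<omega>2} \<Longrightarrow> \<bar>x\<bar> \<ge> X0 \<Longrightarrow> \<bar>resp \<omega> x\<bar> \<le> C1 * \<phi> \<omega> x + C2 * (1 + \<bar>x\<bar>) * \<phi> \<omega> x powr (1 - \<kappa>)"
    using uniform_resp_bound by metis
  obtain B where B: "B \<ge> 0" "\<And>\<omega> x. \<omega> \<in> {0..1} \<Longrightarrow> \<bar>x\<bar> \<le> X0 \<Longrightarrow> \<bar>resp \<omega> x\<bar> \<le> B"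
    using resp_bounded by blast
  define C' where "C' = C1 * C powr 2 + C2 * C powr (2 - \<kappa>)"
  define C'' where "C'' = max C' (\<phi> 1 0 * B * (1 + X0) powr \<bar>2 - 2 * s\<bar>)"
  have k2: "\<kappa> < 2" unfolding \<kappa>_def using assms by simp
  have out_bound: "\<bar>\<phi> \<omega> x * resp \<omega> x\<bar> \<le> C' * (1 + \<bar>x\<bar>) powr (2 - 2 * s)"
    if w: "\<omega> \<in> {0..min \<omega>1 \<omega>2}" and x: "\<bar>x\<bar> \<ge> X0" for \<omega> x
  proof -
    have ps: "\<phi> \<omega> x > 0" using pos[of \<omega> x] w by simp
    have b: "\<phi> \<omega> x powr r \<le> C powr r * (1 + \<bar>x\<bar>) powr (- s * r)" if "r \<ge> 0" for r
    proof -
      have "\<phi> \<omega> x powr r \<le> (C * (1 + \<bar>x\<bar>) powr (- s)) powr r"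
        using 1(4)[of \<omega> x] w ps that by (intro powr_mono2) auto
      also have "\<dots> = C powr r * (1 + \<bar>x\<bar>) powr (- s * r)"
        using 1(3) by (simp add: powr_mult powr_powr)
      finally show ?thesis .
    qed
    have "\<bar>\<phi> \<omega> x * resp \<omega> x\<bar> \<le> \<phi> \<omega> x * (C1 * \<phi> \<omega> x + C2 * (1 + \<bar>x\<bar>) * \<phi> \<omega> x powr (1 - \<kappa>))"
      using 2(6)[of \<omega> x] w x ps by (auto simp: abs_mult intro!: mult_left_mono)
    also have "\<dots> = C1 * \<phi> \<omega> x powr 2 + C2 * ((1 + \<bar>x\<bar>) * \<phi> \<omega> x powr (2 - \<kappa>))"
      using ps by (simp add: powr_diff powr_numeral power2_eq_square field_simps)
    also have "\<dots> \<le> C1 * (C powr 2 * (1 + \<bar>x\<bar>) powr (2 - 2 * s)) + C2 * (C powr (2 - \<kappa>) * (1 + \<bar>x\<bar>) powr (2 - 2 * s))"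
    proof (intro add_mono mult_left_mono)
      have "(1 + \<bar>x\<bar>) powr (- s * 2) \<le> (1 + \<bar>x\<bar>) powr (2 - 2 * s)" by (intro powr_mono) auto
      then show "\<phi> \<omega> x powr 2 \<le> C powr 2 * (1 + \<bar>x\<bar>) powr (2 - 2 * s)"
        by (intro order_trans[OF b[of 2]] mult_left_mono) auto
      have "(1 + \<bar>x\<bar>) * \<phi> \<omega> x powr (2 - \<kappa>) \<le> (1 + \<bar>x\<bar>) * (C powr (2 - \<kappa>) * (1 + \<bar>x\<bar>) powr (- s * (2 - \<kappa>)))"
        using b[of "2 - \<kappa>"] k2 by (intro mult_left_mono) auto
      also have "\<dots> = C powr (2 - \<kappa>) * ((1 + \<bar>x\<bar>) powr 1 * (1 + \<bar>x\<bar>) powr (- s * (2 - \<kappa>)))" by simp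
      also have "\<dots> = C powr (2 - \<kappa>) * (1 + \<bar>x\<bar>) powr (2 - 2 * s)"
        unfolding powr_add [symmetric] using s_kappa by (simp add: algebra_simps)
      finally show "(1 + \<bar>x\<bar>) * \<phi> \<omega> x powr (2 - \<kappa>) \<le> C powr (2 - \<kappa>) * (1 + \<bar>x\<bar>) powr (2 - 2 * s)" .
    qed (use 2 in auto)
    also have "\<dots> = C' * (1 + \<bar>x\<bar>) powr (2 - 2 * s)" unfolding C'_def by (simp add: algebra_simps)
    finally show ?thesis .
  qed
  have bound: "\<bar>\<phi> \<omega> x * resp \<omega> x\<bar> \<le> C'' * (1 + \<bar>x\<bar>) powr (2 - 2 * s)" if w: "\<omega> \<in> {0..min \<omega>1 \<omega>2}" for \<omega> x
    unfolding C''_def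
  proof (rule powr_bound_extend[OF _ out_bound[OF w]])
    have w1: "\<omega> \<in> {0..1}" using w 1 by auto
    assume "\<bar>x\<bar> \<le> X0"
    from B(2)[OF w1 this] show "\<bar>\<phi> \<omega> x * resp \<omega> x\<bar> \<le> \<phi> 1 0 * B"
      using in_range[OF w1, of x] unfolding abs_mult by (intro mult_mono) auto
  qed (use B pos[of 1 0] in auto)
  have C''0: "C'' \<ge> 0" unfolding C''_def C'_def using 2 by (simp add: le_max_iff_disj)
  show thesis
  proof (rule that[of "min \<omega>1 \<omega>2" "max C C''"])
    fix \<omega> x assume w: "\<omega> \<in> {0..min \<omega>1 \<omega>2}"
    have "C * (1 + \<bar>x\<bar>) powr (- s) \<le> max C C'' * (1 + \<bar>x\<bar>) powr (- s)" by (intro mult_right_mono) auto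
    with 1(4)[of \<omega> x] w show "\<phi> \<omega> x \<le> max C C'' * (1 + \<bar>x\<bar>) powr (- s)" by auto
    have "C'' * (1 + \<bar>x\<bar>) powr (2 - 2 * s) \<le> max C C'' * (1 + \<bar>x\<bar>) powr (2 - 2 * s)" by (intro mult_right_mono) auto
    with bound[OF w, of x] show "\<bar>\<phi> \<omega> x * resp \<omega> x\<bar> \<le> max C C'' * (1 + \<bar>x\<bar>) powr (2 - 2 * s)" by auto
  qed (use 1 2 C''0 in auto)
qed

section \<open>Power bounds at frequency zero\<close>

lemma phi0_lower:
  obtains c where "c > 0" "\<And>x. c * (1 + \<bar>x\<bar>) powr (- s) \<le> \<phi> 0 x"
proof -
  define C where "C = max \<kappa> (\<phi> 0 0 powr (- \<kappa>))"
  have C: "C > 0" unfolding C_def using kappa_pos by simp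
  have "C powr (- s) * (1 + \<bar>x\<bar>) powr (- s) \<le> \<phi> 0 x" for x
  proof -
    \<comment> \<open>As \<open>- g v \<le> v powr (p - 1)\<close> for every \<open>v > 0\<close>,
      the slope of \<open>\<phi> powr (- \<kappa>)\<close> never exceeds \<open>\<kappa>\<close>, so
      this power grows at most linearly.\<close>
    have "\<phi> 0 \<bar>x\<bar> powr (- \<kappa>) - \<kappa> * \<bar>x\<bar> \<le> \<phi> 0 0 powr (- \<kappa>) - \<kappa> * 0"
    proof (rule DERIV_nonpos_imp_nonincreasing[OF abs_ge_zero], intro exI conjI)
      fix t :: real assume t: "0 \<le> t"
      show "((\<lambda>x. \<phi> 0 x powr (- \<kappa>) - \<kappa> * x) has_real_derivative \<kappa> * (\<phi> 0 t powr (- \<kappa>) * sqrt (0 - g (\<phi> 0 t))) - \<kappa>) (at t)"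
        using phi_powr_derivative[OF order_refl t] by (intro DERIV_diff DERIV_cmult_Id)
      have ps: "\<phi> 0 t > 0" using pos[of 0] by simp
      have "\<phi> 0 t powr (- \<kappa>) * sqrt (0 - g (\<phi> 0 t)) \<le> \<phi> 0 t powr (- \<kappa>) * \<phi> 0 t powr \<kappa>"
        unfolding sqrt_powr[OF ps, symmetric] using neg_g_upper[OF ps] by (intro mult_left_mono real_sqrt_le_mono) auto
      also have "\<dots> = 1" using ps by (simp add: powr_add [symmetric])
      finally show "\<kappa> * (\<phi> 0 t powr (- \<kappa>) * sqrt (0 - g (\<phi> 0 t))) - \<kappa> \<le> 0"
        using kappa_pos by (simp add: mult_left_le)
    qed
    also have "\<phi> 0 0 powr (- \<kappa>) - \<kappa> * 0 \<le> C" unfolding C_def by simp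
    finally have "\<phi> 0 \<bar>x\<bar> powr (- \<kappa>) \<le> C + \<kappa> * \<bar>x\<bar>" by simp
    also have "\<dots> \<le> C * (1 + \<bar>x\<bar>)" unfolding C_def by (simp add: algebra_simps mult_left_mono max.coboundedI1 mult_mono)
    finally have "(C * (1 + \<bar>x\<bar>)) powr (- s) \<le> (\<phi> 0 x powr (- \<kappa>)) powr (- s)"
      unfolding phi_abs[OF order_refl] using pos[of 0 x] s_pos by (intro powr_mono2') auto
    also have "\<dots> = \<phi> 0 x" using pos[of 0 x] s_kappa by (simp add: powr_powr mult.commute)
    finally show ?thesis using C by (simp add: powr_mult)
  qed
  then show thesis using C by (intro that[of "C powr (- s)"]) auto
qed

text \<open>Nonnegative exponents use the upper bound on the wave, negative ones the lower
  bound.\<close>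

lemma phi0_powr_bound:
  obtains C where "C \<ge> 0" "\<And>x. \<phi> 0 x powr r \<le> C * (1 + \<bar>x\<bar>) powr (- s * r)"
proof (cases "r \<ge> 0")
  case True
  obtain \<omega>1 C where 1: "0 < \<omega>1" "\<omega>1 < 1" "C > 0" "\<And>\<omega> x. \<omega> \<in> {0..\<omega>1} \<Longrightarrow> \<phi> \<omega> x \<le> C * (1 + \<bar>x\<bar>) powr (- s)"
    using uniform_decay by metis
  have "\<phi> 0 x powr r \<le> C powr r * (1 + \<bar>x\<bar>) powr (- s * r)" for x
  proof -
    have "\<phi> 0 x powr r \<le> (C * (1 + \<bar>x\<bar>) powr (- s)) powr r"
      using 1 pos[of 0 x] True by (intro powr_mono2) auto
    also have "\<dots> = C powr r * (1 + \<bar>x\<bar>) powr (- s * r)"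
      using 1(3) by (simp add: powr_mult powr_powr)
    finally show ?thesis .
  qed
  then show thesis by (intro that[of "C powr r"]) auto
next
  case False
  obtain c where c: "c > 0" "\<And>x. c * (1 + \<bar>x\<bar>) powr (- s) \<le> \<phi> 0 x" using phi0_lower by blast
  have "\<phi> 0 x powr r \<le> c powr r * (1 + \<bar>x\<bar>) powr (- s * r)" for x
  proof -
    have "\<phi> 0 x powr r \<le> (c * (1 + \<bar>x\<bar>) powr (- s)) powr r"
      using c pos[of 0 x] False by (intro powr_mono2') auto
    also have "\<dots> = c powr r * (1 + \<bar>x\<bar>) powr (- s * r)"
      using c by (simp add: powr_mult powr_powr)
    finally show ?thesis .
  qed
  then show thesis by (intro that[of "c powr r"]) auto
qed

lemma deriv_phi0_bound:
  obtains C where "C \<ge> 0" "\<And>x. \<bar>deriv (\<phi> 0) x\<bar> \<le> C * (1 + \<bar>x\<bar>) powr (- s - 1)"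
proof -
  obtain C where C: "C \<ge> 0" "\<And>x. \<phi> 0 x powr (1 + \<kappa>) \<le> C * (1 + \<bar>x\<bar>) powr (- s * (1 + \<kappa>))" using phi0_powr_bound by blast
  have "\<bar>deriv (\<phi> 0) x\<bar> \<le> C * (1 + \<bar>x\<bar>) powr (- s - 1)" for x
  proof -
    have ps: "\<phi> 0 x > 0" using pos[of 0] by simp
    have "\<bar>deriv (\<phi> 0) x\<bar> = sqrt ((deriv (\<phi> 0) x)\<^sup>2)" by simp
    also have "\<dots> = \<phi> 0 x * sqrt (- g (\<phi> 0 x))"
      unfolding standing.energy[OF standing[OF order_refl]] using ps by (simp only: real_sqrt_mult) simp
    also have "\<dots> \<le> \<phi> 0 x * sqrt (\<phi> 0 x powr (p - 1))"
      using neg_g_upper[OF ps] ps by (intro mult_left_mono real_sqrt_le_mono) auto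
    also have "\<dots> = \<phi> 0 x powr (1 + \<kappa>)" unfolding sqrt_powr[OF ps] using ps by (simp add: powr_add)
    also have "\<dots> \<le> C * (1 + \<bar>x\<bar>) powr (- s * (1 + \<kappa>))" by (rule C(2))
    also have "- s * (1 + \<kappa>) = - s - 1" using s_kappa by (simp add: algebra_simps)
    finally show ?thesis .
  qed
  then show thesis using C(1) that by blast
qed

text \<open>The exponent \<open>1 - \<kappa>\<close> is negative when \<open>p > 3\<close>, so the
  lower bound on the wave enters; this is possible only because \<open>\<omega> = 0\<close>.\<close>

lemma resp0_bound:
  obtains C where "C \<ge> 0" "\<And>x. \<bar>resp 0 x\<bar> \<le> C * (1 + \<bar>x\<bar>) powr (2 - s)"
proof -
  obtain X0 \<omega>2 C1 C2 where 2: "X0 > 0" "0 < \<omega>2" "\<omega>2 < 1" "C1 \<ge> 0" "C2 \<ge> 0"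
    "\<And>\<omega> x. \<omega> \<in> {0..\<omega>2} \<Longrightarrow> \<bar>x\<bar> \<ge> X0 \<Longrightarrow> \<bar>resp \<omega> x\<bar> \<le> C1 * \<phi> \<omega> x + C2 * (1 + \<bar>x\<bar>) * \<phi> \<omega> x powr (1 - \<kappa>)"
    using uniform_resp_bound by metis
  obtain B where B: "B \<ge> 0" "\<And>\<omega> x. \<omega> \<in> {0..1} \<Longrightarrow> \<bar>x\<bar> \<le> X0 \<Longrightarrow> \<bar>resp \<omega> x\<bar> \<le> B"
    using resp_bounded by blast
  obtain C3 where C3: "C3 \<ge> 0" "\<And>x. \<phi> 0 x powr 1 \<le> C3 * (1 + \<bar>x\<bar>) powr (- s * 1)" using phi0_powr_bound by blast
  obtain C4 where C4: "C4 \<ge> 0" "\<And>x. \<phi> 0 x powr (1 - \<kappa>) \<le> C4 * (1 + \<bar>x\<bar>) powr (- s * (1 - \<kappa>))" using phi0_powr_bound by blast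
  have "\<bar>resp 0 x\<bar> \<le> (C1 * C3 + C2 * C4) * (1 + \<bar>x\<bar>) powr (2 - s)" if x: "\<bar>x\<bar> \<ge> X0" for x
  proof -
    have "\<bar>resp 0 x\<bar> \<le> C1 * \<phi> 0 x powr 1 + C2 * ((1 + \<bar>x\<bar>) * \<phi> 0 x powr (1 - \<kappa>))"
      using 2(6)[of 0 x] 2(2) x less_imp_le[OF pos[of 0 x]] by simp
    also have "\<dots> \<le> C1 * (C3 * (1 + \<bar>x\<bar>) powr (2 - s)) + C2 * (C4 * (1 + \<bar>x\<bar>) powr (2 - s))"
    proof (intro add_mono mult_left_mono)
      have "(1 + \<bar>x\<bar>) powr (- s * 1) \<le> (1 + \<bar>x\<bar>) powr (2 - s)" by (intro powr_mono) auto
      then show "\<phi> 0 x powr 1 \<le> C3 * (1 + \<bar>x\<bar>) powr (2 - s)"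
        using C3(1) by (intro order_trans[OF C3(2)] mult_left_mono) auto
      have "(1 + \<bar>x\<bar>) * \<phi> 0 x powr (1 - \<kappa>) \<le> (1 + \<bar>x\<bar>) * (C4 * (1 + \<bar>x\<bar>) powr (- s * (1 - \<kappa>)))"
        using C4 by (intro mult_left_mono) auto
      also have "\<dots> = C4 * ((1 + \<bar>x\<bar>) powr 1 * (1 + \<bar>x\<bar>) powr (- s * (1 - \<kappa>)))" by simp
      also have "\<dots> = C4 * (1 + \<bar>x\<bar>) powr (2 - s)"
        unfolding powr_add [symmetric] using s_kappa by (simp add: algebra_simps)
      finally show "(1 + \<bar>x\<bar>) * \<phi> 0 x powr (1 - \<kappa>) \<le> C4 * (1 + \<bar>x\<bar>) powr (2 - s)" .
    qed (use 2 in auto)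
    finally show ?thesis by (simp add: algebra_simps)
  qed
  then have "\<bar>resp 0 x\<bar> \<le> max (C1 * C3 + C2 * C4) (B * (1 + X0) powr \<bar>2 - s\<bar>) * (1 + \<bar>x\<bar>) powr (2 - s)" for x
    using B(2)[of 0 x] B(1) by (intro powr_bound_extend) auto
  moreover have "max (C1 * C3 + C2 * C4) (B * (1 + X0) powr \<bar>2 - s\<bar>) \<ge> 0" using B(1) by (simp add: le_max_iff_disj)
  ultimately show thesis using that by blast
qed

text \<open>The derivative of \<open>resp / \<phi>'\<close> is
  \<open>1 / (2 * (- g \<phi>))\<close>, at least a multiple of \<open>(1 + x)^2\<close>. The
  quotient therefore outgrows a cubic, and the factor \<open>\<phi>' < 0\<close> of size
  \<open>(1 + x) powr (- s - 1)\<close> determines both sign and rate.\<close>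

lemma resp0_lower:
  obtains c X1 where "c > 0" "X1 \<ge> 1" "\<And>x. \<bar>x\<bar> \<ge> X1 \<Longrightarrow> c * (1 + \<bar>x\<bar>) powr (2 - s) \<le> - resp 0 x"
proof -
  obtain X0 \<omega>0 m where X: "X0 > 0" "0 < \<omega>0" and m: "0 < m" "m < 1" and
    low: "\<And>\<omega> x. \<omega> \<in> {0..\<omega>0} \<Longrightarrow> x \<ge> X0 \<Longrightarrow> m * \<phi> \<omega> x powr (p - 1) \<le> - g (\<phi> \<omega> x)"
    using uniform_decay by metis
  obtain C where C: "C \<ge> 0" "\<And>x. \<phi> 0 x powr (p - 1) \<le> C * (1 + \<bar>x\<bar>) powr (- s * (p - 1))" using phi0_powr_bound by blast
  have sp: "- s * (p - 1) = -2" unfolding s_def using p_gt_1 by (simp add: divide_simps)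
  obtain C' where C': "C' \<ge> 0" "\<And>x. \<phi> 0 x powr (- 1 - \<kappa>) \<le> C' * (1 + \<bar>x\<bar>) powr (- s * (- 1 - \<kappa>))" using phi0_powr_bound by blast
  have sp': "- s * (- 1 - \<kappa>) = s + 1" using s_kappa by (simp add: algebra_simps)
  have Cpos: "C > 0" using C(2)[of 0] pos[of 0 0] by (cases "C = 0") (use C(1) in auto)
  have C'pos: "C' > 0" using C'(2)[of 0] pos[of 0 0] by (cases "C' = 0") (use C'(1) in auto)
  define a where "a = 1 / (2 * C)"
  have a: "a > 0" unfolding a_def using Cpos by simp
  define h where "h x = resp 0 x / deriv (\<phi> 0) x" for x
  define b where "b = h X0 - a / 3 * (1 + X0) ^ 3"
  have hlow: "a / 3 * (1 + x) ^ 3 + b \<le> h x" if x: "x \<ge> X0" for x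
  proof -
    have "h X0 - a / 3 * (1 + X0) ^ 3 \<le> h x - a / 3 * (1 + x) ^ 3"
    proof (rule DERIV_nonneg_imp_nondecreasing[OF x], intro exI conjI)
      fix t assume t: "X0 \<le> t"
      then have t0: "t > 0" using X by simp
      have h': "(h has_real_derivative 1 / (2 * (0 - g (\<phi> 0 t)))) (at t)"
        using resp_quotient_derivative[of 0 t] t0 by (simp add: h_def [abs_def])
      show "((\<lambda>x. h x - a / 3 * (1 + x) ^ 3) has_real_derivative 1 / (2 * (0 - g (\<phi> 0 t))) - a * (1 + t)\<^sup>2) (at t)"
        by (rule derivative_eq_intros h' refl)+ (simp add: power2_eq_square)
      have gp: "- g (\<phi> 0 t) > 0" using standing.g_less[OF standing[OF order_refl], of t] t0 by simp
      have "- g (\<phi> 0 t) \<le> C * (1 + t) powr (- 2)"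
        using neg_g_upper[OF pos[of 0 t]] C(2)[of t] t0 unfolding sp by simp
      also have "\<dots> = C / (1 + t)\<^sup>2" using t0 by (simp add: powr_minus powr_numeral field_simps)
      finally have "- g (\<phi> 0 t) * (1 + t)\<^sup>2 \<le> C" using t0 by (simp add: pos_le_divide_eq)
      then have "a * (1 + t)\<^sup>2 \<le> 1 / (2 * (0 - g (\<phi> 0 t)))"
        unfolding a_def using gp Cpos by (simp add: field_simps)
      then show "0 \<le> 1 / (2 * (0 - g (\<phi> 0 t))) - a * (1 + t)\<^sup>2" by simp
    qed
    then show ?thesis unfolding b_def by simp
  qed
  \<comment> \<open>Beyond this point \<open>\<bar>b\<bar>\<close> is at most
    \<open>a / 6 * (1 + x) ^ 3\<close>, half of the cubic term.\<close>
  define X1 where "X1 = max (max X0 1) (6 * \<bar>b\<bar> / a)"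
  have main: "sqrt m / C' * (a / 6) * (1 + x) powr (2 - s) \<le> - resp 0 x" if x: "x \<ge> X1" for x
  proof -
    have x0: "x \<ge> X0" "x \<ge> 1" and xb: "6 * \<bar>b\<bar> / a \<le> x" using x unfolding X1_def by auto
    have ps: "\<phi> 0 x > 0" using pos[of 0] by simp
    have "6 * \<bar>b\<bar> \<le> a * x" using xb a by (simp add: field_simps)
    also have "\<dots> \<le> a * (1 + x) ^ 3"
    proof -
      have "x \<le> (1 + x) ^ 1" by simp
      also have "\<dots> \<le> (1 + x) ^ 3" using x0 by (intro power_increasing) auto
      finally show ?thesis using a by simp
    qed
    finally have "a / 6 * (1 + x) ^ 3 \<le> h x" using hlow[OF x0(1)] by linarith
    moreover have "(1 + x) ^ 3 = (1 + x) powr 3" using x0 by (simp add: powr_numeral)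
    ultimately have h: "a / 6 * (1 + x) powr 3 \<le> h x" by simp
    have "sqrt m / C' * (1 + x) powr (- s - 1) \<le> sqrt m * \<phi> 0 x powr (1 + \<kappa>)"
    proof -
      have "1 / (C' * (1 + x) powr (s + 1)) \<le> 1 / \<phi> 0 x powr (- 1 - \<kappa>)"
        using C'(2)[of x] x0 ps C'pos unfolding sp' by (intro divide_left_mono) auto
      also have "1 / \<phi> 0 x powr (- 1 - \<kappa>) = \<phi> 0 x powr (1 + \<kappa>)"
        using powr_minus_divide[of "\<phi> 0 x" "- 1 - \<kappa>"] by (simp add: add.commute)
      also have "1 / (C' * (1 + x) powr (s + 1)) = 1 / C' * (1 + x) powr (- s - 1)"
        using powr_minus_divide[of "1 + x" "s + 1"] by simp
      finally have "sqrt m * (1 / C' * (1 + x) powr (- s - 1)) \<le> sqrt m * \<phi> 0 x powr (1 + \<kappa>)"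
        using m by (intro mult_left_mono) auto
      then show ?thesis by simp
    qed
    also have "\<dots> = \<phi> 0 x * (sqrt m * sqrt (\<phi> 0 x powr (p - 1)))"
      unfolding sqrt_powr[OF ps] using ps by (simp add: powr_add)
    also have "\<dots> \<le> \<phi> 0 x * sqrt (0 - g (\<phi> 0 x))"
      unfolding real_sqrt_mult [symmetric] using ps low[of 0 x] X x0 by (intro mult_left_mono real_sqrt_le_mono) auto
    also have "\<dots> = - deriv (\<phi> 0) x" using standing.deriv_eq[OF standing[OF order_refl], of x] x0 by simp
    finally have d: "sqrt m / C' * (1 + x) powr (- s - 1) \<le> - deriv (\<phi> 0) x" .
    have "sqrt m / C' * (a / 6) * (1 + x) powr (2 - s) = (sqrt m / C' * (1 + x) powr (- s - 1)) * (a / 6 * (1 + x) powr 3)"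
    proof -
      have "(1 + x) powr (2 - s) = (1 + x) powr (- s - 1) * (1 + x) powr 3" by (simp add: powr_add [symmetric])
      then show ?thesis by simp
    qed
    also have "\<dots> \<le> - deriv (\<phi> 0) x * h x"
      using d h a m C'pos order_trans[OF _ d, of 0] by (intro mult_mono) auto
    also have "\<dots> = - resp 0 x"
      unfolding h_def using standing.deriv_neg[OF standing[OF order_refl], of x] x0 by simp
    finally show ?thesis .
  qed
  show thesis
  proof (rule that[of "sqrt m / C' * (a / 6)" X1])
    show "sqrt m / C' * (a / 6) * (1 + \<bar>x\<bar>) powr (2 - s) \<le> - resp 0 x" if "\<bar>x\<bar> \<ge> X1" for x
      using main[OF that] by (simp add: resp_abs)
  qed (use m a C'pos in \<open>auto simp: X1_def\<close>)
qed

end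

section \<open>The derivative of the mass\<close>

lemma integrable_powr_abs:
  fixes r :: real
  assumes "r < - 1"
  shows "integrable lborel (\<lambda>x. (1 + \<bar>x\<bar>) powr r)"
proof -
  define f where "f x = (1 + x) powr r * indicator {0..} x" for x :: real
  have meas: "f \<in> borel_measurable borel" unfolding f_def by measurable
  have lim: "((\<lambda>x. (1 + x) powr (r + 1) / (r + 1)) \<longlongrightarrow> 0 / (r + 1)) at_top"
    using assms by (intro tendsto_intros tendsto_neg_powr filterlim_tendsto_add_at_top[OF tendsto_const] filterlim_ident) auto
  have "(\<integral>\<^sup>+x. ennreal ((1 + x) powr r) * indicator {0..} x \<partial>lborel) = ennreal (0 / (r + 1) - (1 + 0) powr (r + 1) / (r + 1))"
  proof (rule nn_integral_FTC_atLeast[OF _ _ _ lim])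
    fix x :: real assume "0 \<le> x"
    then show "((\<lambda>x. (1 + x) powr (r + 1) / (r + 1)) has_real_derivative (1 + x) powr r) (at x)"
      using assms by (auto intro!: derivative_eq_intros)
  qed auto
  then have "(\<integral>\<^sup>+x. ennreal (f x) \<partial>lborel) < \<infinity>"
    unfolding f_def by (simp add: ennreal_mult'' ennreal_indicator)
  then have int: "integrable lborel f"
    using meas by (intro integrableI_nonneg) (auto simp: f_def)
  have "integrable lborel (\<lambda>x. f (0 + (-1) * x))"
    by (rule lborel_integrable_real_affine[OF int]) simp
  then have "integrable lborel (\<lambda>x. f x + f (- x))" using int by auto
  \<comment> \<open>The two half-line pieces overlap at \<open>0\<close>, hence a bound instead of
    an equality.\<close>
  then show ?thesis
    by (rule Bochner_Integration.integrable_bound) (auto simp: f_def indicator_def)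
qed

text \<open>Sequences approaching \<open>a\<close> reduce this to the sequential theorem; the shift
  by \<open>N\<close> discards the indices at which the majorant is not yet available.\<close>

lemma dominated_convergence_at_within:
  fixes s :: "real \<Rightarrow> 'a \<Rightarrow> real"
  assumes "f \<in> borel_measurable M" and B: "integrable M B"
    and ev: "eventually (\<lambda>w. s w \<in> borel_measurable M \<and> (\<forall>x. \<bar>s w x\<bar> \<le> B x)) (at a within S)"
    and lim: "\<And>x. ((\<lambda>w. s w x) \<longlongrightarrow> f x) (at a within S)"
  shows "((\<lambda>w. integral\<^sup>L M (s w)) \<longlongrightarrow> integral\<^sup>L M f) (at a within S)"
  unfolding tendsto_at_iff_sequentially comp_def
proof (intro allI impI)
  fix X assume X: "\<forall>i. X i \<in> S - {a}" "X \<longlonglongrightarrow> a"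
  then have fl: "filterlim X (at a within S) sequentially"
    by (auto simp: filterlim_at)
  from eventually_compose_filterlim[OF ev fl] obtain N
    where N: "\<And>n. n \<ge> N \<Longrightarrow> s (X n) \<in> borel_measurable M \<and> (\<forall>x. \<bar>s (X n) x\<bar> \<le> B x)"
    by (auto simp: eventually_sequentially)
  show "(\<lambda>n. integral\<^sup>L M (s (X n))) \<longlonglongrightarrow> integral\<^sup>L M f"
  proof (rule LIMSEQ_offset, rule integral_dominated_convergence[OF assms(1) _ B])
    show "s (X (n + N)) \<in> borel_measurable M" for n using N[of "n + N"] by simp
    show "AE x in M. norm (s (X (n + N)) x) \<le> B x" for n using N[of "n + N"] by simp
    show "AE x in M. (\<lambda>n. s (X (n + N)) x) \<longlonglongrightarrow> f x"
      by (intro AE_I2 LIMSEQ_ignore_initial_segment filterlim_compose[OF lim fl])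
  qed
qed

lemma borel_measurable_DERIV:
  fixes f :: "real \<Rightarrow> real"
  assumes "\<And>x. (f has_real_derivative f' x) (at x)"
  shows "f \<in> borel_measurable lborel"
  using assms by (auto intro!: borel_measurable_continuous_onI continuous_at_imp_continuous_on DERIV_isCont)

context family
begin

lemma phi_measurable: "\<omega> \<ge> 0 \<Longrightarrow> \<phi> \<omega> \<in> borel_measurable lborel"
  by (rule borel_measurable_DERIV[OF deriv1])

lemma resp_measurable: "\<omega> \<in> {0..1} \<Longrightarrow> resp \<omega> \<in> borel_measurable lborel"
  by (rule borel_measurable_DERIV[OF resp1])

lemma mass_eq: "mass \<phi> \<omega> = (LINT x|lborel. 1 / 2 * (\<phi> \<omega> x)\<^sup>2)"
proof -
  have "L2_inner (\<phi> \<omega>) (\<phi> \<omega>) \<ge> 0" unfolding L2_inner_def by (intro Bochner_Integration.integral_nonneg) auto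
  then show ?thesis unfolding mass_def L2_norm_def by (simp add: L2_inner_def power2_eq_square)
qed

lemma s_gt_half: "p < 5 \<Longrightarrow> s > 1 / 2"
  unfolding s_def using p_gt_1 by (simp add: field_simps)

text \<open>The same majorant \<open>(1 + \<bar>x\<bar>) powr (2 - 2 * s)\<close>, integrable
  because \<open>s > 3 / 2\<close>, is used twice: to differentiate the mass under the integral for
  small \<open>\<omega> > 0\<close>, and to let \<open>\<omega>\<close> decrease to \<open>0\<close>
  in the resulting formula.\<close>

lemma mass_derivative_limit:
  assumes s: "s > 3 / 2" and p5: "p < 5"
  shows "integrable lborel (\<lambda>x. \<phi> 0 x * resp 0 x)"
    and "mass_deriv0 \<phi> = ereal (LINT x|lborel. \<phi> 0 x * resp 0 x)"
proof -
  obtain \<omega>0 C where w0: "0 < \<omega>0" "\<omega>0 < 1" and C: "C \<ge> 0"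
    and phi_le: "\<And>\<omega> x. \<omega> \<in> {0..\<omega>0} \<Longrightarrow> \<phi> \<omega> x \<le> C * (1 + \<bar>x\<bar>) powr (- s)"
    and prod_le: "\<And>\<omega> x. \<omega> \<in> {0..\<omega>0} \<Longrightarrow> \<bar>\<phi> \<omega> x * resp \<omega> x\<bar> \<le> C * (1 + \<bar>x\<bar>) powr (2 - 2 * s)"
    using uniform_product_bound[OF p5] by metis
  define B where "B x = C * (1 + \<bar>x\<bar>) powr (2 - 2 * s)" for x
  have B: "integrable lborel B"
    unfolding B_def using s by (intro integrable_mult_right integrable_powr_abs) auto
  have prod_meas: "(\<lambda>x. \<phi> \<omega> x * resp \<omega> x) \<in> borel_measurable lborel" if "\<omega> \<in> {0..1}" for \<omega>
    using that by (intro borel_measurable_times phi_measurable resp_measurable) auto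
  show "integrable lborel (\<lambda>x. \<phi> 0 x * resp 0 x)"
    by (rule Bochner_Integration.integrable_bound[OF B prod_meas])
       (use prod_le[of 0] w0 C in \<open>simp_all add: B_def\<close>)
  have sq: "integrable lborel (\<lambda>x. 1 / 2 * (\<phi> \<omega> x)\<^sup>2)" if w: "\<omega> \<in> {0..\<omega>0}" for \<omega>
  proof (rule Bochner_Integration.integrable_bound)
    show "integrable lborel (\<lambda>x. C\<^sup>2 * (1 + \<bar>x\<bar>) powr (- 2 * s))"
      using s by (intro integrable_mult_right integrable_powr_abs) auto
    show "(\<lambda>x. 1 / 2 * (\<phi> \<omega> x)\<^sup>2) \<in> borel_measurable lborel"
      using w by (intro borel_measurable_times borel_measurable_power phi_measurable borel_measurable_const) auto
    have "norm (1 / 2 * (\<phi> \<omega> x)\<^sup>2) \<le> norm (C\<^sup>2 * (1 + \<bar>x\<bar>) powr (- 2 * s))" for x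
    proof -
      have "norm (1 / 2 * (\<phi> \<omega> x)\<^sup>2) = (\<phi> \<omega> x)\<^sup>2 / 2" by simp
      also have "\<dots> \<le> (\<phi> \<omega> x)\<^sup>2" by simp
      also have "\<dots> \<le> (C * (1 + \<bar>x\<bar>) powr (- s))\<^sup>2"
        using phi_le[OF w] pos[of \<omega> x] w by (intro power_mono) auto
      also have "\<dots> = C\<^sup>2 * (1 + \<bar>x\<bar>) powr (- 2 * s)"
        by (simp add: power_mult_distrib powr_power)
      also have "\<dots> \<le> norm (C\<^sup>2 * (1 + \<bar>x\<bar>) powr (- 2 * s))" by simp
      finally show ?thesis .
    qed
    then show "AE x in lborel. norm (1 / 2 * (\<phi> \<omega> x)\<^sup>2) \<le> norm (C\<^sup>2 * (1 + \<bar>x\<bar>) powr (- 2 * s))"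
      by (rule AE_I2)
  qed
  have D: "(mass \<phi> has_real_derivative (LINT x|lborel. \<phi> \<omega> x * resp \<omega> x)) (at \<omega>)" if w: "0 < \<omega>" "\<omega> < \<omega>0" for \<omega>
  proof -
    define t where "t h x = (1 / 2 * (\<phi> (\<omega> + h) x)\<^sup>2 - 1 / 2 * (\<phi> \<omega> x)\<^sup>2) / h" for h x
    have dsq: "((\<lambda>w. 1 / 2 * (\<phi> w x)\<^sup>2) has_real_derivative \<phi> w x * resp w x) (at w)" if "0 < w" "w < 1" for w x
      using that by (auto intro!: derivative_eq_intros phi_has_derivative)
    have ev: "eventually (\<lambda>h. 0 < \<omega> + h \<and> \<omega> + h < \<omega>0) (at 0)"
      unfolding eventually_at using w by (intro exI[of _ "min \<omega> (\<omega>0 - \<omega>)"]) (auto simp: dist_real_def abs_if split: if_splits)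
    have ne: "eventually (\<lambda>h. h \<noteq> 0) (at (0::real))" by (simp add: eventually_at_filter)
    have "((\<lambda>h. integral\<^sup>L lborel (t h)) \<longlongrightarrow> (LINT x|lborel. \<phi> \<omega> x * resp \<omega> x)) (at 0)"
    proof (rule dominated_convergence_at_within[OF prod_meas B])
      show "((\<lambda>h. t h x) \<longlongrightarrow> \<phi> \<omega> x * resp \<omega> x) (at 0)" for x
        using dsq[of \<omega> x] w w0 unfolding t_def DERIV_def by simp
      show "eventually (\<lambda>h. t h \<in> borel_measurable lborel \<and> (\<forall>x. \<bar>t h x\<bar> \<le> B x)) (at 0)"
        using ev ne
      proof eventually_elim
        case (elim h)
        have "\<bar>t h x\<bar> \<le> B x" for x
        proof -
          let ?q = "\<lambda>w. 1 / 2 * (\<phi> w x)\<^sup>2"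
          \<comment> \<open>The increment \<open>h\<close> may have either sign, so the endpoints
            are ordered first. The mean value theorem in the frequency turns the difference quotient
            into \<open>\<phi> z x * resp z x\<close> at an intermediate \<open>z\<close>, which
            \<open>B\<close> dominates.\<close>
          define u v where "u = min \<omega> (\<omega> + h)" and "v = max \<omega> (\<omega> + h)"
          have uv: "u < v" "0 < u" "v < \<omega>0" unfolding u_def v_def using elim w by auto
          have "\<exists>z>u. z < v \<and> ?q v - ?q u = (v - u) * (\<phi> z x * resp z x)"
            by (rule MVT2[OF uv(1)]) (use dsq uv w0 in auto)
          then obtain z where z: "u < z" "z < v" "?q v - ?q u = (v - u) * (\<phi> z x * resp z x)" by blast
          have "t h x = (?q v - ?q u) / (v - u)"
            unfolding t_def u_def v_def using elim by (auto simp: min_def max_def field_simps)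
          then have "t h x = \<phi> z x * resp z x" using z uv by simp
          then show ?thesis using prod_le[of z x] z uv unfolding B_def by auto
        qed
        moreover have "t h \<in> borel_measurable lborel"
          unfolding t_def using elim w
          by (intro borel_measurable_divide borel_measurable_diff borel_measurable_times borel_measurable_power phi_measurable borel_measurable_const) auto
        ultimately show ?case by blast
      qed
    qed (use w w0 in auto)
    moreover have "eventually (\<lambda>h. integral\<^sup>L lborel (t h) = (mass \<phi> (\<omega> + h) - mass \<phi> \<omega>) / h) (at 0)"
      using ev
    proof eventually_elim
      case (elim h)
      have int: "integrable lborel (\<lambda>x. 1 / 2 * (\<phi> (\<omega> + h) x)\<^sup>2)" "integrable lborel (\<lambda>x. 1 / 2 * (\<phi> \<omega> x)\<^sup>2)"
        by (rule sq, use elim w in simp)+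
      show ?case
        unfolding t_def mass_eq Bochner_Integration.integral_diff[OF int, symmetric] by simp
    qed
    ultimately show ?thesis
      unfolding DERIV_def by (rule Lim_transform_eventually)
  qed
  have "((\<lambda>\<omega>. LINT x|lborel. \<phi> \<omega> x * resp \<omega> x) \<longlongrightarrow> (LINT x|lborel. \<phi> 0 x * resp 0 x)) (at_right 0)"
  proof (rule dominated_convergence_at_within[OF prod_meas B])
    show "((\<lambda>\<omega>. \<phi> \<omega> x * resp \<omega> x) \<longlongrightarrow> \<phi> 0 x * resp 0 x) (at_right 0)" for x
      by (intro tendsto_intros phi_tendsto resp_tendsto)
    show "eventually (\<lambda>\<omega>. (\<lambda>x. \<phi> \<omega> x * resp \<omega> x) \<in> borel_measurable lborel \<and> (\<forall>x. \<bar>\<phi> \<omega> x * resp \<omega> x\<bar> \<le> B x)) (at_right 0)"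
      using eventually_small[OF w0(1)]
    proof eventually_elim
      case (elim \<omega>)
      then show ?case using prod_meas[of \<omega>] prod_le[of \<omega>] w0 unfolding B_def by simp
    qed
  qed auto
  moreover have "eventually (\<lambda>\<omega>. (LINT x|lborel. \<phi> \<omega> x * resp \<omega> x) = deriv (mass \<phi>) \<omega>) (at_right 0)"
    using eventually_small[OF w0(1)] by eventually_elim (use DERIV_imp_deriv[OF D] in auto)
  ultimately have "((\<lambda>\<omega>. deriv (mass \<phi>) \<omega>) \<longlongrightarrow> (LINT x|lborel. \<phi> 0 x * resp 0 x)) (at_right 0)"
    by (rule Lim_transform_eventually)
  then show "mass_deriv0 \<phi> = ereal (LINT x|lborel. \<phi> 0 x * resp 0 x)"
    unfolding mass_deriv0_def by (intro tendsto_Lim) auto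
qed

end

section \<open>Expansion of the quadratic form\<close>

lemma continuous_compact_support_integrable:
  fixes h :: "real \<Rightarrow> real"
  assumes "continuous_on UNIV h" and 0: "\<And>x. \<bar>x\<bar> > b \<Longrightarrow> h x = 0"
  shows "integrable lborel h"
proof -
  have "set_integrable lborel {-b..b} h"
    by (rule borel_integrable_atLeastAtMost') (rule continuous_on_subset[OF assms(1)], simp)
  moreover have "(\<lambda>x. indicator {-b..b} x *\<^sub>R h x) = h"
  proof
    show "indicator {-b..b} x *\<^sub>R h x = h x" for x using 0[of x] by (cases "\<bar>x\<bar> > b") (auto simp: indicator_def)
  qed
  ultimately show ?thesis unfolding set_integrable_def by simp
qed

text \<open>Integration by parts in the form used below: instead of boundary terms, a primitive with
  bounded support is exhibited.\<close>

lemma integral_exact_compact_support: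
  fixes F h :: "real \<Rightarrow> real"
  assumes F: "\<And>x. (F has_real_derivative h x) (at x)" and h: "continuous_on UNIV h"
    and 0: "\<And>x. \<bar>x\<bar> > b \<Longrightarrow> F x = 0"
  shows "integrable lborel h" "(LINT x|lborel. h x) = 0"
proof -
  \<comment> \<open>Strictly beyond \<open>b\<close>, so \<open>F\<close> vanishes at both
    endpoints, and positive even if \<open>b\<close> is negative.\<close>
  define c where "c = max b 0 + 1"
  have h0: "h x = 0" if x: "\<bar>x\<bar> > b" for x
  proof -
    have "open {x. \<bar>x\<bar> > b}" by (intro open_Collect_less continuous_intros)
    then have "((\<lambda>_. 0) has_real_derivative h x) (at x)"
      using x 0 by (intro has_field_derivative_transform_within_open[OF F, where S = "{x. \<bar>x\<bar> > b}"]) auto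
    then show ?thesis using DERIV_unique[OF _ DERIV_const] by blast
  qed
  show "integrable lborel h"
    by (rule continuous_compact_support_integrable[OF h h0])
  have "h = (\<lambda>x. indicator {-c..c} x *\<^sub>R h x)"
  proof
    show "h x = indicator {-c..c} x *\<^sub>R h x" for x
      using h0[of x] unfolding c_def by (cases "\<bar>x\<bar> > b") (auto simp: indicator_def)
  qed
  then have "(LINT x|lborel. h x) = (LINT x|lborel. indicator {-c..c} x *\<^sub>R h x)" by simp
  also have "\<dots> = F c - F (-c)"
    using F unfolding c_def
    by (intro integral_FTC_atLeastAtMost continuous_on_subset[OF h])
       (auto intro: has_field_derivative_at_within simp: has_real_derivative_iff_has_vector_derivative [symmetric])
  also have "\<dots> = 0" using 0[of c] 0[of "-c"] unfolding c_def by auto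
  finally show "(LINT x|lborel. h x) = 0" .
qed

lemma integral_abs_bound_support:
  fixes h :: "real \<Rightarrow> real"
  assumes h: "integrable lborel h" and b: "b \<ge> 0" and M: "\<And>x. \<bar>x\<bar> \<le> b \<Longrightarrow> \<bar>h x\<bar> \<le> M"
    and 0: "\<And>x. \<bar>x\<bar> > b \<Longrightarrow> h x = 0"
  shows "\<bar>LINT x|lborel. h x\<bar> \<le> 2 * b * M"
proof -
  have "\<bar>LINT x|lborel. h x\<bar> \<le> (LINT x|lborel. \<bar>h x\<bar>)"
    using integral_norm_bound[of lborel h] by simp
  also have "\<dots> \<le> (LINT x|lborel. indicator {-b..b} x * M)"
    using h b M 0 by (intro integral_mono integrable_abs integrable_mult_left integrable_real_indicator) (auto simp: indicator_def abs_le_iff)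
  also have "\<dots> = 2 * b * M" using b by simp
  finally show ?thesis .
qed

text \<open>On this annulus \<open>(1 + \<bar>x\<bar>) / R\<close> lies between \<open>1\<close> and
  \<open>3\<close>, which settles exponents of either sign.\<close>

lemma powr_annulus_bound:
  fixes R x r :: real
  assumes "R \<ge> 1" "R \<le> \<bar>x\<bar>" "\<bar>x\<bar> \<le> 2 * R"
  shows "(1 + \<bar>x\<bar>) powr r \<le> 3 powr \<bar>r\<bar> * R powr r"
proof -
  have "((1 + \<bar>x\<bar>) / R) powr r \<le> ((1 + \<bar>x\<bar>) / R) powr \<bar>r\<bar>"
    using assms by (intro powr_mono) auto
  also have "\<dots> \<le> 3 powr \<bar>r\<bar>" using assms by (intro powr_mono2) (auto simp: field_simps)
  finally have "((1 + \<bar>x\<bar>) / R) powr r * R powr r \<le> 3 powr \<bar>r\<bar> * R powr r" by (intro mult_right_mono) auto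
  then show ?thesis using assms by (simp add: powr_mult [symmetric])
qed

lemma cutoff_derivatives:
  assumes "cutoff \<theta>"
  obtains \<theta>' \<theta>'' K where "K \<ge> 0"
    "\<And>x. (\<theta> has_real_derivative \<theta>' x) (at x)" "\<And>x. (\<theta>' has_real_derivative \<theta>'' x) (at x)"
    "continuous_on UNIV \<theta>''" "\<And>x. \<bar>\<theta>' x\<bar> \<le> K" "\<And>x. \<bar>\<theta>'' x\<bar> \<le> K"
    "\<And>x. \<bar>x\<bar> < 1 \<or> \<bar>x\<bar> > 2 \<Longrightarrow> \<theta>' x = 0 \<and> \<theta>'' x = 0"
proof -
  define d where "d n = (deriv ^^ n) \<theta>" for n
  have d0: "d 0 = \<theta>" by (simp add: d_def)
  have diff: "(d n has_real_derivative d (Suc n) x) (at x)" for n x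
  proof -
    have "d n differentiable at x" using assms unfolding cutoff_def d_def by (auto simp: differentiable_on_def)
    then show ?thesis by (simp add: DERIV_deriv_iff_real_differentiable d_def)
  qed
  have cont: "continuous_on A (d n)" for A n
    using diff by (auto intro!: continuous_at_imp_continuous_on DERIV_isCont)
  have z0: "d n x = (if n = 0 \<and> \<bar>x\<bar> < 1 then 1 else 0)" if "\<bar>x\<bar> < 1 \<or> \<bar>x\<bar> > 2" for n x
    using that
  proof (induction n arbitrary: x)
    case 0
    then show ?case using assms unfolding cutoff_def d0 by force
  next
    case (Suc n)
    let ?S = "if \<bar>x\<bar> < 1 then {x. \<bar>x\<bar> < 1} else {x::real. 2 < \<bar>x\<bar>}"
    let ?c = "if n = 0 \<and> \<bar>x\<bar> < 1 then 1 else 0 :: real"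
    have op: "open ?S" by (auto intro!: open_Collect_less continuous_intros)
    have "((\<lambda>_. ?c) has_real_derivative d (Suc n) x) (at x)"
      by (rule has_field_derivative_transform_within_open[OF diff op]) (use Suc in auto)
    then have "d (Suc n) x = 0" using DERIV_unique[OF _ DERIV_const] by blast
    then show ?case by simp
  qed
  have bd: "\<exists>K\<ge>0. \<forall>x. \<bar>d (Suc n) x\<bar> \<le> K" for n
  proof -
    have "bounded (d (Suc n) ` {-2..2})"
      by (intro compact_imp_bounded compact_continuous_image cont) simp
    then obtain K where K: "\<forall>x\<in>{-2..2}. \<bar>d (Suc n) x\<bar> \<le> K" unfolding bounded_iff by auto
    have "\<bar>d (Suc n) x\<bar> \<le> max K 0" for x
      using bspec[OF K, of x] z0[of x "Suc n"] by (cases "x \<in> {-2..2}") auto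
    then show ?thesis by (intro exI[of _ "max K 0"]) auto
  qed
  obtain K1 K2 where K: "K1 \<ge> 0" "\<And>x. \<bar>d 1 x\<bar> \<le> K1" "K2 \<ge> 0" "\<And>x. \<bar>d 2 x\<bar> \<le> K2"
    using bd[of 0] bd[of 1] by (auto simp: numeral_2_eq_2)
  show thesis
  proof (rule that[of "max K1 K2" "d 1" "d 2"])
    show "\<bar>d 1 x\<bar> \<le> max K1 K2" for x by (rule max.coboundedI1[OF K(2)])
    show "\<bar>d 2 x\<bar> \<le> max K1 K2" for x by (rule max.coboundedI2[OF K(4)])
    show "(\<theta> has_real_derivative d 1 x) (at x)" for x using diff[of 0] d0 by simp
    show "(d 1 has_real_derivative d 2 x) (at x)" for x using diff[of 1 x] by (simp add: numeral_2_eq_2)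
  qed (use K z0 cont in auto)
qed

context family
begin

lemma phi0_square_integrable:
  assumes "p < 5"
  shows "integrable lborel (\<lambda>x. (\<phi> 0 x)\<^sup>2)"
proof -
  obtain C where C: "C \<ge> 0" "\<And>x. \<phi> 0 x powr 2 \<le> C * (1 + \<bar>x\<bar>) powr (- s * 2)" using phi0_powr_bound by blast
  show ?thesis
  proof (rule Bochner_Integration.integrable_bound)
  show "integrable lborel (\<lambda>x. C * (1 + \<bar>x\<bar>) powr (- s * 2))"
    using s_gt_half[OF assms] by (intro integrable_mult_right integrable_powr_abs) auto
  show "(\<lambda>x. (\<phi> 0 x)\<^sup>2) \<in> borel_measurable lborel"
    by (intro borel_measurable_power phi_measurable) simp
  have "norm ((\<phi> 0 x)\<^sup>2) \<le> norm (C * (1 + \<bar>x\<bar>) powr (- s * 2))" for x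
    using C(2)[of x] C(1) pos[of 0 x] by (simp add: powr_numeral)
  then show "AE x in lborel. norm ((\<phi> 0 x)\<^sup>2) \<le> norm (C * (1 + \<bar>x\<bar>) powr (- s * 2))" by simp
  qed
qed

lemma L2_norm_phi0: "(L2_norm (\<phi> 0))\<^sup>2 = (LINT x|lborel. (\<phi> 0 x)\<^sup>2)"
  using mass_eq[of 0] unfolding mass_def by simp

text \<open>Needed to split the form of \<open>psi\<close> into three integrals: this part alone is
  not compactly supported. The coefficient is bounded along the wave, so \<open>\<phi>^2\<close>
  controls the second summand.\<close>

lemma phi0_form_integrable:
  assumes "p < 5"
  shows "integrable lborel (\<lambda>x. (deriv (\<phi> 0) x)\<^sup>2 + nl' (\<phi> 0 x) * (\<phi> 0 x)\<^sup>2)"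
proof (rule Bochner_Integration.integrable_add)
  have z: "(0::real) \<in> {0..1}" "(0::real) \<ge> 0" by auto
  obtain C where C: "C \<ge> 0" "\<And>x. \<bar>deriv (\<phi> 0) x\<bar> \<le> C * (1 + \<bar>x\<bar>) powr (- s - 1)" using deriv_phi0_bound by blast
  show "integrable lborel (\<lambda>x. (deriv (\<phi> 0) x)\<^sup>2)"
  proof (rule Bochner_Integration.integrable_bound)
    show "integrable lborel (\<lambda>x. C\<^sup>2 * (1 + \<bar>x\<bar>) powr ((- s - 1) * 2))"
      using s_pos by (intro integrable_mult_right integrable_powr_abs) auto
    show "(\<lambda>x. (deriv (\<phi> 0) x)\<^sup>2) \<in> borel_measurable lborel"
      by (intro borel_measurable_power borel_measurable_DERIV[OF deriv2[OF z(2)]])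
    have "norm ((deriv (\<phi> 0) x)\<^sup>2) \<le> norm (C\<^sup>2 * (1 + \<bar>x\<bar>) powr ((- s - 1) * 2))" for x
    proof -
      have "(\<bar>deriv (\<phi> 0) x\<bar>)\<^sup>2 \<le> (C * (1 + \<bar>x\<bar>) powr (- s - 1))\<^sup>2"
        by (intro power_mono C) auto
      also have "\<dots> = C\<^sup>2 * (1 + \<bar>x\<bar>) powr ((- s - 1) * 2)"
        by (simp add: power_mult_distrib powr_power mult.commute)
      finally show ?thesis by simp
    qed
    then show "AE x in lborel. norm ((deriv (\<phi> 0) x)\<^sup>2) \<le> norm (C\<^sup>2 * (1 + \<bar>x\<bar>) powr ((- s - 1) * 2))" by simp
  qed
  obtain L where L: "L \<ge> 0" "\<And>v. v \<in> {0..\<phi> 1 0} \<Longrightarrow> \<bar>nl' v\<bar> \<le> L" using nl'_bound by blast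
  show "integrable lborel (\<lambda>x. nl' (\<phi> 0 x) * (\<phi> 0 x)\<^sup>2)"
  proof (rule Bochner_Integration.integrable_bound)
    show "integrable lborel (\<lambda>x. L * (\<phi> 0 x)\<^sup>2)"
      by (intro integrable_mult_right phi0_square_integrable assms)
    have "(\<lambda>x. nl' (\<phi> 0 x)) \<in> borel_measurable lborel"
      using isCont_nl'[OF z(2)] by (auto intro!: borel_measurable_continuous_onI continuous_at_imp_continuous_on)
    then show "(\<lambda>x. nl' (\<phi> 0 x) * (\<phi> 0 x)\<^sup>2) \<in> borel_measurable lborel"
      by (intro borel_measurable_times borel_measurable_power phi_measurable) auto
    have "norm (nl' (\<phi> 0 x) * (\<phi> 0 x)\<^sup>2) \<le> norm (L * (\<phi> 0 x)\<^sup>2)" for x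
      using L(2)[OF in_range[OF z(1)], of x] L(1) by (simp add: abs_mult mult_right_mono)
    then show "AE x in lborel. norm (nl' (\<phi> 0 x) * (\<phi> 0 x)\<^sup>2) \<le> norm (L * (\<phi> 0 x)\<^sup>2)" by simp
  qed
qed

end

locale cutoff_family = family +
  fixes \<theta> \<theta>' \<theta>'' :: "real \<Rightarrow> real" and K :: real
  assumes p_lt_5: "p < 5" and cutoff: "cutoff \<theta>" and K: "K \<ge> 0"
    and th1: "(\<theta> has_real_derivative \<theta>' x) (at x)" and th2: "(\<theta>' has_real_derivative \<theta>'' x) (at x)"
    and th2_cont: "continuous_on UNIV \<theta>''"
    and th1_bound: "\<bar>\<theta>' x\<bar> \<le> K" and th2_bound: "\<bar>\<theta>'' x\<bar> \<le> K"
    and th_zero: "\<bar>x\<bar> < 1 \<or> \<bar>x\<bar> > 2 \<Longrightarrow> \<theta>' x = 0 \<and> \<theta>'' x = 0"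
begin

abbreviation f where "f \<equiv> \<phi> 0"
abbreviation f' where "f' \<equiv> deriv (\<phi> 0)"
abbreviation e where "e \<equiv> resp 0"
abbreviation e' where "e' \<equiv> deriv (resp 0)"
abbreviation c where "c \<equiv> \<lambda>x. nl' (f x)"

lemma zero_in: "(0::real) \<in> {0..1}" by simp

lemma th_range: "0 \<le> \<theta> x" "\<theta> x \<le> 1" and th_one: "\<bar>x\<bar> \<le> 1 \<Longrightarrow> \<theta> x = 1" and th_out: "\<bar>x\<bar> \<ge> 2 \<Longrightarrow> \<theta> x = 0"
  using cutoff unfolding cutoff_def by auto

lemma ddf: "(f has_real_derivative f' x) (at x)" "(f' has_real_derivative nl (f x)) (at x)"
  using deriv1[of 0 x] deriv2[of 0 x] by auto

lemma dde: "(e has_real_derivative e' x) (at x)" "(e' has_real_derivative c x * e x + f x) (at x)"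
  using resp1[OF zero_in, of x] resp2[OF zero_in, of x] by auto

lemma conts: "continuous_on A f" "continuous_on A f'" "continuous_on A e" "continuous_on A e'"
  "continuous_on A c" "continuous_on A \<theta>" "continuous_on A \<theta>'" "continuous_on A \<theta>''"
proof -
  have *: "continuous_on A h" if "\<And>x. (h has_real_derivative h' x) (at x)" for h h' :: "real \<Rightarrow> real" and A
    using that by (auto intro!: continuous_at_imp_continuous_on DERIV_isCont)
  show "continuous_on A f" "continuous_on A f'" "continuous_on A e" "continuous_on A e'"
    "continuous_on A \<theta>" "continuous_on A \<theta>'"
    by (rule * ddf dde th1 th2)+
  show "continuous_on A c" using isCont_nl'[of 0] by (auto intro!: continuous_at_imp_continuous_on)
  show "continuous_on A \<theta>''" using th2_cont by (rule continuous_on_subset) simp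
qed

section \<open>The rescaled cutoff and the integrals in the expansion\<close>

definition chi where "chi R x = \<theta> (x / R)"
definition chi' where "chi' R x = \<theta>' (x / R) / R"
definition chi'' where "chi'' R x = \<theta>'' (x / R) / R\<^sup>2"

lemma chi1: "R > 0 \<Longrightarrow> (chi R has_real_derivative chi' R x) (at x)"
  and chi2: "R > 0 \<Longrightarrow> (chi' R has_real_derivative chi'' R x) (at x)"
proof -
  assume R: "R > 0"
  have "((\<lambda>x. x / R) has_real_derivative 1 / R) (at x)" using R by (auto intro!: derivative_eq_intros)
  from DERIV_chain2[OF th1 this] DERIV_cdivide[OF DERIV_chain2[OF th2 this], of R]
  show "(chi R has_real_derivative chi' R x) (at x)" "(chi' R has_real_derivative chi'' R x) (at x)"
    unfolding chi_def chi'_def chi''_def by (simp_all add: power2_eq_square)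
qed

lemma chi_conts: "R > 0 \<Longrightarrow> continuous_on A (chi R)" "R > 0 \<Longrightarrow> continuous_on A (chi' R)" "R > 0 \<Longrightarrow> continuous_on A (chi'' R)"
  unfolding chi_def chi'_def chi''_def
  by (auto intro!: continuous_intros continuous_on_compose2[OF conts(6)] continuous_on_compose2[OF conts(7)]
      continuous_on_compose2[OF conts(8)])

lemma chi_out: "R > 0 \<Longrightarrow> \<bar>x\<bar> > 2 * R \<Longrightarrow> chi R x = 0 \<and> chi' R x = 0 \<and> chi'' R x = 0"
proof -
  assume "R > 0" "\<bar>x\<bar> > 2 * R"
  then have "\<bar>x / R\<bar> > 2" by (simp add: abs_divide less_divide_eq)
  then show ?thesis using th_out[of "x / R"] th_zero[of "x / R"] unfolding chi_def chi'_def chi''_def by simp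
qed

lemma chi_in: "R > 0 \<Longrightarrow> \<bar>x\<bar> < R \<Longrightarrow> chi R x = 1 \<and> chi' R x = 0 \<and> chi'' R x = 0"
proof -
  assume "R > 0" "\<bar>x\<bar> < R"
  then have "\<bar>x / R\<bar> < 1" by (simp add: abs_divide divide_less_eq)
  then show ?thesis using th_one[of "x / R"] th_zero[of "x / R"] unfolding chi_def chi'_def chi''_def by simp
qed

lemma chi_range: "0 \<le> chi R x" "chi R x \<le> 1"
  unfolding chi_def by (rule th_range)+

lemma chi'_bound: "R > 0 \<Longrightarrow> \<bar>chi' R x\<bar> \<le> K / R" and chi''_bound: "R > 0 \<Longrightarrow> \<bar>chi'' R x\<bar> \<le> K / R\<^sup>2"
  unfolding chi'_def chi''_def using th1_bound th2_bound by (auto simp: abs_divide intro!: divide_right_mono)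

text \<open>The denominator of \<open>beta\<close>. Of the integrals that follow, \<open>E1\<close>
  and \<open>E2\<close> are the errors due to derivatives falling on the cutoff and live on
  \<open>R \<le> \<bar>x\<bar> \<le> 2 * R\<close>.\<close>

definition P where "P R = (LINT x|lborel. chi R x * (f x * e x))"
definition P2 where "P2 R = (LINT x|lborel. (chi R x)\<^sup>2 * (f x * e x))"
definition N where "N R = (LINT x|lborel. chi R x * (f x)\<^sup>2)"
definition E1 where "E1 R = (LINT x|lborel. (2 * f' x * chi' R x + f x * chi'' R x) * e x)"
definition E2 where "E2 R = (LINT x|lborel. (chi' R x)\<^sup>2 * (e x)\<^sup>2)"
definition m where "m = (LINT x|lborel. (f x)\<^sup>2)"

lemma integrables:
  assumes R: "R > 0"
  shows "integrable lborel (\<lambda>x. chi R x * (f x * e x))" "integrable lborel (\<lambda>x. (chi R x)\<^sup>2 * (f x * e x))"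
    "integrable lborel (\<lambda>x. chi R x * (f x)\<^sup>2)" "integrable lborel (\<lambda>x. (2 * f' x * chi' R x + f x * chi'' R x) * e x)"
    "integrable lborel (\<lambda>x. (chi' R x)\<^sup>2 * (e x)\<^sup>2)"
  by (rule continuous_compact_support_integrable[where b = "2 * R"]; (use chi_out[OF R] in \<open>auto intro!: continuous_intros conts chi_conts R\<close>))+

lemma beta_eq: "beta \<phi> \<theta> R = - (m / P R)"
proof -
  have "eta0 \<phi> = e" using eta0_eq by auto
  then have "L2_inner f (\<lambda>x. \<theta> (x / R) * eta0 \<phi> x) = P R"
    unfolding L2_inner_def P_def chi_def by (simp add: ac_simps)
  then show ?thesis unfolding beta_def L2_norm_phi0 m_def by simp
qed

lemma psi_eq: "psi \<phi> \<theta> R = (\<lambda>x. f x + beta \<phi> \<theta> R * (chi R x * e x))"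
  unfolding psi_def chi_def eta0_eq ..

text \<open>Up to exact derivatives of compactly supported functions, the cross term is
  \<open>- chi f\<^sup>2 + (2 f' chi' + f chi'') e\<close> and the square term is \<open>chi'\<^sup>2 e\<^sup>2 - chi\<^sup>2 f e\<close>, because
  \<open>e'' = c e + f\<close>.\<close>

lemma form_expansion:
  assumes R: "R > 0"
  shows "L0_form p q f (psi \<phi> \<theta> R) = L0_form p q f f + 2 * beta \<phi> \<theta> R * (E1 R - N R) + (beta \<phi> \<theta> R)\<^sup>2 * (E2 R - P2 R)"
proof -
  define b where "b = beta \<phi> \<theta> R"
  define u' where "u' x = chi' R x * e x + chi R x * e' x" for x
  have du: "((\<lambda>x. chi R x * e x) has_real_derivative u' x) (at x)" for x
    unfolding u'_def by (auto intro!: derivative_eq_intros chi1[OF R] dde)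
  have dpsi: "deriv (psi \<phi> \<theta> R) x = f' x + b * u' x" for x
    unfolding psi_eq b_def [symmetric] by (intro DERIV_imp_deriv DERIV_add DERIV_cmult du ddf)
  define A where "A x = (f' x)\<^sup>2 + c x * (f x)\<^sup>2" for x
  define X where "X x = f' x * u' x + c x * f x * (chi R x * e x)" for x
  define Y where "Y x = (u' x)\<^sup>2 + c x * (chi R x * e x)\<^sup>2" for x
  have u'_cont: "continuous_on UNIV u'" unfolding u'_def by (intro continuous_intros conts chi_conts R)
  have X: "integrable lborel X \<and> (LINT x|lborel. X x) = E1 R - N R"
  proof -
    \<comment> \<open>The first term moves the derivative from \<open>f\<close> to
      \<open>u'\<close>. The second removes the resulting \<open>f * chi' * e'\<close>, so that no
      decay estimate for \<open>e'\<close> is required.\<close>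
    define F where "F x = f x * u' x - 2 * (f x * chi' R x * e x)" for x
    define h where "h x = X x - ((2 * f' x * chi' R x + f x * chi'' R x) * e x - chi R x * (f x)\<^sup>2)" for x
    have "(F has_real_derivative h x) (at x)" for x
      unfolding F_def u'_def
      by (rule derivative_eq_intros chi1[OF R] chi2[OF R] dde ddf refl)+
         (simp add: h_def X_def u'_def algebra_simps power2_eq_square)
    moreover have "continuous_on UNIV h"
      unfolding h_def X_def by (intro continuous_intros conts chi_conts R u'_cont)
    moreover have "F x = 0" if "\<bar>x\<bar> > 2 * R" for x
      using chi_out[OF R that] by (simp add: F_def u'_def)
    ultimately have h: "integrable lborel h" "(LINT x|lborel. h x) = 0"
      using integral_exact_compact_support[of F h "2 * R"] by blast+
    have i: "integrable lborel (\<lambda>x. (2 * f' x * chi' R x + f x * chi'' R x) * e x - chi R x * (f x)\<^sup>2)"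
      by (intro Bochner_Integration.integrable_diff integrables R)
    have X_eq: "X = (\<lambda>x. h x + ((2 * f' x * chi' R x + f x * chi'' R x) * e x - chi R x * (f x)\<^sup>2))"
      unfolding h_def by auto
    show ?thesis
      unfolding X_eq Bochner_Integration.integral_add[OF h(1) i] h(2)
        Bochner_Integration.integral_diff[OF integrables(4,3)[OF R]] E1_def N_def
      using Bochner_Integration.integrable_add[OF h(1) i] h(2) by simp
  qed
  have Y: "integrable lborel Y \<and> (LINT x|lborel. Y x) = E2 R - P2 R"
  proof -
    \<comment> \<open>The localisation (IMS) identity: the mixed terms
      \<open>chi * chi' * e * e'\<close> cancel, leaving only \<open>chi'^2 e^2\<close> besides the
      contribution of the equation for \<open>e\<close>.\<close>
    define F where "F x = (chi R x)\<^sup>2 * (e x * e' x)" for x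
    define h where "h x = Y x - ((chi' R x)\<^sup>2 * (e x)\<^sup>2 - (chi R x)\<^sup>2 * (f x * e x))" for x
    have "(F has_real_derivative h x) (at x)" for x
      unfolding F_def power2_eq_square
      by (rule derivative_eq_intros chi1[OF R] chi2[OF R] dde ddf refl)+
         (simp add: h_def Y_def u'_def algebra_simps power2_eq_square)
    moreover have "continuous_on UNIV h"
      unfolding h_def Y_def by (intro continuous_intros conts chi_conts R u'_cont)
    moreover have "F x = 0" if "\<bar>x\<bar> > 2 * R" for x
      using chi_out[OF R that] by (simp add: F_def)
    ultimately have h: "integrable lborel h" "(LINT x|lborel. h x) = 0"
      using integral_exact_compact_support[of F h "2 * R"] by blast+
    have i: "integrable lborel (\<lambda>x. (chi' R x)\<^sup>2 * (e x)\<^sup>2 - (chi R x)\<^sup>2 * (f x * e x))"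
      by (intro Bochner_Integration.integrable_diff integrables R)
    have Y_eq: "Y = (\<lambda>x. h x + ((chi' R x)\<^sup>2 * (e x)\<^sup>2 - (chi R x)\<^sup>2 * (f x * e x)))"
      unfolding h_def by auto
    show ?thesis
      unfolding Y_eq Bochner_Integration.integral_add[OF h(1) i] h(2)
        Bochner_Integration.integral_diff[OF integrables(5,2)[OF R]] E2_def P2_def
      using Bochner_Integration.integrable_add[OF h(1) i] h(2) by simp
  qed
  have Ai: "integrable lborel A" unfolding A_def by (rule phi0_form_integrable[OF p_lt_5])
  have form: "L0_form p q f v = (LINT x|lborel. (deriv v x)\<^sup>2 + c x * (v x)\<^sup>2)" for v
    unfolding L0_form_def nl'_def by (simp add: left_diff_distrib add_diff_eq)
  have "L0_form p q f (psi \<phi> \<theta> R) = (LINT x|lborel. A x + (2 * b * X x + b\<^sup>2 * Y x))"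
    unfolding form unfolding dpsi unfolding psi_eq b_def [symmetric]
    by (intro Bochner_Integration.integral_cong refl) (simp add: A_def X_def Y_def algebra_simps power2_eq_square)
  also have "\<dots> = (LINT x|lborel. A x) + (2 * b * (E1 R - N R) + b\<^sup>2 * (E2 R - P2 R))"
    using Ai X Y by simp
  finally show ?thesis unfolding form A_def [symmetric] b_def by simp
qed

section \<open>Limits and sizes of the individual integrals\<close>

lemma N_tendsto: "(N \<longlongrightarrow> m) at_top"
  unfolding N_def m_def
proof (rule integral_dominated_convergence_at_top[where w = "\<lambda>x. (f x)\<^sup>2"])
  show "AE x in lborel. ((\<lambda>R. chi R x * (f x)\<^sup>2) \<longlongrightarrow> (f x)\<^sup>2) at_top"
  proof (rule AE_I2)
    fix x
    have "eventually (\<lambda>R. (f x)\<^sup>2 = chi R x * (f x)\<^sup>2) at_top"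
      using eventually_gt_at_top[of "\<bar>x\<bar>"] eventually_gt_at_top[of 0]
      by eventually_elim (use chi_in in auto)
    then show "((\<lambda>R. chi R x * (f x)\<^sup>2) \<longlongrightarrow> (f x)\<^sup>2) at_top"
      by (rule Lim_transform_eventually[OF tendsto_const])
  qed
  show "\<forall>\<^sub>F R in at_top. AE x in lborel. norm (chi R x * (f x)\<^sup>2) \<le> (f x)\<^sup>2"
    using mult_left_le_one_le[OF _ chi_range] chi_range(1) by (simp add: abs_mult)
  show "(\<lambda>x. chi t x * (f x)\<^sup>2) \<in> borel_measurable lborel" for t
  proof -
    have "chi t \<in> borel_measurable lborel" unfolding chi_def
      using measurable_compose[OF _ borel_measurable_continuous_onI[OF conts(6)], of "\<lambda>x. x / t" lborel] by simp
    then show ?thesis by (intro borel_measurable_times borel_measurable_power phi_measurable) auto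
  qed
qed (use phi0_square_integrable[OF p_lt_5] in \<open>auto intro: borel_measurable_integrable\<close>)

lemma P_tendsto:
  assumes int: "integrable lborel (\<lambda>x. f x * e x)"
  shows "(P \<longlongrightarrow> (LINT x|lborel. f x * e x)) at_top" "(P2 \<longlongrightarrow> (LINT x|lborel. f x * e x)) at_top"
proof -
  have "((\<lambda>R. LINT x|lborel. (chi R x) ^ k * (f x * e x)) \<longlongrightarrow> (LINT x|lborel. f x * e x)) at_top" for k
  proof (rule integral_dominated_convergence_at_top[where w = "\<lambda>x. \<bar>f x * e x\<bar>"])
    show "AE x in lborel. ((\<lambda>R. (chi R x) ^ k * (f x * e x)) \<longlongrightarrow> f x * e x) at_top"
    proof (rule AE_I2)
      fix x
      have "eventually (\<lambda>R. f x * e x = (chi R x) ^ k * (f x * e x)) at_top"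
        using eventually_gt_at_top[of "\<bar>x\<bar>"] eventually_gt_at_top[of 0]
        by eventually_elim (use chi_in in auto)
      then show "((\<lambda>R. (chi R x) ^ k * (f x * e x)) \<longlongrightarrow> f x * e x) at_top"
        by (rule Lim_transform_eventually[OF tendsto_const])
    qed
    have "norm ((chi R x) ^ k * (f x * e x)) \<le> \<bar>f x * e x\<bar>" for R x
      using chi_range[of R x] unfolding real_norm_def abs_mult[of "chi R x ^ k"]
      by (intro mult_left_le_one_le) (auto intro!: power_le_one)
    then show "\<forall>\<^sub>F R in at_top. AE x in lborel. norm ((chi R x) ^ k * (f x * e x)) \<le> \<bar>f x * e x\<bar>" by simp
    show "(\<lambda>x. (chi t x) ^ k * (f x * e x)) \<in> borel_measurable lborel" for t
    proof -
      have "chi t \<in> borel_measurable lborel" unfolding chi_def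
        using measurable_compose[OF _ borel_measurable_continuous_onI[OF conts(6)], of "\<lambda>x. x / t" lborel] by simp
      then show ?thesis 
        by (intro borel_measurable_times[OF borel_measurable_power borel_measurable_integrable[OF int]])
    qed
  qed (use int in auto)
  from this[of 1] this[of 2] show "(P \<longlongrightarrow> (LINT x|lborel. f x * e x)) at_top" "(P2 \<longlongrightarrow> (LINT x|lborel. f x * e x)) at_top"
    unfolding P_def P2_def by auto
qed

text \<open>On the annulus both products are of size \<open>R powr (- 2 * s)\<close>, for instance
  \<open>f' * chi' * e\<close> with exponents \<open>- s - 1\<close>, \<open>- 1\<close> and
  \<open>2 - s\<close>. The annulus has length of order \<open>R\<close>, and
  \<open>1 - 2 * s\<close> is negative because \<open>p < 5\<close>.\<close>

lemma E1_tendsto: "(E1 \<longlongrightarrow> 0) at_top"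
proof -
  obtain C0 where C0: "C0 \<ge> 0" "\<And>x. f x powr 1 \<le> C0 * (1 + \<bar>x\<bar>) powr (- s * 1)" using phi0_powr_bound by blast
  obtain C1 where C1: "C1 \<ge> 0" "\<And>x. \<bar>f' x\<bar> \<le> C1 * (1 + \<bar>x\<bar>) powr (- s - 1)" using deriv_phi0_bound by blast
  obtain C2 where C2: "C2 \<ge> 0" "\<And>x. \<bar>e x\<bar> \<le> C2 * (1 + \<bar>x\<bar>) powr (2 - s)" using resp0_bound by blast
  define M where "M = 2 * C1 * K * C2 * 3 powr \<bar>1 - 2 * s\<bar> + C0 * K * C2 * 3 powr \<bar>2 - 2 * s\<bar>"
  have M0: "M \<ge> 0" unfolding M_def using C0 C1 C2 K by simp
  have b: "\<bar>E1 R\<bar> \<le> 4 * M * R powr (1 - 2 * s)" if R: "R \<ge> 1" for R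
  proof -
    have R0: "R > 0" using R by simp
    have "\<bar>E1 R\<bar> \<le> 2 * (2 * R) * (M * R powr (- 2 * s))"
      unfolding E1_def
    proof (rule integral_abs_bound_support[OF integrables(4)[OF R0]])
      fix x assume x: "\<bar>x\<bar> \<le> 2 * R"
      show "\<bar>(2 * f' x * chi' R x + f x * chi'' R x) * e x\<bar> \<le> M * R powr (- 2 * s)"
      proof (cases "\<bar>x\<bar> < R")
        case True
        then show ?thesis using chi_in[OF R0 True] M0 by simp
      next
        case False
        then have xR: "R \<le> \<bar>x\<bar>" by simp
        have "\<bar>(2 * f' x * chi' R x + f x * chi'' R x) * e x\<bar> \<le> (2 * \<bar>f' x\<bar> * \<bar>chi' R x\<bar> + \<bar>f x\<bar> * \<bar>chi'' R x\<bar>) * \<bar>e x\<bar>"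
          unfolding abs_mult by (intro mult_right_mono order_trans[OF abs_triangle_ineq]) (auto simp: abs_mult)
        also have "\<dots> \<le> (2 * (C1 * (1 + \<bar>x\<bar>) powr (- s - 1)) * (K / R) + (C0 * (1 + \<bar>x\<bar>) powr (- s)) * (K / R\<^sup>2)) * (C2 * (1 + \<bar>x\<bar>) powr (2 - s))"
          using C1 C2 C0(1) C0(2)[of x] pos[of 0 x] chi'_bound[OF R0, of x] chi''_bound[OF R0, of x] K R0
          by (intro mult_mono add_mono) auto
        also have "\<dots> = 2 * C1 * K * C2 / R * ((1 + \<bar>x\<bar>) powr (- s - 1) * (1 + \<bar>x\<bar>) powr (2 - s))
            + C0 * K * C2 / R\<^sup>2 * ((1 + \<bar>x\<bar>) powr (- s) * (1 + \<bar>x\<bar>) powr (2 - s))"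
          by (simp add: algebra_simps)
        also have "\<dots> = 2 * C1 * K * C2 / R * (1 + \<bar>x\<bar>) powr (1 - 2 * s) + C0 * K * C2 / R\<^sup>2 * (1 + \<bar>x\<bar>) powr (2 - 2 * s)"
          unfolding powr_add [symmetric] by simp
        also have "\<dots> \<le> 2 * C1 * K * C2 / R * (3 powr \<bar>1 - 2 * s\<bar> * R powr (1 - 2 * s)) + C0 * K * C2 / R\<^sup>2 * (3 powr \<bar>2 - 2 * s\<bar> * R powr (2 - 2 * s))"
          using C0 C1 C2 K R0 by (intro add_mono mult_left_mono powr_annulus_bound R xR x) auto
        also have "\<dots> = M * R powr (- 2 * s)"
        proof -
          have "R powr (1 - 2 * s) = R * R powr (- 2 * s)" "R powr (2 - 2 * s) = R\<^sup>2 * R powr (- 2 * s)"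
            using R0 powr_add[of R 1 "- 2 * s"] powr_add[of R 2 "- 2 * s"] by (simp_all add: powr_numeral)
          then show ?thesis unfolding M_def using R0 by (simp add: algebra_simps)
        qed
        finally show ?thesis .
      qed
    qed (use R0 chi_out[OF R0] in auto)
    also have "\<dots> = 4 * M * R powr (1 - 2 * s)"
      using R0 powr_add[of R 1 "- 2 * s"] by simp
    finally show ?thesis .
  qed
  have "((\<lambda>R. 4 * M * R powr (1 - 2 * s)) \<longlongrightarrow> 4 * M * 0) at_top"
    using s_gt_half[OF p_lt_5] by (intro tendsto_intros tendsto_neg_powr filterlim_ident) auto
  then have "((\<lambda>R. 4 * M * R powr (1 - 2 * s)) \<longlongrightarrow> 0) at_top" by simp
  then show ?thesis
    by (rule Lim_null_comparison[rotated]) (use b in \<open>auto intro!: eventually_mono[OF eventually_ge_at_top[of 1]]\<close>)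
qed

text \<open>The factors \<open>chi'^2\<close> and \<open>e^2\<close> contribute the exponents
  \<open>- 2\<close> and \<open>4 - 2 * s\<close>, the length of the annulus one more. This tends to
  \<open>0\<close> only for \<open>s > 3 / 2\<close>; otherwise it is absorbed by the growth of
  \<open>P\<close>.\<close>

lemma E2_bound:
  obtains M where "M \<ge> 0" "\<And>R. R \<ge> 1 \<Longrightarrow> \<bar>E2 R\<bar> \<le> M * R powr (3 - 2 * s)"
proof -
  obtain C2 where C2: "C2 \<ge> 0" "\<And>x. \<bar>e x\<bar> \<le> C2 * (1 + \<bar>x\<bar>) powr (2 - s)" using resp0_bound by blast
  define M where "M = K\<^sup>2 * C2\<^sup>2 * 3 powr \<bar>4 - 2 * s\<bar>"
  have M0: "M \<ge> 0" unfolding M_def by simp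
  have b: "\<bar>E2 R\<bar> \<le> 4 * M * R powr (3 - 2 * s)" if R: "R \<ge> 1" for R
  proof -
    have R0: "R > 0" using R by simp
    have "\<bar>E2 R\<bar> \<le> 2 * (2 * R) * (M * R powr (2 - 2 * s))"
      unfolding E2_def
    proof (rule integral_abs_bound_support[OF integrables(5)[OF R0]])
      fix x assume x: "\<bar>x\<bar> \<le> 2 * R"
      show "\<bar>(chi' R x)\<^sup>2 * (e x)\<^sup>2\<bar> \<le> M * R powr (2 - 2 * s)"
      proof (cases "\<bar>x\<bar> < R")
        case True
        then show ?thesis using chi_in[OF R0 True] M0 by simp
      next
        case False
        then have xR: "R \<le> \<bar>x\<bar>" by simp
        have "\<bar>(chi' R x)\<^sup>2 * (e x)\<^sup>2\<bar> = \<bar>chi' R x\<bar>\<^sup>2 * \<bar>e x\<bar>\<^sup>2" by (simp add: abs_mult)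
        also have "\<dots> \<le> (K / R)\<^sup>2 * (C2 * (1 + \<bar>x\<bar>) powr (2 - s))\<^sup>2"
          using C2 chi'_bound[OF R0, of x] by (intro mult_mono power_mono) auto
        also have "\<dots> = K\<^sup>2 * C2\<^sup>2 / R\<^sup>2 * (1 + \<bar>x\<bar>) powr (4 - 2 * s)"
          by (simp add: power_mult_distrib power_divide powr_power algebra_simps)
        also have "\<dots> \<le> K\<^sup>2 * C2\<^sup>2 / R\<^sup>2 * (3 powr \<bar>4 - 2 * s\<bar> * R powr (4 - 2 * s))"
          by (intro mult_left_mono powr_annulus_bound R xR x) auto
        also have "\<dots> = M * R powr (2 - 2 * s)"
        proof -
          have "R powr (4 - 2 * s) = R\<^sup>2 * R powr (2 - 2 * s)"
            using R0 powr_add[of R 2 "2 - 2 * s"] by (simp add: powr_numeral)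
          then show ?thesis unfolding M_def using R0 by simp
        qed
        finally show ?thesis .
      qed
    qed (use R0 chi_out[OF R0] in auto)
    also have "\<dots> = 4 * M * R powr (3 - 2 * s)"
      using R0 powr_add[of R 1 "2 - 2 * s"] by simp
    finally show ?thesis .
  qed
  then show thesis using M0 by (intro that[of "4 * M"]) auto
qed

end

section \<open>The limits\<close>

context cutoff_family
begin

text \<open>With \<open>Q\<close> the integral of \<open>f * e\<close>, \<open>beta\<close> tends to
  \<open>- m / Q\<close>; the cross term then contributes \<open>2 m^2 / Q\<close> and the square
  term \<open>- m^2 / Q\<close>. The assumption on \<open>M'(0)\<close> says exactly that
  \<open>Q\<close> is nonzero.\<close>

lemma finite_limit:
  assumes s: "s > 3 / 2" and "mass_deriv0 \<phi> \<noteq> 0"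
  shows "((\<lambda>R. ereal (L0_form p q f (psi \<phi> \<theta> R))) \<longlongrightarrow>
    ereal (L0_form p q f f) + ereal (L2_norm f ^ 4) / mass_deriv0 \<phi>) at_top"
proof -
  define Q where "Q = (LINT x|lborel. f x * e x)"
  have Q: "mass_deriv0 \<phi> = ereal Q" unfolding Q_def by (rule mass_derivative_limit[OF s p_lt_5])
  then have Q0: "Q \<noteq> 0" using assms(2) by (auto simp: zero_ereal_def)
  note P = P_tendsto[OF mass_derivative_limit(1)[OF s p_lt_5], folded Q_def]
  have E2: "(E2 \<longlongrightarrow> 0) at_top"
  proof -
    obtain M where M: "M \<ge> 0" "\<And>R. R \<ge> 1 \<Longrightarrow> \<bar>E2 R\<bar> \<le> M * R powr (3 - 2 * s)" using E2_bound by blast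
    have "((\<lambda>R. M * R powr (3 - 2 * s)) \<longlongrightarrow> M * 0) at_top"
      using s by (intro tendsto_intros tendsto_neg_powr filterlim_ident) auto
    then have "((\<lambda>R. M * R powr (3 - 2 * s)) \<longlongrightarrow> 0) at_top" by simp
    then show ?thesis
      by (rule Lim_null_comparison[rotated]) (use M in \<open>auto intro!: eventually_mono[OF eventually_ge_at_top[of 1]]\<close>)
  qed
  have "((\<lambda>R. L0_form p q f f + 2 * (- (m / P R)) * (E1 R - N R) + (- (m / P R))\<^sup>2 * (E2 R - P2 R)) \<longlongrightarrow>
    L0_form p q f f + 2 * (- (m / Q)) * (0 - m) + (- (m / Q))\<^sup>2 * (0 - Q)) at_top"
    by (intro tendsto_intros P E1_tendsto E2 N_tendsto Q0)
  moreover have "L0_form p q f f + 2 * (- (m / Q)) * (0 - m) + (- (m / Q))\<^sup>2 * (0 - Q) = L0_form p q f f + m\<^sup>2 / Q"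
    using Q0 by (simp add: field_simps power2_eq_square)
  moreover have "m\<^sup>2 = L2_norm f ^ 4"
    unfolding m_def L2_norm_phi0 [symmetric] by simp
  ultimately have lim: "((\<lambda>R. L0_form p q f f + 2 * (- (m / P R)) * (E1 R - N R) + (- (m / P R))\<^sup>2 * (E2 R - P2 R)) \<longlongrightarrow>
    L0_form p q f f + L2_norm f ^ 4 / Q) at_top" by (simp only:)
  have "((\<lambda>R. L0_form p q f (psi \<phi> \<theta> R)) \<longlongrightarrow> L0_form p q f f + L2_norm f ^ 4 / Q) at_top"
    by (rule Lim_transform_eventually[OF lim])
       (auto intro!: eventually_mono[OF eventually_gt_at_top[of 0]] simp: form_expansion beta_eq)
  then show ?thesis unfolding Q using Q0 by simp
qed

text \<open>The logarithmic bound gives divergence even at \<open>s = 3/2\<close>; the power bound absorbs \<open>E2\<close>.\<close>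

lemma P_lower_bounds:
  assumes s: "s \<le> 3 / 2"
  obtains C0 c1 X1 where "C0 \<ge> 0" "c1 > 0" "X1 \<ge> 1"
    "\<And>R. R \<ge> 1 \<Longrightarrow> \<bar>P2 R\<bar> \<le> C0 - P R"
    "\<And>R. R \<ge> X1 \<Longrightarrow> c1 * (ln (1 + R) - ln (1 + X1)) \<le> C0 - P R"
    "\<And>R. R \<ge> 2 * X1 \<Longrightarrow> c1 * R powr (3 - 2 * s) \<le> C0 - P R"
proof -
  define r where "r = 2 - 2 * s"
  have r: "r \<ge> -1" unfolding r_def using s by simp
  obtain a where a: "a > 0" "\<And>x. a * (1 + \<bar>x\<bar>) powr (- s) \<le> f x" using phi0_lower by blast
  obtain b X1 where b: "b > 0" "X1 \<ge> 1" "\<And>x. \<bar>x\<bar> \<ge> X1 \<Longrightarrow> b * (1 + \<bar>x\<bar>) powr (2 - s) \<le> - e x" using resp0_lower by blast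
  obtain B where B: "B \<ge> 0" "\<And>\<omega> x. \<omega> \<in> {0..1} \<Longrightarrow> \<bar>x\<bar> \<le> X1 \<Longrightarrow> \<bar>resp \<omega> x\<bar> \<le> B"
    using resp_bounded by blast
  define D where "D = \<phi> 1 0 * B"
  have fe_in: "\<bar>f x * e x\<bar> \<le> D" if "\<bar>x\<bar> \<le> X1" for x
    unfolding D_def abs_mult using B(2)[OF zero_in that] in_range[OF zero_in, of x] by (intro mult_mono) auto
  have D0: "D \<ge> 0" unfolding D_def using B(1) pos[of 1 0] by simp
  have fe_out: "a * b * (1 + \<bar>x\<bar>) powr r \<le> - (f x * e x)" if "\<bar>x\<bar> \<ge> X1" for x
  proof -
    have "(a * (1 + \<bar>x\<bar>) powr (- s)) * (b * (1 + \<bar>x\<bar>) powr (2 - s)) \<le> f x * (- e x)"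
      using a b(1) b(3)[OF that] pos[of 0 x] by (intro mult_mono) (auto intro: less_imp_le)
    moreover have "(1 + \<bar>x\<bar>) powr (- s) * (1 + \<bar>x\<bar>) powr (2 - s) = (1 + \<bar>x\<bar>) powr r"
      unfolding powr_add [symmetric] r_def by simp
    ultimately show ?thesis by (simp add: ac_simps)
  qed
  have fe_neg: "0 \<le> - (f x * e x)" if "\<bar>x\<bar> \<ge> X1" for x
    using fe_out[OF that] a(1) b(1) by (meson less_imp_le mult_nonneg_nonneg order_trans powr_ge_zero)
  \<comment> \<open>The sign of \<open>f * e\<close> is known only for
    \<open>\<bar>x\<bar> \<ge> X1\<close>. Adding \<open>I\<close> compensates for the core, at the
    fixed cost \<open>C0\<close>.\<close>
  define I where "I x = indicator {-X1..X1} x * D" for x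
  have I_int: "integrable lborel I" and I_val: "(LINT x|lborel. I x) = 2 * X1 * D"
    unfolding I_def using b(2) by (auto intro!: integrable_mult_left integrable_real_indicator)
  have I_in: "I x = D" if "\<bar>x\<bar> \<le> X1" for x using that unfolding I_def by (auto simp: indicator_def)
  have I_out: "I x = 0" if "\<not> \<bar>x\<bar> \<le> X1" for x using that unfolding I_def by (auto simp: indicator_def)
  define C0 where "C0 = 2 * X1 * D"
  \<comment> \<open>All three bounds come from integrating a suitable minorant \<open>h\<close> of
    \<open>I - chi * f * e\<close>.\<close>
  have key: "(LINT x|lborel. h x) \<le> C0 - P R"
    if R: "R > 0" and h: "integrable lborel h" "\<And>x. \<bar>x\<bar> \<le> X1 \<Longrightarrow> h x \<le> D - chi R x * (f x * e x)"
      "\<And>x. \<bar>x\<bar> \<ge> X1 \<Longrightarrow> h x \<le> - (chi R x * (f x * e x))" for h R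
  proof -
    have "(LINT x|lborel. h x) \<le> (LINT x|lborel. I x - chi R x * (f x * e x))"
    proof (rule integral_mono[OF h(1) Bochner_Integration.integrable_diff[OF I_int integrables(1)[OF R]]])
      show "h x \<le> I x - chi R x * (f x * e x)" for x
        using h(2,3)[of x] I_in[of x] I_out[of x] by (cases "\<bar>x\<bar> \<le> X1") auto
    qed
    also have "\<dots> = C0 - P R"
      unfolding Bochner_Integration.integral_diff[OF I_int integrables(1)[OF R]] I_val C0_def P_def ..
    finally show ?thesis .
  qed
  have chi_fe_in: "\<bar>chi R x ^ k * (f x * e x)\<bar> \<le> D" if "\<bar>x\<bar> \<le> X1" for x R k
  proof -
    have "\<bar>chi R x ^ k * (f x * e x)\<bar> \<le> 1 * D"
      unfolding abs_mult[of "chi R x ^ k"] using chi_range[of R x] fe_in[OF that] by (intro mult_mono) (auto intro: power_le_one)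
    then show ?thesis by simp
  qed
  \<comment> \<open>Outside the core \<open>f * e \<le> 0\<close> and
    \<open>chi^2 \<le> chi\<close>. The core is paid for twice, once for \<open>P2\<close> and once
    for \<open>P\<close>.\<close>
  have P2_le: "\<bar>P2 R\<bar> \<le> 2 * C0 - P R" if R: "R \<ge> 1" for R
  proof -
    have R0: "R > 0" using R by simp
    have i: "integrable lborel (\<lambda>x. \<bar>(chi R x)\<^sup>2 * (f x * e x)\<bar> - I x)"
      by (intro Bochner_Integration.integrable_diff integrable_abs integrables R0 I_int)
    have "(LINT x|lborel. \<bar>(chi R x)\<^sup>2 * (f x * e x)\<bar> - I x) \<le> C0 - P R"
    proof (rule key[OF R0 i])
      fix x assume x: "\<bar>x\<bar> \<le> X1"
      show "\<bar>(chi R x)\<^sup>2 * (f x * e x)\<bar> - I x \<le> D - chi R x * (f x * e x)"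
        using chi_fe_in[OF x, of R 2] chi_fe_in[OF x, of R 1] I_in[OF x] by simp
    next
      fix x assume x: "\<bar>x\<bar> \<ge> X1"
      have "\<bar>(chi R x)\<^sup>2 * (f x * e x)\<bar> = (chi R x)\<^sup>2 * (- (f x * e x))"
        using fe_neg[OF x] unfolding abs_mult[of "(chi R x)\<^sup>2"] by simp
      also have "\<dots> \<le> chi R x * (- (f x * e x))"
        using chi_range[of R x] fe_neg[OF x] unfolding power2_eq_square
        by (intro mult_right_mono) (auto intro: mult_left_le_one_le)
      finally show "\<bar>(chi R x)\<^sup>2 * (f x * e x)\<bar> - I x \<le> - (chi R x * (f x * e x))"
        using D0 unfolding I_def by (simp add: indicator_def)
    qed
    moreover have "(LINT x|lborel. \<bar>(chi R x)\<^sup>2 * (f x * e x)\<bar> - I x) = (LINT x|lborel. \<bar>(chi R x)\<^sup>2 * (f x * e x)\<bar>) - C0"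
      unfolding C0_def I_val [symmetric]
      by (intro Bochner_Integration.integral_diff integrable_abs integrables R0 I_int)
    moreover have "\<bar>P2 R\<bar> \<le> (LINT x|lborel. \<bar>(chi R x)\<^sup>2 * (f x * e x)\<bar>)"
      unfolding P2_def using integral_norm_bound[of lborel "\<lambda>x. (chi R x)\<^sup>2 * (f x * e x)"] by simp
    ultimately show ?thesis by linarith
  qed
  \<comment> \<open>As \<open>r \<ge> -1\<close>, the tail of \<open>- f * e\<close> dominates a
    multiple of \<open>1 / (1 + x)\<close>, whose integral is the logarithm.\<close>
  have log: "a * b * (ln (1 + R) - ln (1 + X1)) \<le> C0 - P R" if R: "R \<ge> X1" for R
  proof -
    have R0: "R > 0" using R b(2) by simp
    have cont: "continuous_on {X1..R} (\<lambda>x. a * b * (1 / (1 + x)))" using b(2) by (intro continuous_intros) auto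
    have low: "a * b * (1 / (1 + x)) \<le> - (chi R x * (f x * e x))" if x: "x \<in> {X1..R}" for x
    proof -
      have x0: "x \<ge> 1" "\<bar>x\<bar> \<ge> X1" using x b(2) by auto
      have "1 / (1 + x) = (1 + x) powr (-1)" using x0 by (simp add: powr_minus_divide)
      also have "\<dots> \<le> (1 + x) powr r" using x0 r by (intro powr_mono) auto
      finally have "a * b * (1 / (1 + x)) \<le> a * b * (1 + \<bar>x\<bar>) powr r"
        using a(1) b(1) x0 by (intro mult_left_mono) auto
      also have "\<dots> \<le> - (f x * e x)" by (rule fe_out[OF x0(2)])
      also have "chi R x = 1" unfolding chi_def using x x0(1) R0 by (intro th_one) auto
      then have "- (f x * e x) = - (chi R x * (f x * e x))" by simp
      finally show ?thesis .
    qed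
    have "(LINT x|lborel. indicator {X1..R} x *\<^sub>R (a * b * (1 / (1 + x)))) \<le> C0 - P R"
    proof (rule key[OF R0])
      show "integrable lborel (\<lambda>x. indicator {X1..R} x *\<^sub>R (a * b * (1 / (1 + x))))"
        using borel_integrable_atLeastAtMost'[OF cont] unfolding set_integrable_def .
      fix x :: real
      show "indicator {X1..R} x *\<^sub>R (a * b * (1 / (1 + x))) \<le> - (chi R x * (f x * e x))" if x: "\<bar>x\<bar> \<ge> X1"
        using low[of x] chi_range(1)[of R x] fe_neg[OF x]
        by (cases "x \<in> {X1..R}") (simp_all add: mult_nonneg_nonpos)
      show "indicator {X1..R} x *\<^sub>R (a * b * (1 / (1 + x))) \<le> D - chi R x * (f x * e x)" if x: "\<bar>x\<bar> \<le> X1"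
        using low[of x] D0 chi_fe_in[OF x, of R 1] by (cases "x \<in> {X1..R}") simp_all
    qed
    moreover have "(LINT x|lborel. indicator {X1..R} x *\<^sub>R (a * b * (1 / (1 + x)))) = a * b * ln (1 + R) - a * b * ln (1 + X1)"
      using b(2) R
      by (intro integral_FTC_atLeastAtMost cont)
         (auto intro!: derivative_eq_intros simp: has_real_derivative_iff_has_vector_derivative [symmetric])
    ultimately show ?thesis by (simp add: right_diff_distrib)
  qed
  \<comment> \<open>Only \<open>R / 2 < x < R\<close> is kept: there the cutoff equals
    \<open>1\<close>, the sign is known because \<open>R \<ge> 2 * X1\<close>, and
    \<open>(1 + x) / R\<close> lies between \<open>1 / 2\<close> and \<open>2\<close>, whence the
    factor \<open>2 powr (- \<bar>r\<bar>)\<close>.\<close>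
  have power: "a * b * 2 powr (- \<bar>r\<bar>) / 2 * R powr (3 - 2 * s) \<le> C0 - P R" if R: "R \<ge> 2 * X1" for R
  proof -
    have R0: "R > 0" "R \<ge> 2" using R b(2) by auto
    define v where "v = a * b * (2 powr (- \<bar>r\<bar>) * R powr r)"
    have "(LINT x|lborel. indicator {R/2<..<R} x * v) \<le> C0 - P R"
    proof (rule key[OF R0(1)])
      show "integrable lborel (\<lambda>x. indicator {R/2<..<R} x * v)"
        using R0 by (intro integrable_mult_left integrable_real_indicator) auto
      fix x :: real assume x: "\<bar>x\<bar> \<ge> X1"
      show "indicator {R/2<..<R} x * v \<le> - (chi R x * (f x * e x))"
      proof (cases "x \<in> {R/2<..<R}")
        case True
        then have x0: "x \<ge> 1" "\<bar>x\<bar> < R" using R b(2) by auto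
        have "2 powr (- \<bar>r\<bar>) \<le> ((1 + x) / R) powr r"
        proof (cases "r \<ge> 0")
          case True
          have "2 powr (- r) = (1 / 2) powr r" by (simp add: powr_minus_divide powr_divide)
          also have "\<dots> \<le> ((1 + x) / R) powr r" using True \<open>x \<in> _\<close> R0 by (intro powr_mono2) (auto simp: field_simps)
          finally show ?thesis using True by simp
        next
          case False
          then show ?thesis using \<open>x \<in> _\<close> R0 by (auto simp: field_simps intro!: powr_mono2')
        qed
        then have "2 powr (- \<bar>r\<bar>) * R powr r \<le> ((1 + x) / R) powr r * R powr r" by (intro mult_right_mono) auto
        also have "\<dots> = (1 + \<bar>x\<bar>) powr r" using R0 x0 by (simp add: powr_mult [symmetric])
        finally have "v \<le> a * b * (1 + \<bar>x\<bar>) powr r" unfolding v_def using a(1) b(1) by (intro mult_left_mono) auto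
        also have "\<dots> \<le> - (f x * e x)" by (rule fe_out[OF x])
        finally show ?thesis using True chi_in[OF R0(1) x0(2)] by simp
      next
        case False
        then show ?thesis using chi_range(1)[of R x] fe_neg[OF x] by (simp add: mult_nonneg_nonpos)
      qed
    next
      fix x :: real assume x: "\<bar>x\<bar> \<le> X1"
      then have "x \<notin> {R/2<..<R}" using R by auto
      then show "indicator {R/2<..<R} x * v \<le> D - chi R x * (f x * e x)"
        using chi_fe_in[OF x, of R 1] by simp
    qed
    moreover have "(LINT x|lborel. indicator {R/2<..<R} x * v) = R / 2 * v" using R0 by simp
    moreover have "R / 2 * v = a * b * 2 powr (- \<bar>r\<bar>) / 2 * R powr (3 - 2 * s)"
    proof -
      have "R powr (3 - 2 * s) = R * R powr r" using R0 powr_add[of R 1 r] unfolding r_def by simp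
      then show ?thesis unfolding v_def by simp
    qed
    ultimately show ?thesis by (simp only:)
  qed
  define c1 where "c1 = a * b * 2 powr (- \<bar>r\<bar>) / 2"
  have c1: "c1 > 0" "c1 \<le> a * b"
  proof -
    show "c1 > 0" unfolding c1_def using a(1) b(1) by simp
    have "2 powr (- \<bar>r\<bar>) \<le> 2 powr (0::real)" by (intro powr_mono) auto
    then have "2 powr (- \<bar>r\<bar>) / 2 \<le> 1" by simp
    then have "a * b * (2 powr (- \<bar>r\<bar>) / 2) \<le> a * b * 1" using a(1) b(1) by (intro mult_left_mono) auto
    then show "c1 \<le> a * b" unfolding c1_def by simp
  qed
  have C00: "C0 \<ge> 0" unfolding C0_def using D0 b(2) by simp
  show thesis
  proof (rule that[of "2 * C0" c1 X1])
    show "c1 * (ln (1 + R) - ln (1 + X1)) \<le> 2 * C0 - P R" if "R \<ge> X1" for R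
    proof -
      have "c1 * (ln (1 + R) - ln (1 + X1)) \<le> a * b * (ln (1 + R) - ln (1 + X1))"
        using c1 that b(2) by (intro mult_right_mono) auto
      then show ?thesis using log[OF that] C00 by linarith
    qed
    show "c1 * R powr (3 - 2 * s) \<le> 2 * C0 - P R" if "R \<ge> 2 * X1" for R
      using power[OF that] C00 unfolding c1_def by linarith
  qed (use C00 c1 b(2) P2_le in auto)
qed

text \<open>Here \<open>beta\<close> tends to \<open>0\<close> while \<open>E1 - N\<close>
  converges, so the cross term vanishes. In the square term \<open>\<bar>E2 - P2\<bar>\<close> is at
  most a multiple of \<open>C0 - P\<close>, so after division by \<open>P^2\<close> it is of order
  \<open>1 / \<bar>P\<bar>\<close>.\<close>

lemma degenerate_limit:
  assumes s: "s \<le> 3 / 2"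
  shows "((\<lambda>R. L0_form p q f (psi \<phi> \<theta> R)) \<longlongrightarrow> L0_form p q f f) at_top"
proof -
  obtain C0 c1 X1 where c: "C0 \<ge> 0" "c1 > 0" "X1 \<ge> 1" and
    P2: "\<And>R. R \<ge> 1 \<Longrightarrow> \<bar>P2 R\<bar> \<le> C0 - P R" and
    log: "\<And>R. R \<ge> X1 \<Longrightarrow> c1 * (ln (1 + R) - ln (1 + X1)) \<le> C0 - P R" and
    power: "\<And>R. R \<ge> 2 * X1 \<Longrightarrow> c1 * R powr (3 - 2 * s) \<le> C0 - P R"
    using P_lower_bounds[OF s] by metis
  obtain M where M: "M \<ge> 0" "\<And>R. R \<ge> 1 \<Longrightarrow> \<bar>E2 R\<bar> \<le> M * R powr (3 - 2 * s)" using E2_bound by blast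
  have "filterlim (\<lambda>R. c1 * (- ln (1 + X1) + ln (1 + R))) at_top at_top"
    by (intro filterlim_tendsto_pos_mult_at_top[OF tendsto_const c(2)] filterlim_tendsto_add_at_top[OF tendsto_const]
        filterlim_compose[OF ln_at_top] filterlim_ident)
  then have "filterlim (\<lambda>R. C0 - P R) at_top at_top"
    by (rule filterlim_at_top_mono) (use log in \<open>auto intro!: eventually_mono[OF eventually_ge_at_top[of X1]]\<close>)
  then have "filterlim (\<lambda>R. - C0 + (C0 - P R)) at_top at_top"
    by (rule filterlim_tendsto_add_at_top[OF tendsto_const])
  then have P: "filterlim (\<lambda>R. - P R) at_top at_top" by simp
  have beta: "((\<lambda>R. m / (- P R)) \<longlongrightarrow> 0) at_top"
    by (rule real_tendsto_divide_at_top[OF tendsto_const P])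
  have inv: "((\<lambda>R. 1 / (- P R)) \<longlongrightarrow> 0) at_top"
    by (rule real_tendsto_divide_at_top[OF tendsto_const P])
  \<comment> \<open>\<open>M / c1\<close> bounds \<open>E2\<close> through the power bound on
    \<open>C0 - P\<close>, and \<open>1\<close> accounts for \<open>P2\<close>.\<close>
  define M' where "M' = M / c1 + 1"
  have sq: "((\<lambda>R. (m / (- P R))\<^sup>2 * (E2 R - P2 R)) \<longlongrightarrow> 0) at_top"
  proof (rule Lim_null_comparison)
    have "((\<lambda>R. m\<^sup>2 * M' * (C0 * (1 / (- P R))\<^sup>2 + 1 / (- P R))) \<longlongrightarrow> m\<^sup>2 * M' * (C0 * 0\<^sup>2 + 0)) at_top"
      by (intro tendsto_intros inv)
    then show "((\<lambda>R. m\<^sup>2 * M' * (C0 * (1 / (- P R))\<^sup>2 + 1 / (- P R))) \<longlongrightarrow> 0) at_top" by simp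
    have "eventually (\<lambda>R. - P R > 0) at_top" using P unfolding filterlim_at_top_dense by blast
    then show "eventually (\<lambda>R. norm ((m / (- P R))\<^sup>2 * (E2 R - P2 R)) \<le> m\<^sup>2 * M' * (C0 * (1 / (- P R))\<^sup>2 + 1 / (- P R))) at_top"
      using eventually_ge_at_top[of "2 * X1"]
    proof eventually_elim
      case (elim R)
      have R1: "R \<ge> 1" using elim c(3) by simp
      have "R powr (3 - 2 * s) \<le> (C0 - P R) / c1" using power[OF elim(2)] c(2) by (simp add: field_simps)
      then have "\<bar>E2 R\<bar> \<le> M * ((C0 - P R) / c1)"
        using M(2)[OF R1] mult_left_mono[OF _ M(1)] by (meson order_trans)
      then have b: "\<bar>E2 R - P2 R\<bar> \<le> M' * (C0 - P R)"
      proof -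
        have "M' * (C0 - P R) = M * ((C0 - P R) / c1) + (C0 - P R)" unfolding M'_def by (simp add: distrib_right)
        then show ?thesis using P2[OF R1] \<open>\<bar>E2 R\<bar> \<le> M * ((C0 - P R) / c1)\<close> by linarith
      qed
      have "norm ((m / (- P R))\<^sup>2 * (E2 R - P2 R)) = (m / (- P R))\<^sup>2 * \<bar>E2 R - P2 R\<bar>" by (simp add: abs_mult)
      also have "\<dots> \<le> (m / (- P R))\<^sup>2 * (M' * (C0 - P R))" by (intro mult_left_mono b) auto
      also have "\<dots> = m\<^sup>2 * M' * (C0 * (1 / (- P R))\<^sup>2 + 1 / (- P R))"
        using elim(1) by (simp add: field_simps power2_eq_square)
      finally show ?case .
    qed
  qed
  have "((\<lambda>R. L0_form p q f f + 2 * (m / (- P R)) * (E1 R - N R) + (m / (- P R))\<^sup>2 * (E2 R - P2 R)) \<longlongrightarrow>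
    L0_form p q f f + 2 * 0 * (0 - m) + 0) at_top"
    by (intro tendsto_intros beta E1_tendsto N_tendsto sq)
  then have lim: "((\<lambda>R. L0_form p q f f + 2 * (m / (- P R)) * (E1 R - N R) + (m / (- P R))\<^sup>2 * (E2 R - P2 R)) \<longlongrightarrow>
    L0_form p q f f) at_top" by simp
  show ?thesis
    by (rule Lim_transform_eventually[OF lim])
       (auto intro!: eventually_mono[OF eventually_gt_at_top[of 0]] simp: form_expansion beta_eq)
qed

end

theorem theorem4p1:
  fixes p q :: real and \<phi> :: "real \<Rightarrow> real \<Rightarrow> real" and \<theta> :: "real \<Rightarrow> real"
  assumes "1 < p" and "p < q" and "q < 5"
    and "\<And>\<omega>. \<omega> \<ge> 0 \<Longrightarrow> standing_wave p q \<omega> (\<phi> \<omega>)"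
    and "cutoff \<theta>"
    and "mass_deriv0 \<phi> \<noteq> 0"
  shows "(p < 7 / 3 \<longrightarrow>
            ((\<lambda>R. ereal (L0_form p q (\<phi> 0) (psi \<phi> \<theta> R))) \<longlongrightarrow>
               ereal (L0_form p q (\<phi> 0) (\<phi> 0))
                 + ereal (L2_norm (\<phi> 0) ^ 4) / mass_deriv0 \<phi>) at_top) \<and>
         (p \<ge> 7 / 3 \<longrightarrow>
            ((\<lambda>R. L0_form p q (\<phi> 0) (psi \<phi> \<theta> R)) \<longlongrightarrow> L0_form p q (\<phi> 0) (\<phi> 0)) at_top)"
proof -
  obtain \<theta>' \<theta>'' K where cut: "K \<ge> 0"
    "\<And>x. (\<theta> has_real_derivative \<theta>' x) (at x)" "\<And>x. (\<theta>' has_real_derivative \<theta>'' x) (at x)"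
    "continuous_on UNIV \<theta>''" "\<And>x. \<bar>\<theta>' x\<bar> \<le> K" "\<And>x. \<bar>\<theta>'' x\<bar> \<le> K"
    "\<And>x. \<bar>x\<bar> < 1 \<or> \<bar>x\<bar> > 2 \<Longrightarrow> \<theta>' x = 0 \<and> \<theta>'' x = 0"
    using cutoff_derivatives[OF assms(5)] by metis
  interpret cutoff_family p q \<phi> \<theta> \<theta>' \<theta>'' K
    by unfold_locales (use assms cut in auto)
  have "s > 3 / 2 \<longleftrightarrow> p < 7 / 3" unfolding s_def using assms(1) by (auto simp: field_simps)
  then show ?thesis using finite_limit degenerate_limit assms(6) by auto
qed

end
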